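(* Let $N=2$, $p\in[1,\infty)$, and for $i=1,2$ let $\mu_i\in\mathcal P(X_i)$ satisfy $\int\exp(\alpha\,d_{X_i}(\hat x_i,x_i)^p)\,\mu_i(dx_i)<\infty$ for some $\alpha>0$ and $\hat x_i\in X_i$. Let $\pi^*$ be the optimizer of $S_{\rm ent}(\mu_1,\mu_2,c)$ and $(\pi^n)_{n\ge0}$ the Sinkhorn iterates. (i) If $c:X\to[0,\infty)$ is continuous with growth of order $p$, then $\mathcal F(\pi^n)\to\mathcal F(\pi^* )$ and $\pi^n\to\pi^*$ in $W_p$ as $n\to\infty$. (ii) Let $1\le q\le p$ and $c=fg\ge0$ where $f,g:X\to\mathbb R$ are Lipschitz with growth of order $p-1$ (i.e. $|f(x)|,|g(x)|\le C(1+d_{X,p}(x,\hat x)^{p-1})$). Then there is a constant $c_0$ (independent of $n$) such that for all $n\ge2$, $$|\mathcal F(\pi^* )-\mathcal F(\pi^n)|\le c_0n^{-\frac1{2p}},\qquad W_q(\pi^*,\pi^n)\le c_0n^{-\frac1{4pq}}.$$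
   Context: $(X_1,d_{X_1}),(X_2,d_{X_2})$ Polish, $X=X_1\times X_2$, $d_{X,r}(x,y)=(d_{X_1}(x_1,y_1)^r+d_{X_2}(x_2,y_2)^r)^{1/r}$, $W_r$ on $X$ w.r.t. $d_{X,r}$. Growth of order $p$: $|c(x)|\le C(1+d_{X,p}(x,\hat x)^p)$. $S_{\rm ent}(\mu_1,\mu_2,c)=\inf_{\pi\in\Pi(\mu_1,\mu_2)}\int c\,d\pi+D_{\rm KL}(\pi,\mu_1\otimes\mu_2)$, $\Pi$ = couplings. $\mathcal F(\pi):=\int c\,d\pi+D_{\rm KL}(\pi,\mu_1\otimes\mu_2)$ for $\pi\in\mathcal P(X)$. Sinkhorn iterates: $\pi^0=P_c$ with $\frac{dP_c}{d(\mu_1\otimes\mu_2)}=e^{-c}/\int e^{-c}\,d(\mu_1\otimes\mu_2)$; for $n\ge1$, $\frac{d\pi^n}{d\pi^{n-1}}(x)=\frac{d\mu_1}{d\pi^{n-1}_1}(x_1)$ for $n$ odd and $\frac{d\pi^n}{d\pi^{n-1}}(x)=\frac{d\mu_2}{d\pi^{n-1}_2}(x_2)$ for $n$ even, where $\pi^{n-1}_i$ is the $i$-th marginal of $\pi^{n-1}$. *)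

theory Defs
  imports "HOL-Probability.Probability"
begin

definition dXr :: "real \<Rightarrow> ('a::metric_space \<times> 'b::metric_space) \<Rightarrow> ('a \<times> 'b) \<Rightarrow> real" where
  "dXr r x y = (dist (fst x) (fst y) powr r + dist (snd x) (snd y) powr r) powr (1 / r)"

definition couplings :: "'a::topological_space measure \<Rightarrow> 'b::topological_space measure \<Rightarrow> ('a \<times> 'b) measure set" where
  "couplings M N = {P. prob_space P \<and> sets P = sets (borel :: ('a \<times> 'b) measure)
      \<and> distr P borel fst = M \<and> distr P borel snd = N}"

definition Wass :: "real \<Rightarrow> ('a::metric_space \<times> 'b::metric_space) measure \<Rightarrow> ('a \<times> 'b) measure \<Rightarrow> ennreal" where
  "Wass r P Q = (let I = (INF \<gamma>\<in>couplings P Q. \<integral>\<^sup>+ z. ennreal (dXr r (fst z) (snd z) powr r) \<partial>\<gamma>)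
     in if I = \<infinity> then \<infinity> else ennreal (enn2real I powr (1 / r)))"

definition ext_integral :: "'a measure \<Rightarrow> ('a \<Rightarrow> real) \<Rightarrow> ereal" where
  "ext_integral M f = enn2ereal (\<integral>\<^sup>+ x. ennreal (max 0 (f x)) \<partial>M) - enn2ereal (\<integral>\<^sup>+ x. ennreal (max 0 (- f x)) \<partial>M)"

definition KL :: "'a measure \<Rightarrow> 'a measure \<Rightarrow> ereal" where
  "KL P N = (if sets P = sets N \<and> absolutely_continuous N P
     then ext_integral P (\<lambda>x. ln (enn2real (RN_deriv N P x))) else \<infinity>)"

definition Fent :: "('a::topological_space \<times> 'b::topological_space \<Rightarrow> real) \<Rightarrow> 'a measure \<Rightarrow> 'b measure \<Rightarrow> ('a \<times> 'b) measure \<Rightarrow> ereal" where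
  "Fent c \<mu>1 \<mu>2 \<pi> = ext_integral \<pi> c + KL \<pi> (\<mu>1 \<Otimes>\<^sub>M \<mu>2)"

definition S_ent :: "('a::topological_space \<times> 'b::topological_space \<Rightarrow> real) \<Rightarrow> 'a measure \<Rightarrow> 'b measure \<Rightarrow> ereal" where
  "S_ent c \<mu>1 \<mu>2 = (INF \<pi>\<in>couplings \<mu>1 \<mu>2. Fent c \<mu>1 \<mu>2 \<pi>)"

primrec sinkhorn :: "('a::topological_space \<times> 'b::topological_space \<Rightarrow> real) \<Rightarrow> 'a measure \<Rightarrow> 'b measure \<Rightarrow> nat \<Rightarrow> ('a \<times> 'b) measure" where
  "sinkhorn c \<mu>1 \<mu>2 0 = density (\<mu>1 \<Otimes>\<^sub>M \<mu>2)
      (\<lambda>x. ennreal (exp (- c x)) / (\<integral>\<^sup>+ y. ennreal (exp (- c y)) \<partial>(\<mu>1 \<Otimes>\<^sub>M \<mu>2)))"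
| "sinkhorn c \<mu>1 \<mu>2 (Suc n) =
     (if even n
      then density (sinkhorn c \<mu>1 \<mu>2 n) (\<lambda>x. RN_deriv (distr (sinkhorn c \<mu>1 \<mu>2 n) borel fst) \<mu>1 (fst x))
      else density (sinkhorn c \<mu>1 \<mu>2 n) (\<lambda>x. RN_deriv (distr (sinkhorn c \<mu>1 \<mu>2 n) borel snd) \<mu>2 (snd x)))"

definition growth :: "real \<Rightarrow> real \<Rightarrow> ('a::metric_space \<times> 'b::metric_space \<Rightarrow> real) \<Rightarrow> bool" where
  "growth p r h = (\<exists>C xh. \<forall>x. \<bar>h x\<bar> \<le> C * (1 + dXr p x xh powr r))"

definition lipschitzX :: "real \<Rightarrow> ('a::metric_space \<times> 'b::metric_space \<Rightarrow> real) \<Rightarrow> bool" where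
  "lipschitzX p h = (\<exists>L. \<forall>x y. \<bar>h x - h y\<bar> \<le> L * dXr p x y)"

end

theory Submission
  imports Defs
begin

text \<open>
  Write the iterates as \<open>\<pi>\<^sup>n = exp (a + b - c) (\<mu>\<^sub>1 \<otimes> \<mu>\<^sub>2)\<close>. Each half step increases the dual value
  \<open>\<integral>a d\<mu>\<^sub>1 + \<integral>b d\<mu>\<^sub>2 \<le> \<integral>c d(\<mu>\<^sub>1 \<otimes> \<mu>\<^sub>2)\<close> by the relative entropy of the prescribed marginal with respect
  to the current one, and by data processing these entropies, in either direction, are monotone along
  the iteration; hence the entropy of the unmatched marginal \<open>\<nu>\<close> of \<open>\<pi>\<^sup>n\<close> is \<open>O(1/n)\<close>. The exponential
  moments turn this into \<open>O(n\<^sup>-\<^sup>1\<^sup>/\<^sup>2)\<close> in total variation weighted by \<open>1 + d\<^sup>p\<close>.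

  The stability argument pushes a coupling through the total variation optimal kernel between \<open>\<mu>\<close> and
  \<open>\<nu>\<close>. This does not increase the entropy relative to the product of the marginals, and changes the
  transport cost by \<open>\<delta> = O(n\<^sup>-\<^sup>1\<^sup>/\<^sup>2 log n)\<close>, without the logarithm if \<open>c\<close> is bounded. Applied to \<open>\<pi>\<^sup>n\<close> it
  gives \<open>F(\<pi>\<^sup>*) \<le> F(\<pi>\<^sup>n) + \<delta>\<close>; applied to \<open>\<pi>\<^sup>*\<close> it gives a competitor \<open>s\<close> with the marginals of \<open>\<pi>\<^sup>n\<close>, for
  which the relative entropy of \<open>s\<close> with respect to \<open>\<pi>\<^sup>n\<close> equals \<open>F(s) - F(\<pi>\<^sup>n)\<close> and is therefore
  \<open>O(\<delta>)\<close>. A weighted Pinsker inequality and the total variation coupling then bound \<open>W\<^sub>q\<^sup>q\<close> by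
  \<open>O(\<delta>\<^sup>1\<^sup>/\<^sup>2)\<close>. In (ii), \<open>c = f g\<close> has growth of order \<open>p\<close>, and is bounded if \<open>p = 1\<close>;
  if \<open>p > 1\<close>, then \<open>\<delta> = O(n\<^sup>-\<^sup>1\<^sup>/\<^sup>2\<^sup>p)\<close> in spite of the logarithm.
\<close>

section \<open>Entropy inequalities\<close>

lemma xlnx_ge_tangent:
  fixes s t :: real
  assumes "0 < t" "0 \<le> s"
  shows "t * ln t + (1 + ln t) * (s - t) \<le> s * ln s"
proof (cases "s = 0")
  case False
  with assms have "0 < s" by simp
  then have "ln (t / s) \<le> t / s - 1" using assms by (intro ln_le_minus_one) simp
  then have "s * (ln t - ln s) \<le> s * (t / s - 1)"
    using \<open>0 < s\<close> assms by (intro mult_left_mono) (simp_all add: ln_div)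
  also have "\<dots> = t - s" using \<open>0 < s\<close> by (simp add: field_simps)
  finally show ?thesis by (simp add: algebra_simps)
qed (use assms in \<open>simp add: algebra_simps\<close>)

lemma xlnx_ge_minus_one: "0 \<le> s \<Longrightarrow> -1 \<le> s * ln (s::real)"
  using xlnx_ge_tangent[of 1 s] by simp

lemma convex_on_xlnx: "convex_on {0..} (\<lambda>s. s * ln (s::real))"
proof (rule convex_onI)
  fix w x y :: real
  assume w: "0 < w" "w < 1" and xy: "x \<in> {0..}" "y \<in> {0..}"
  define u where "u = (1 - w) * x + w * y"
  have "0 \<le> u" using w xy by (simp add: u_def)
  show "((1 - w) *\<^sub>R x + w *\<^sub>R y) * ln ((1 - w) *\<^sub>R x + w *\<^sub>R y)
      \<le> (1 - w) * (x * ln x) + w * (y * ln y)"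
  proof (cases "u = 0")
    case True
    then have "x = 0" "y = 0"
      using w xy by (simp_all add: u_def add_nonneg_eq_0_iff)
    then show ?thesis by simp
  next
    case False
    then have "0 < u" using \<open>0 \<le> u\<close> by simp
    have "u * ln u = (1 - w) * (u * ln u + (1 + ln u) * (x - u)) + w * (u * ln u + (1 + ln u) * (y - u))"
    proof -
      have "(1 - w) * (x - u) + w * (y - u) = 0" by (simp add: u_def algebra_simps)
      then have "(1 + ln u) * ((1 - w) * (x - u) + w * (y - u)) = 0" by simp
      then show ?thesis by (simp add: algebra_simps)
    qed
    also have "\<dots> \<le> (1 - w) * (x * ln x) + w * (y * ln y)"
      using w xy \<open>0 < u\<close> by (intro add_mono mult_left_mono xlnx_ge_tangent) auto
    finally show ?thesis by (simp add: u_def)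
  qed
qed simp

definition kl_div :: "real \<Rightarrow> real \<Rightarrow> real" where
  "kl_div s q = s * ln (s / q) - s + q"

lemma kl_div_scale: "0 < r \<Longrightarrow> kl_div (r * s) (r * q) = r * kl_div s q"
  by (simp add: kl_div_def algebra_simps)

text \<open>The Fenchel-Young inequality for \<open>t ln t - t + 1\<close>, whose conjugate is \<open>exp u - 1\<close>.\<close>

lemma mult_diff_le_kl_div:
  fixes s q u :: real
  assumes "0 \<le> s" "0 < q"
  shows "u * (s - q) \<le> kl_div s q + q * (exp u - 1 - u)"
proof -
  have "q * (exp u * u + (1 + u) * (s / q - exp u)) \<le> q * (s / q * ln (s / q))"
    using xlnx_ge_tangent[of "exp u" "s / q"] assms by (intro mult_left_mono) auto
  moreover have "q * (exp u * u + (1 + u) * (s / q - exp u)) = s + u * s - q * exp u"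
    using assms by (simp add: field_simps)
  ultimately show ?thesis using assms by (simp add: kl_div_def algebra_simps)
qed

lemma kl_div_nonneg: "0 \<le> s \<Longrightarrow> 0 < q \<Longrightarrow> 0 \<le> kl_div s q"
  using mult_diff_le_kl_div[of s q 0] by simp

lemma exp_remainder_le: "exp u - 1 - u \<le> u\<^sup>2 / 2 * exp \<bar>u::real\<bar>"
proof -
  obtain t where t: "\<bar>t\<bar> \<le> \<bar>u\<bar>" "exp u = (\<Sum>m<2. u ^ m / fact m) + exp t / fact 2 * u ^ 2"
    using Maclaurin_exp_le by blast
  have "exp u - 1 - u = u\<^sup>2 / 2 * exp t" using t(2) by (simp add: lessThan_nat_numeral)
  also have "\<dots> \<le> u\<^sup>2 / 2 * exp \<bar>u\<bar>" using t(1) by (intro mult_left_mono) auto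
  finally show ?thesis .
qed

lemma square_mult_exp_le:
  fixes l \<alpha> \<phi> :: real
  assumes "0 < \<alpha>" "l \<le> \<alpha> / 2" "0 \<le> \<phi>"
  shows "\<phi>\<^sup>2 * exp (l * \<phi>) \<le> 8 / \<alpha>\<^sup>2 * exp (\<alpha> * \<phi>)"
proof -
  have "(\<alpha> * \<phi> / 2)\<^sup>2 \<le> 2 * exp (\<alpha> * \<phi> / 2)"
    using exp_lower_Taylor_quadratic[of "\<alpha> * \<phi> / 2"] assms
    by (smt (verit) divide_nonneg_pos field_sum_of_halves mult_nonneg_nonneg)
  then have "\<phi>\<^sup>2 \<le> 8 / \<alpha>\<^sup>2 * exp (\<alpha> * \<phi> / 2)"
    using assms by (simp add: field_simps power2_eq_square)
  moreover have "exp (l * \<phi>) \<le> exp (\<alpha> * \<phi> / 2)"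
    using mult_right_mono[OF assms(2,3)] by simp
  ultimately have "\<phi>\<^sup>2 * exp (l * \<phi>) \<le> 8 / \<alpha>\<^sup>2 * exp (\<alpha> * \<phi> / 2) * exp (\<alpha> * \<phi> / 2)"
    by (intro mult_mono) auto
  also have "\<dots> = 8 / \<alpha>\<^sup>2 * exp (\<alpha> * \<phi>)" by (simp flip: exp_add)
  finally show ?thesis .
qed

lemma weighted_pinsker_pointwise:
  fixes l \<alpha> \<phi> s q :: real
  assumes l: "0 < l" "l \<le> \<alpha> / 2" and "0 \<le> \<phi>" "0 \<le> s" "0 < q"
  shows "\<phi> * \<bar>s - q\<bar> \<le> kl_div s q / l + l * (4 / \<alpha>\<^sup>2) * (q * exp (\<alpha> * \<phi>))"
proof -
  have bound: "u * (s - q) \<le> kl_div s q + q * ((l * \<phi>)\<^sup>2 / 2 * exp (l * \<phi>))" if "\<bar>u\<bar> = l * \<phi>" for u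
  proof -
    have "u\<^sup>2 = (l * \<phi>)\<^sup>2" using that by (metis power2_abs)
    then have "exp u - 1 - u \<le> (l * \<phi>)\<^sup>2 / 2 * exp (l * \<phi>)" using exp_remainder_le[of u] that by simp
    then have "q * (exp u - 1 - u) \<le> q * ((l * \<phi>)\<^sup>2 / 2 * exp (l * \<phi>))"
      using assms by (intro mult_left_mono) auto
    then show ?thesis using mult_diff_le_kl_div[of s q u] assms by linarith
  qed
  have "l * \<phi> * \<bar>s - q\<bar> = (if q \<le> s then l * \<phi> else - (l * \<phi>)) * (s - q)"
    by (simp add: algebra_simps)
  also have "\<dots> \<le> kl_div s q + q * ((l * \<phi>)\<^sup>2 / 2 * exp (l * \<phi>))"
    by (rule bound) (use assms in auto)
  finally have "l * \<phi> * \<bar>s - q\<bar> \<le> kl_div s q + l\<^sup>2 / 2 * q * (\<phi>\<^sup>2 * exp (l * \<phi>))"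
    by (simp add: power_mult_distrib mult_ac)
  also have "\<dots> \<le> kl_div s q + l\<^sup>2 / 2 * q * (8 / \<alpha>\<^sup>2 * exp (\<alpha> * \<phi>))"
    using assms by (intro add_left_mono mult_left_mono square_mult_exp_le) auto
  finally show ?thesis using l by (simp add: field_simps power2_eq_square)
qed

lemma weighted_pinsker:
  fixes s q \<phi> :: "'a \<Rightarrow> real"
  assumes \<phi>: "\<And>x. 0 \<le> \<phi> x" and s: "\<And>x. 0 \<le> s x" and q: "\<And>x. 0 < q x"
    and kl: "integrable M (\<lambda>x. kl_div (s x) (q x))" and exp: "integrable M (\<lambda>x. q x * exp (\<alpha> * \<phi> x))"
    and l: "0 < l" "l \<le> \<alpha> / 2"
  shows "(\<integral>\<^sup>+x. ennreal (\<phi> x * \<bar>s x - q x\<bar>) \<partial>M)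
    \<le> ennreal ((\<integral>x. kl_div (s x) (q x) \<partial>M) / l + l * (4 / \<alpha>\<^sup>2) * (\<integral>x. q x * exp (\<alpha> * \<phi> x) \<partial>M))"
proof -
  let ?U = "\<lambda>x. kl_div (s x) (q x) / l + l * (4 / \<alpha>\<^sup>2) * (q x * exp (\<alpha> * \<phi> x))"
  have "(\<integral>\<^sup>+x. ennreal (\<phi> x * \<bar>s x - q x\<bar>) \<partial>M) \<le> (\<integral>\<^sup>+x. ennreal (?U x) \<partial>M)"
    by (intro nn_integral_mono ennreal_leI weighted_pinsker_pointwise l \<phi> s q)
  also have "\<dots> = ennreal (\<integral>x. ?U x \<partial>M)"
    using kl exp l s q kl_div_nonneg[OF s q]
    by (intro nn_integral_eq_integral AE_I2) (auto intro!: add_nonneg_nonneg mult_nonneg_nonneg simp: less_imp_le)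
  finally show ?thesis using kl exp by simp
qed

lemma le_truncation_plus_exp:
  fixes \<alpha> \<phi> R :: real
  assumes "0 < \<alpha>" "0 \<le> \<phi>" "0 \<le> R"
  shows "\<phi> \<le> R + 2 / \<alpha> * exp (- \<alpha> * R / 2) * exp (\<alpha> * \<phi>)"
proof (cases "\<phi> \<le> R")
  case True
  then show ?thesis using assms by (simp add: add_increasing2)
next
  case False
  have "\<phi> \<le> 2 / \<alpha> * exp (\<alpha> * \<phi> / 2)"
    using exp_ge_add_one_self[of "\<alpha> * \<phi> / 2"] assms by (simp add: field_simps)
  also have "\<dots> \<le> 2 / \<alpha> * exp (\<alpha> * \<phi> - \<alpha> * R / 2)"
    using False assms by (intro mult_left_mono) (auto simp: field_simps)
  also have "\<dots> = 2 / \<alpha> * exp (- \<alpha> * R / 2) * exp (\<alpha> * \<phi>)" by (simp flip: exp_add)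
  finally show ?thesis using assms by simp
qed

lemma nn_integral_le_truncation_plus_exp:
  fixes \<phi> :: "'a \<Rightarrow> real"
  assumes [measurable]: "\<phi> \<in> borel_measurable M" "w \<in> borel_measurable M"
    and "0 < \<alpha>" "\<And>x. 0 \<le> \<phi> x" "0 \<le> R"
  shows "(\<integral>\<^sup>+x. ennreal (\<phi> x) * w x \<partial>M) \<le> ennreal R * (\<integral>\<^sup>+x. w x \<partial>M)
    + ennreal (2 / \<alpha> * exp (- \<alpha> * R / 2)) * (\<integral>\<^sup>+x. ennreal (exp (\<alpha> * \<phi> x)) * w x \<partial>M)"
proof -
  have "ennreal (\<phi> x) \<le> ennreal R + ennreal (2 / \<alpha> * exp (- \<alpha> * R / 2)) * ennreal (exp (\<alpha> * \<phi> x))" for x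
    using le_truncation_plus_exp[of \<alpha> "\<phi> x" R] assms
    by (simp add: ennreal_leI flip: ennreal_plus ennreal_mult)
  then have "ennreal (\<phi> x) * w x
      \<le> ennreal R * w x + ennreal (2 / \<alpha> * exp (- \<alpha> * R / 2)) * (ennreal (exp (\<alpha> * \<phi> x)) * w x)" for x
    unfolding mult.assoc[symmetric] distrib_right[symmetric] by (rule mult_right_mono) simp
  then have "(\<integral>\<^sup>+x. ennreal (\<phi> x) * w x \<partial>M) \<le> (\<integral>\<^sup>+x. ennreal R * w x
      + ennreal (2 / \<alpha> * exp (- \<alpha> * R / 2)) * (ennreal (exp (\<alpha> * \<phi> x)) * w x) \<partial>M)"
    by (rule nn_integral_mono)
  also have "\<dots> = ennreal R * (\<integral>\<^sup>+x. w x \<partial>M)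
    + ennreal (2 / \<alpha> * exp (- \<alpha> * R / 2)) * (\<integral>\<^sup>+x. ennreal (exp (\<alpha> * \<phi> x)) * w x \<partial>M)"
    by (simp add: nn_integral_add nn_integral_cmult)
  finally show ?thesis .
qed

lemma integrable_of_integrable_exp:
  fixes \<phi> :: "'a \<Rightarrow> real"
  assumes [measurable]: "\<phi> \<in> borel_measurable M"
    and "\<And>x. 0 \<le> \<phi> x" "0 < \<alpha>" "integrable M (\<lambda>x. exp (\<alpha> * \<phi> x))"
  shows "integrable M \<phi>"
proof (rule Bochner_Integration.integrable_bound)
  show "integrable M (\<lambda>x. exp (\<alpha> * \<phi> x) / \<alpha>)" using assms by simp
  have "\<phi> x \<le> exp (\<alpha> * \<phi> x) / \<alpha>" for x
  proof -
    have "\<alpha> * \<phi> x \<le> exp (\<alpha> * \<phi> x)" using exp_ge_add_one_self[of "\<alpha> * \<phi> x"] by linarith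
    then show ?thesis using assms(3) by (simp add: pos_le_divide_eq mult.commute)
  qed
  then show "AE x in M. norm (\<phi> x) \<le> norm (exp (\<alpha> * \<phi> x) / \<alpha>)" using assms by simp
qed simp

lemma (in prob_space) weighted_tv_le_entropy:
  fixes f \<phi> :: "'a \<Rightarrow> real"
  assumes f: "\<And>x. 0 \<le> f x" "integrable M f" "(\<integral>x. f x \<partial>M) = 1" "integrable M (\<lambda>x. f x * ln (f x))"
    and ent: "(\<integral>x. f x * ln (f x) \<partial>M) \<le> K * t\<^sup>2" and t: "0 < t" "t \<le> 1"
    and \<phi>: "\<And>x. 0 \<le> \<phi> x" "integrable M (\<lambda>x. exp (\<alpha> * \<phi> x))" and \<alpha>: "0 < \<alpha>"
  shows "(\<integral>\<^sup>+x. ennreal ((1 + \<phi> x) * \<bar>f x - 1\<bar>) \<partial>M)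
    \<le> ennreal ((2 * K / \<alpha> + 2 * exp \<alpha> * (\<integral>x. exp (\<alpha> * \<phi> x) \<partial>M) / \<alpha>) * t)"
proof -
  define l where "l = \<alpha> / 2 * t"
  have l: "0 < l" "l \<le> \<alpha> / 2" using t \<alpha> by (auto simp: l_def mult_left_le)
  have kl: "integrable M (\<lambda>x. kl_div (f x) 1)" "(\<integral>x. kl_div (f x) 1 \<partial>M) = (\<integral>x. f x * ln (f x) \<partial>M)"
    using f by (simp_all add: kl_div_def prob_space)
  have "(\<integral>\<^sup>+x. ennreal ((1 + \<phi> x) * \<bar>f x - 1\<bar>) \<partial>M)
      \<le> ennreal ((\<integral>x. kl_div (f x) 1 \<partial>M) / l + l * (4 / \<alpha>\<^sup>2) * (\<integral>x. 1 * exp (\<alpha> * (1 + \<phi> x)) \<partial>M))"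
    using \<phi> f kl l by (intro weighted_pinsker) (auto simp: distrib_left exp_add)
  also have "\<dots> \<le> ennreal (K * t\<^sup>2 / l + l * (4 / \<alpha>\<^sup>2) * (exp \<alpha> * (\<integral>x. exp (\<alpha> * \<phi> x) \<partial>M)))"
    using ent l \<phi> by (intro ennreal_leI add_mono divide_right_mono) (auto simp: kl distrib_left exp_add)
  also have "K * t\<^sup>2 / l + l * (4 / \<alpha>\<^sup>2) * (exp \<alpha> * (\<integral>x. exp (\<alpha> * \<phi> x) \<partial>M))
      = (2 * K / \<alpha> + 2 * exp \<alpha> * (\<integral>x. exp (\<alpha> * \<phi> x) \<partial>M) / \<alpha>) * t"
    using t \<alpha> by (simp add: l_def power2_eq_square field_simps)
  finally show ?thesis .
qed

lemma weighted_jensen: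
  fixes w g h :: "'a \<Rightarrow> real"
  assumes w: "integrable M w" "(\<integral>x. w x \<partial>M) = 1"
    and g: "integrable M (\<lambda>x. w x * g x)" and h: "integrable M (\<lambda>x. w x * h x)"
    and tangent: "AE x in M. w x * (v + slope * (g x - (\<integral>x. w x * g x \<partial>M))) \<le> w x * h x"
  shows "v \<le> (\<integral>x. w x * h x \<partial>M)"
proof -
  let ?t = "\<integral>x. w x * g x \<partial>M"
  have affine: "w x * (v + slope * (g x - ?t)) = (v - slope * ?t) * w x + slope * (w x * g x)" for x
    by (simp add: algebra_simps)
  have "v = (\<integral>x. (v - slope * ?t) * w x + slope * (w x * g x) \<partial>M)" using w g by simp
  also have "\<dots> \<le> (\<integral>x. w x * h x \<partial>M)"
    using w g h tangent unfolding affine by (intro integral_mono_AE) auto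
  finally show ?thesis .
qed

lemma jensen_xlnx:
  fixes w g :: "'a \<Rightarrow> real"
  assumes w: "\<And>x. 0 \<le> w x" "integrable M w" "(\<integral>x. w x \<partial>M) = 1"
    and g: "\<And>x. 0 \<le> g x" "integrable M (\<lambda>x. w x * g x)" "integrable M (\<lambda>x. w x * (g x * ln (g x)))"
  shows "(\<integral>x. w x * g x \<partial>M) * ln (\<integral>x. w x * g x \<partial>M) \<le> (\<integral>x. w x * (g x * ln (g x)) \<partial>M)"
    (is "?t * ln ?t \<le> _")
proof (cases "?t = 0")
  case True
  then have "AE x in M. w x * g x = 0"
    using g w by (subst (asm) integral_nonneg_eq_0_iff_AE) auto
  then have "AE x in M. w x * (g x * ln (g x)) = 0" by eventually_elim auto
  then show ?thesis using True by (simp add: integral_eq_zero_AE)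
next
  case False
  moreover have "0 \<le> ?t" using w g by (intro integral_nonneg_AE) auto
  ultimately have "0 < ?t" by simp
  then have "AE x in M. w x * (?t * ln ?t + (1 + ln ?t) * (g x - ?t)) \<le> w x * (g x * ln (g x))"
    using w g by (intro AE_I2 mult_left_mono xlnx_ge_tangent)
  then show ?thesis by (rule weighted_jensen[OF w(2,3) g(2,3)])
qed

lemma weighted_integral_pos:
  fixes w g :: "'a \<Rightarrow> real"
  assumes w: "\<And>x. 0 \<le> w x" "(\<integral>x. w x \<partial>M) \<noteq> 0"
    and g: "AE x in M. 0 < g x" "integrable M (\<lambda>x. w x * g x)"
  shows "0 < (\<integral>x. w x * g x \<partial>M)"
proof -
  have nonneg: "AE x in M. 0 \<le> w x * g x" using g(1) by eventually_elim (use w in auto)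
  have "(\<integral>x. w x * g x \<partial>M) \<noteq> 0"
  proof
    assume "(\<integral>x. w x * g x \<partial>M) = 0"
    then have "AE x in M. w x * g x = 0"
      using g nonneg by (subst (asm) integral_nonneg_eq_0_iff_AE) auto
    then have "AE x in M. w x = 0" using g(1) by eventually_elim auto
    then show False using w integral_eq_zero_AE by blast
  qed
  moreover have "0 \<le> (\<integral>x. w x * g x \<partial>M)" using nonneg by (rule integral_nonneg_AE)
  ultimately show ?thesis by simp
qed

lemma jensen_ln:
  fixes w g :: "'a \<Rightarrow> real"
  assumes w: "\<And>x. 0 \<le> w x" "integrable M w" "(\<integral>x. w x \<partial>M) = 1"
    and g: "AE x in M. 0 < g x" "integrable M (\<lambda>x. w x * g x)" "integrable M (\<lambda>x. w x * ln (g x))"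
  shows "(\<integral>x. w x * ln (g x) \<partial>M) \<le> ln (\<integral>x. w x * g x \<partial>M)" (is "_ \<le> ln ?t")
proof -
  have t: "0 < ?t" using w g by (intro weighted_integral_pos) auto
  have "AE x in M. w x * (- ln ?t + - (1 / ?t) * (g x - ?t)) \<le> w x * (- ln (g x))"
    using g(1)
  proof eventually_elim
    case (elim x)
    have "ln (g x / ?t) \<le> g x / ?t - 1" using elim t by (intro ln_le_minus_one) simp
    then have "- ln ?t + - (1 / ?t) * (g x - ?t) \<le> - ln (g x)"
      using elim t by (simp add: ln_div field_simps)
    then show ?case by (intro mult_left_mono w)
  qed
  from weighted_jensen[OF w(2,3) g(2) _ this] show ?thesis using g(3) by simp
qed

section \<open>Densities with prescribed marginals\<close>

context pair_sigma_finite
begin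

abbreviation "MM \<equiv> M1 \<Otimes>\<^sub>M M2"

definition has_marginals :: "('a \<Rightarrow> real) \<Rightarrow> ('b \<Rightarrow> real) \<Rightarrow> ('a \<Rightarrow> 'b \<Rightarrow> real) \<Rightarrow> bool" where
  "has_marginals g f s \<longleftrightarrow> case_prod s \<in> borel_measurable MM \<and> (\<forall>x y. 0 \<le> s x y)
    \<and> (\<forall>x. 0 \<le> g x) \<and> (\<forall>y. 0 \<le> f y)
    \<and> (AE x in M1. (\<integral>\<^sup>+y. ennreal (s x y) \<partial>M2) = ennreal (g x))
    \<and> (AE y in M2. (\<integral>\<^sup>+x. ennreal (s x y) \<partial>M1) = ennreal (f y))"

lemma has_marginalsD:
  assumes "has_marginals g f s"
  shows "case_prod s \<in> borel_measurable MM" "0 \<le> s x y" "0 \<le> g x" "0 \<le> f y"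
    "AE x in M1. (\<integral>\<^sup>+y. ennreal (s x y) \<partial>M2) = ennreal (g x)"
    "AE y in M2. (\<integral>\<^sup>+x. ennreal (s x y) \<partial>M1) = ennreal (f y)"
  using assms by (auto simp: has_marginals_def)

lemma measurable_case_prod_swap:
  "case_prod s \<in> borel_measurable MM \<Longrightarrow> case_prod (\<lambda>y x. s x y) \<in> borel_measurable (M2 \<Otimes>\<^sub>M M1)"
  using measurable_pair_swap[of "case_prod s"] by (simp add: case_prod_beta')

lemma nn_integral_swap:
  assumes "case_prod f \<in> borel_measurable MM"
  shows "(\<integral>\<^sup>+(y, x). f x y \<partial>(M2 \<Otimes>\<^sub>M M1)) = (\<integral>\<^sup>+(x, y). f x y \<partial>MM)"
  using M1.nn_integral_fst[OF measurable_case_prod_swap[OF assms]] nn_integral_snd[OF assms] by simp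

lemma integrable_swap:
  fixes f :: "'a \<Rightarrow> 'b \<Rightarrow> real"
  assumes "integrable MM (\<lambda>(x, y). f x y)"
  shows "integrable (M2 \<Otimes>\<^sub>M M1) (\<lambda>(y, x). f x y)"
  using integrable_product_swap[OF assms] by (simp only: case_prod_beta' prod.case fst_conv snd_conv)

lemma integral_swap:
  fixes f :: "'a \<Rightarrow> 'b \<Rightarrow> real"
  assumes "case_prod f \<in> borel_measurable MM"
  shows "(\<integral>(y, x). f x y \<partial>(M2 \<Otimes>\<^sub>M M1)) = (\<integral>(x, y). f x y \<partial>MM)"
  using integral_product_swap[OF assms] by (simp only: case_prod_beta' prod.case fst_conv snd_conv)

lemma has_marginals_swap:
  assumes "has_marginals g f s"
  shows "pair_sigma_finite.has_marginals M2 M1 f g (\<lambda>y x. s x y)"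
proof -
  interpret swapped: pair_sigma_finite M2 M1 ..
  show ?thesis
    unfolding swapped.has_marginals_def
    using has_marginalsD[OF assms] measurable_case_prod_swap[OF has_marginalsD(1)[OF assms]] by blast
qed

lemma nn_integral_mult_fst:
  assumes s: "has_marginals g f s" and [measurable]: "\<psi> \<in> borel_measurable M1"
  shows "(\<integral>\<^sup>+(x, y). \<psi> x * ennreal (s x y) \<partial>MM) = (\<integral>\<^sup>+x. \<psi> x * ennreal (g x) \<partial>M1)"
proof -
  note [measurable] = has_marginalsD(1)[OF s]
  have "(\<integral>\<^sup>+(x, y). \<psi> x * ennreal (s x y) \<partial>MM) = (\<integral>\<^sup>+x. \<integral>\<^sup>+y. \<psi> x * ennreal (s x y) \<partial>M2 \<partial>M1)"
    by (subst M2.nn_integral_fst[symmetric]) auto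
  also have "\<dots> = (\<integral>\<^sup>+x. \<psi> x * ennreal (g x) \<partial>M1)"
  proof (rule nn_integral_cong_AE)
    show "AE x in M1. (\<integral>\<^sup>+y. \<psi> x * ennreal (s x y) \<partial>M2) = \<psi> x * ennreal (g x)"
      using has_marginalsD(5)[OF s] AE_space by eventually_elim (simp add: nn_integral_cmult)
  qed
  finally show ?thesis .
qed

lemma nn_integral_mult_snd:
  assumes s: "has_marginals g f s" and [measurable]: "\<psi> \<in> borel_measurable M2"
  shows "(\<integral>\<^sup>+(x, y). \<psi> y * ennreal (s x y) \<partial>MM) = (\<integral>\<^sup>+y. \<psi> y * ennreal (f y) \<partial>M2)"
proof -
  note [measurable] = has_marginalsD(1)[OF s]
  interpret swapped: pair_sigma_finite M2 M1 ..
  have "(\<integral>\<^sup>+(x, y). \<psi> y * ennreal (s x y) \<partial>MM) = (\<integral>\<^sup>+(y, x). \<psi> y * ennreal (s x y) \<partial>(M2 \<Otimes>\<^sub>M M1))"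
    by (rule nn_integral_swap[symmetric]) simp
  also have "\<dots> = (\<integral>\<^sup>+y. \<psi> y * ennreal (f y) \<partial>M2)"
    by (rule swapped.nn_integral_mult_fst[OF has_marginals_swap[OF s]]) simp
  finally show ?thesis .
qed

lemma has_marginals_section_fst:
  assumes s: "has_marginals g f s"
  shows "AE x in M1. integrable M2 (s x) \<and> (\<integral>y. s x y \<partial>M2) = g x"
  using has_marginalsD(5)[OF s] AE_space
proof eventually_elim
  case (elim x)
  note [measurable] = has_marginalsD(1)[OF s]
  have "s x \<in> borel_measurable M2" using elim(2) by simp
  then show ?case
    using elim(1) has_marginalsD(2,3)[OF s]
    by (auto intro!: integrableI_nn_integral_finite simp: integral_eq_nn_integral)
qed

lemma has_marginals_section_snd:
  assumes s: "has_marginals g f s"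
  shows "AE y in M2. integrable M1 (\<lambda>x. s x y) \<and> (\<integral>x. s x y \<partial>M1) = f y"
proof -
  interpret swapped: pair_sigma_finite M2 M1 ..
  show ?thesis by (rule swapped.has_marginals_section_fst[OF has_marginals_swap[OF s]])
qed

lemma
  fixes u :: "'a \<Rightarrow> real"
  assumes s: "has_marginals g f s" and [measurable]: "u \<in> borel_measurable M1"
    and int: "integrable M1 (\<lambda>x. g x * u x)"
  shows integrable_mult_fst: "integrable MM (\<lambda>(x, y). s x y * u x)"
    and integral_mult_fst: "(\<integral>(x, y). s x y * u x \<partial>MM) = (\<integral>x. g x * u x \<partial>M1)"
proof -
  note [measurable] = has_marginalsD(1)[OF s] and nonneg = has_marginalsD(2,3)[OF s]
  have "(\<integral>\<^sup>+z. ennreal (norm (case z of (x, y) \<Rightarrow> s x y * u x)) \<partial>MM)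
      = (\<integral>\<^sup>+(x, y). ennreal \<bar>u x\<bar> * ennreal (s x y) \<partial>MM)"
    by (intro nn_integral_cong) (auto simp: abs_mult nonneg mult.commute simp flip: ennreal_mult)
  also have "\<dots> = (\<integral>\<^sup>+x. ennreal (norm (g x * u x)) \<partial>M1)"
    by (subst nn_integral_mult_fst[OF s]) (auto simp: abs_mult nonneg mult.commute simp flip: ennreal_mult)
  also have "\<dots> < \<infinity>" using int by (simp add: integrable_iff_bounded)
  finally show I: "integrable MM (\<lambda>(x, y). s x y * u x)" by (simp add: integrable_iff_bounded)
  have "(\<integral>(x, y). s x y * u x \<partial>MM) = (\<integral>x. \<integral>y. s x y * u x \<partial>M2 \<partial>M1)"
    using integral_fst[OF I] by simp
  also have "\<dots> = (\<integral>x. g x * u x \<partial>M1)"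
  proof (rule integral_cong_AE)
    show "AE x in M1. (\<integral>y. s x y * u x \<partial>M2) = g x * u x"
      using has_marginals_section_fst[OF s] by eventually_elim simp
  qed (use int in auto)
  finally show "(\<integral>(x, y). s x y * u x \<partial>MM) = (\<integral>x. g x * u x \<partial>M1)" .
qed

lemma
  fixes u :: "'b \<Rightarrow> real"
  assumes s: "has_marginals g f s" and u[measurable]: "u \<in> borel_measurable M2"
    and int: "integrable M2 (\<lambda>y. f y * u y)"
  shows integrable_mult_snd: "integrable MM (\<lambda>(x, y). s x y * u y)"
    and integral_mult_snd: "(\<integral>(x, y). s x y * u y \<partial>MM) = (\<integral>y. f y * u y \<partial>M2)"
proof -
  interpret swapped: pair_sigma_finite M2 M1 ..
  note [measurable] = has_marginalsD(1)[OF s]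
  note fst_swapped = swapped.integrable_mult_fst[OF has_marginals_swap[OF s] u int]
    swapped.integral_mult_fst[OF has_marginals_swap[OF s] u int]
  show "integrable MM (\<lambda>(x, y). s x y * u y)"
    by (rule swapped.integrable_swap[OF fst_swapped(1)])
  have "(\<integral>(x, y). s x y * u y \<partial>MM) = (\<integral>(y, x). s x y * u y \<partial>(M2 \<Otimes>\<^sub>M M1))"
    by (rule integral_swap[symmetric]) measurable
  also note fst_swapped(2)
  finally show "(\<integral>(x, y). s x y * u y \<partial>MM) = (\<integral>y. f y * u y \<partial>M2)" .
qed

end

context pair_prob_space
begin

lemma has_marginals_one: "has_marginals (\<lambda>_. 1) (\<lambda>_. 1) (\<lambda>_ _. 1)"
  by (simp add: has_marginals_def M1.emeasure_space_1 M2.emeasure_space_1)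

lemma
  fixes u :: "'a \<Rightarrow> real"
  assumes "integrable M1 u"
  shows integrable_comp_fst: "integrable MM (\<lambda>(x, y). u x)"
    and integral_comp_fst: "(\<integral>(x, y). u x \<partial>MM) = (\<integral>x. u x \<partial>M1)"
proof -
  have u: "u \<in> borel_measurable M1" "integrable M1 (\<lambda>x. 1 * u x)" using assms by simp_all
  show "integrable MM (\<lambda>(x, y). u x)" "(\<integral>(x, y). u x \<partial>MM) = (\<integral>x. u x \<partial>M1)"
    using integrable_mult_fst[OF has_marginals_one u] integral_mult_fst[OF has_marginals_one u] by simp_all
qed

lemma
  fixes u :: "'b \<Rightarrow> real"
  assumes "integrable M2 u"
  shows integrable_comp_snd: "integrable MM (\<lambda>(x, y). u y)"
    and integral_comp_snd: "(\<integral>(x, y). u y \<partial>MM) = (\<integral>y. u y \<partial>M2)"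
proof -
  have u: "u \<in> borel_measurable M2" "integrable M2 (\<lambda>y. 1 * u y)" using assms by simp_all
  show "integrable MM (\<lambda>(x, y). u y)" "(\<integral>(x, y). u y \<partial>MM) = (\<integral>y. u y \<partial>M2)"
    using integrable_mult_snd[OF has_marginals_one u] integral_mult_snd[OF has_marginals_one u] by simp_all
qed

lemma
  assumes s: "has_marginals (\<lambda>_. 1) f s"
  shows has_marginals_integrable: "integrable MM (case_prod s)"
    and has_marginals_integral: "integral\<^sup>L MM (case_prod s) = 1"
proof -
  have one: "(\<lambda>_. 1::real) \<in> borel_measurable M1" "integrable M1 (\<lambda>_. 1 * 1::real)" by simp_all
  show "integrable MM (case_prod s)" "integral\<^sup>L MM (case_prod s) = 1"
    using integrable_mult_fst[OF s one] integral_mult_fst[OF s one] by (simp_all add: M1.prob_space)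
qed

lemma nn_integral_has_marginals:
  assumes s: "has_marginals (\<lambda>_. 1) f s"
  shows "(\<integral>\<^sup>+(x, y). ennreal (s x y) \<partial>MM) = 1"
  using nn_integral_mult_fst[OF s, of "\<lambda>_. 1"] by (simp add: M1.emeasure_space_1)

lemma
  assumes s: "has_marginals g f s" and f: "f \<in> borel_measurable M2"
    and mass: "(\<integral>\<^sup>+(x, y). ennreal (s x y) \<partial>MM) = 1"
  shows marginal_snd_integrable: "integrable M2 f"
    and marginal_snd_integral: "(\<integral>y. f y \<partial>M2) = 1"
proof -
  have "(\<integral>\<^sup>+y. ennreal (f y) \<partial>M2) = 1"
    using nn_integral_mult_snd[OF s, of "\<lambda>_. 1"] mass by simp
  then show "integrable M2 f" "(\<integral>y. f y \<partial>M2) = 1"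
    using f has_marginalsD(4)[OF s]
    by (auto intro!: integrableI_nn_integral_finite[where x = 1] simp: integral_eq_nn_integral)
qed

lemma AE_integrable_section_of_xlnx:
  assumes s: "has_marginals (\<lambda>_. 1) f s"
    and u[measurable]: "case_prod u \<in> borel_measurable MM" and u_nonneg: "\<And>x y. 0 \<le> u x y"
    and ent: "integrable MM (\<lambda>(x, y). s x y * (u x y * ln (u x y)))"
  shows "AE x in M1. integrable M2 (\<lambda>y. s x y * u x y)"
  using has_marginals_section_fst[OF s] AE_integrable_fst[OF ent] AE_space
proof eventually_elim
  case (elim x)
  note [measurable] = has_marginalsD(1)[OF s] and s_nonneg = has_marginalsD(2)[OF s]
  have [measurable]: "s x \<in> borel_measurable M2" "u x \<in> borel_measurable M2"
    using elim(3) has_marginalsD(1)[OF s] u by simp_all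
  show ?case
  proof (rule Bochner_Integration.integrable_bound)
    show "integrable M2 (\<lambda>y. s x y * (u x y * ln (u x y)) + exp 1 * s x y)" using elim by simp
    have "norm (s x y * u x y) \<le> norm (s x y * (u x y * ln (u x y)) + exp 1 * s x y)" for y
    proof -
      have "2 * u x y \<le> u x y * ln (u x y) + exp 1"
        using xlnx_ge_tangent[of "exp 1" "u x y"] u_nonneg[of x y] by (simp add: algebra_simps)
      then have "u x y \<le> u x y * ln (u x y) + exp 1" using u_nonneg[of x y] by linarith
      then have "s x y * u x y \<le> s x y * (u x y * ln (u x y) + exp 1)"
        by (rule mult_left_mono) (rule s_nonneg)
      moreover have "0 \<le> s x y * u x y" using s_nonneg u_nonneg by simp
      ultimately show ?thesis unfolding real_norm_def by (simp add: algebra_simps)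
    qed
    then show "AE y in M2. norm (s x y * u x y) \<le> norm (s x y * (u x y * ln (u x y)) + exp 1 * s x y)" by simp
  qed measurable
qed

lemma
  fixes s u :: "'a \<Rightarrow> 'b \<Rightarrow> real"
  assumes s: "has_marginals (\<lambda>_. 1) f s"
    and u[measurable]: "case_prod u \<in> borel_measurable MM" and u_nonneg: "\<And>x y. 0 \<le> u x y"
    and ent: "integrable MM (\<lambda>(x, y). s x y * (u x y * ln (u x y)))"
  defines "v \<equiv> \<lambda>x. \<integral>y. s x y * u x y \<partial>M2"
  shows integrable_conditional_xlnx: "integrable M1 (\<lambda>x. v x * ln (v x))"
    and conditional_jensen_xlnx: "(\<integral>x. v x * ln (v x) \<partial>M1) \<le> (\<integral>(x, y). s x y * (u x y * ln (u x y)) \<partial>MM)"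
proof -
  note [measurable] = has_marginalsD(1)[OF s] and s_nonneg = has_marginalsD(2)[OF s]
  have [measurable]: "v \<in> borel_measurable M1" unfolding v_def by measurable
  have v_nonneg: "0 \<le> v x" for x
    unfolding v_def using s_nonneg u_nonneg by (intro integral_nonneg_AE) auto
  define J where "J x = (\<integral>y. s x y * (u x y * ln (u x y)) \<partial>M2)" for x
  have J: "integrable M1 J" "(\<integral>x. J x \<partial>M1) = (\<integral>(x, y). s x y * (u x y * ln (u x y)) \<partial>MM)"
    using integrable_fst[OF ent] integral_fst[OF ent] by (simp_all add: J_def[abs_def])
  have le_J: "AE x in M1. v x * ln (v x) \<le> J x"
    using has_marginals_section_fst[OF s] AE_integrable_fst[OF ent]
      AE_integrable_section_of_xlnx[OF s u u_nonneg ent]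
    unfolding v_def J_def by eventually_elim (intro jensen_xlnx, use s_nonneg u_nonneg in auto)
  show int: "integrable M1 (\<lambda>x. v x * ln (v x))"
  proof (rule Bochner_Integration.integrable_bound)
    show "integrable M1 (\<lambda>x. \<bar>J x\<bar> + 1)" using J by simp
    show "AE x in M1. norm (v x * ln (v x)) \<le> norm (\<bar>J x\<bar> + 1)"
      using le_J
    proof eventually_elim
      case (elim x)
      then show ?case using xlnx_ge_minus_one[OF v_nonneg[of x]] by (simp add: abs_real_def)
    qed
  qed measurable
  show "(\<integral>x. v x * ln (v x) \<partial>M1) \<le> (\<integral>(x, y). s x y * (u x y * ln (u x y)) \<partial>MM)"
    unfolding J(2)[symmetric] by (rule integral_mono_AE[OF int J(1) le_J])
qed

lemma conditional_jensen_ln: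
  fixes s u :: "'a \<Rightarrow> 'b \<Rightarrow> real"
  assumes s: "has_marginals (\<lambda>_. 1) f s"
    and u[measurable]: "case_prod u \<in> borel_measurable MM" and u_pos: "\<And>x y. 0 < u x y"
    and v: "AE x in M1. integrable M2 (\<lambda>y. s x y * u x y)"
      "integrable M1 (\<lambda>x. ln (\<integral>y. s x y * u x y \<partial>M2))"
    and ln_u: "integrable MM (\<lambda>(x, y). s x y * ln (u x y))"
  shows "(\<integral>(x, y). s x y * ln (u x y) \<partial>MM) \<le> (\<integral>x. ln (\<integral>y. s x y * u x y \<partial>M2) \<partial>M1)"
proof -
  note [measurable] = has_marginalsD(1)[OF s]
  have "AE x in M1. (\<integral>y. s x y * ln (u x y) \<partial>M2) \<le> ln (\<integral>y. s x y * u x y \<partial>M2)"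
    using has_marginals_section_fst[OF s] v(1) AE_integrable_fst[OF ln_u]
    by eventually_elim (intro jensen_ln, use has_marginalsD(2)[OF s] u_pos in auto)
  then have "(\<integral>x. \<integral>y. s x y * ln (u x y) \<partial>M2 \<partial>M1) \<le> (\<integral>x. ln (\<integral>y. s x y * u x y \<partial>M2) \<partial>M1)"
    using integrable_fst[OF ln_u] v(2) by (intro integral_mono_AE) auto
  then show ?thesis using integral_fst[OF ln_u] by simp
qed

end

section \<open>Total variation shadows\<close>

text \<open>The shadow is the image of \<open>s\<close> under the kernel that keeps \<open>y\<close> with probability \<open>min 1 (f2 / f1)\<close>
  and otherwise redraws it from the normalised positive part of \<open>f2 - f1\<close>. Read backwards, its density
  with respect to \<open>M1 \<otimes> f2 M2\<close> averages values of the density of \<open>s\<close> with respect to \<open>M1 \<otimes> f1 M2\<close>,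
  so the entropy bound is Jensen's inequality.\<close>

locale tv_shadow = pair_prob_space M1 M2 for M1 :: "'a measure" and M2 :: "'b measure" +
  fixes s :: "'a \<Rightarrow> 'b \<Rightarrow> real" and f1 f2 :: "'b \<Rightarrow> real"
  assumes s: "has_marginals (\<lambda>_. 1) f1 s"
    and f1_measurable[measurable]: "f1 \<in> borel_measurable M2" and f1_pos: "0 < f1 y"
    and f2_measurable[measurable]: "f2 \<in> borel_measurable M2" and f2_pos: "0 < f2 y"
    and f2_integrable: "integrable M2 f2" and f2_integral: "(\<integral>y. f2 y \<partial>M2) = 1"
    and ent: "integrable MM (\<lambda>(x, y). s x y * ln (s x y / f1 y))"
begin

definition "keep y = min (f1 y) (f2 y) / f1 y"
definition "gain y = max 0 (f2 y - f1 y)"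
definition "loss y = max 0 (f1 y - f2 y)"
definition "moved_mass = (\<integral>y. loss y \<partial>M2)"
definition "lost x y = (1 - keep y) * s x y"

text \<open>If \<open>moved_mass\<close> is zero, then \<open>x / 0 = 0\<close> makes \<open>redrawn\<close> vanish, and nothing is redrawn almost surely.\<close>

definition "redrawn x = (\<integral>y. lost x y \<partial>M2) / moved_mass"
definition "shadow x y = keep y * s x y + gain y * redrawn x"

lemma s_measurable[measurable]: "case_prod s \<in> borel_measurable MM" and s_nonneg: "0 \<le> s x y"
  using has_marginalsD[OF s] by auto

lemma shadow_measurable[measurable]:
  "keep \<in> borel_measurable M2" "gain \<in> borel_measurable M2" "loss \<in> borel_measurable M2"
  "case_prod lost \<in> borel_measurable MM" "redrawn \<in> borel_measurable M1"
  "case_prod shadow \<in> borel_measurable MM"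
proof -
  show [measurable]: "keep \<in> borel_measurable M2" "gain \<in> borel_measurable M2" "loss \<in> borel_measurable M2"
    unfolding keep_def[abs_def] gain_def[abs_def] loss_def[abs_def] by measurable
  show [measurable]: "case_prod lost \<in> borel_measurable MM" unfolding lost_def[abs_def] by measurable
  show [measurable]: "redrawn \<in> borel_measurable M1" unfolding redrawn_def[abs_def] by measurable
  show "case_prod shadow \<in> borel_measurable MM" unfolding shadow_def[abs_def] by measurable
qed

lemma keep_bounds: "0 \<le> keep y" "keep y \<le> 1"
  using f1_pos[of y] f2_pos[of y] by (auto simp: keep_def min_def)

lemma gain_loss: "0 \<le> gain y" "0 \<le> loss y" "gain y + loss y = \<bar>f1 y - f2 y\<bar>" "loss y - gain y = f1 y - f2 y"
  by (auto simp: gain_def loss_def)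

lemma loss_eq: "(1 - keep y) * f1 y = loss y"
  using f1_pos[of y] by (simp add: keep_def loss_def min_def max_def field_simps)

lemma f2_eq: "keep y * f1 y + gain y = f2 y"
  using f1_pos[of y] by (simp add: keep_def gain_def min_def max_def)

lemma lost_nonneg: "0 \<le> lost x y" and lost_le: "lost x y \<le> s x y"
  using keep_bounds[of y] s_nonneg[of x y] by (simp_all add: lost_def mult_left_le_one_le)

lemma redrawn_nonneg: "0 \<le> redrawn x"
  unfolding redrawn_def moved_mass_def
  by (intro divide_nonneg_nonneg integral_nonneg_AE AE_I2 lost_nonneg gain_loss)

lemma shadow_nonneg: "0 \<le> shadow x y"
  unfolding shadow_def by (intro add_nonneg_nonneg mult_nonneg_nonneg keep_bounds s_nonneg gain_loss redrawn_nonneg)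

lemma
  shows f1_integrable: "integrable M2 f1" and f1_integral: "(\<integral>y. f1 y \<partial>M2) = 1"
  using marginal_snd_integrable[OF s f1_measurable] marginal_snd_integral[OF s f1_measurable]
    nn_integral_has_marginals[OF s] by auto

lemma loss_integrable: "integrable M2 loss" and gain_integrable: "integrable M2 gain"
proof -
  have f: "integrable M2 (\<lambda>y. f1 y - f2 y)" "integrable M2 (\<lambda>y. f2 y - f1 y)"
    using f1_integrable f2_integrable by auto
  show "integrable M2 loss" "integrable M2 gain"
    using integrable_max[OF _ f(1), of "\<lambda>_. 0"] integrable_max[OF _ f(2), of "\<lambda>_. 0"]
    by (simp_all add: loss_def[abs_def] gain_def[abs_def])
qed

lemma moved_mass_eq_gain: "moved_mass = (\<integral>y. gain y \<partial>M2)"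
proof -
  have "(\<integral>y. loss y - gain y \<partial>M2) = (\<integral>y. f1 y - f2 y \<partial>M2)" by (simp add: gain_loss)
  also have "\<dots> = 0"
    using f1_integrable f1_integral f2_integrable f2_integral by simp
  finally show ?thesis using loss_integrable gain_integrable by (simp add: moved_mass_def)
qed

lemma moved_mass_nonneg: "0 \<le> moved_mass"
  unfolding moved_mass_def by (intro integral_nonneg_AE AE_I2 gain_loss)

lemma nn_integral_gain: "(\<integral>\<^sup>+y. ennreal (gain y) \<partial>M2) = ennreal moved_mass"
  unfolding moved_mass_eq_gain by (intro nn_integral_eq_integral gain_integrable AE_I2 gain_loss)

lemma nn_integral_loss: "(\<integral>\<^sup>+y. ennreal (loss y) \<partial>M2) = ennreal moved_mass"
  unfolding moved_mass_def by (intro nn_integral_eq_integral loss_integrable AE_I2 gain_loss)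

lemma lost_marginal_snd: "AE y in M2. (\<integral>\<^sup>+x. ennreal (lost x y) \<partial>M1) = ennreal (loss y)"
  using has_marginalsD(6)[OF s] AE_space
proof eventually_elim
  case (elim y)
  have "(\<integral>\<^sup>+x. ennreal (lost x y) \<partial>M1) = (\<integral>\<^sup>+x. ennreal (1 - keep y) * ennreal (s x y) \<partial>M1)"
    using keep_bounds[of y] s_nonneg by (simp add: lost_def ennreal_mult)
  also have "\<dots> = ennreal (1 - keep y) * ennreal (f1 y)"
    using elim by (simp add: nn_integral_cmult)
  also have "\<dots> = ennreal (loss y)"
    using keep_bounds[of y] f1_pos[of y] by (simp add: loss_eq flip: ennreal_mult)
  finally show ?case .
qed

lemma nn_integral_lost: "(\<integral>\<^sup>+(x, y). ennreal (lost x y) \<partial>MM) = ennreal moved_mass"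
proof -
  have "(\<integral>\<^sup>+(x, y). ennreal (lost x y) \<partial>MM) = (\<integral>\<^sup>+y. \<integral>\<^sup>+x. ennreal (lost x y) \<partial>M1 \<partial>M2)"
    by (subst nn_integral_snd[symmetric]) simp_all
  also have "\<dots> = ennreal moved_mass"
    using nn_integral_cong_AE[OF lost_marginal_snd] nn_integral_loss by simp
  finally show ?thesis .
qed

lemma lost_integrable: "integrable MM (case_prod lost)"
  using nn_integral_lost lost_nonneg by (intro integrableI_nn_integral_finite) (auto simp: case_prod_beta')

lemma AE_lost_eq_0:
  assumes "moved_mass = 0"
  shows "AE z in MM. case_prod lost z = 0"
proof -
  have "(\<integral>\<^sup>+z. ennreal (case_prod lost z) \<partial>MM) = 0"
    using nn_integral_lost assms by (simp add: case_prod_beta')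
  then have "AE z in MM. ennreal (case_prod lost z) = 0"
    by (subst (asm) nn_integral_0_iff_AE) auto
  then show ?thesis
  proof eventually_elim
    case (elim z)
    then show ?case using lost_nonneg[of "fst z" "snd z"] by (simp add: case_prod_beta' ennreal_eq_0_iff)
  qed
qed

lemma integral_lost: "AE x in M1. integrable M2 (lost x) \<and> (\<integral>y. lost x y \<partial>M2) = moved_mass * redrawn x"
proof (cases "moved_mass = 0")
  case False
  then show ?thesis using AE_integrable_fst[OF lost_integrable] by (simp add: redrawn_def)
next
  case True
  then have "(\<integral>\<^sup>+x. \<integral>\<^sup>+y. ennreal (lost x y) \<partial>M2 \<partial>M1) = 0"
    using nn_integral_lost M2.nn_integral_fst[of "\<lambda>(x, y). ennreal (lost x y)" M1] by simp
  then have "AE x in M1. (\<integral>\<^sup>+y. ennreal (lost x y) \<partial>M2) = 0"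
    by (subst (asm) nn_integral_0_iff_AE) auto
  then show ?thesis
    using AE_integrable_fst[OF lost_integrable]
    by eventually_elim (simp add: True integral_eq_nn_integral lost_nonneg)
qed

lemma has_marginals_lost: "has_marginals (\<lambda>x. moved_mass * redrawn x) loss lost"
proof -
  have "AE x in M1. (\<integral>\<^sup>+y. ennreal (lost x y) \<partial>M2) = ennreal (moved_mass * redrawn x)"
    using integral_lost by eventually_elim (simp add: nn_integral_eq_integral lost_nonneg)
  then show ?thesis
    using lost_marginal_snd moved_mass_nonneg redrawn_nonneg
    by (simp add: has_marginals_def lost_nonneg gain_loss)
qed

lemma nn_integral_redrawn: "ennreal moved_mass * (\<integral>\<^sup>+x. ennreal (redrawn x) \<partial>M1) = ennreal moved_mass"
proof -
  have "ennreal moved_mass * (\<integral>\<^sup>+x. ennreal (redrawn x) \<partial>M1) = (\<integral>\<^sup>+x. 1 * ennreal (moved_mass * redrawn x) \<partial>M1)"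
    by (simp add: nn_integral_cmult ennreal_mult moved_mass_nonneg redrawn_nonneg)
  also have "\<dots> = (\<integral>\<^sup>+(x, y). 1 * ennreal (lost x y) \<partial>MM)"
    by (rule nn_integral_mult_fst[OF has_marginals_lost, symmetric]) simp
  finally show ?thesis using nn_integral_lost by simp
qed

lemma has_marginals_gain: "has_marginals (\<lambda>x. moved_mass * redrawn x) gain (\<lambda>x y. gain y * redrawn x)"
proof -
  have "AE y in M2. (\<integral>\<^sup>+x. ennreal (gain y * redrawn x) \<partial>M1) = ennreal (gain y)"
  proof (cases "moved_mass = 0")
    case True
    then have "AE y in M2. gain y = 0"
      using moved_mass_eq_gain gain_integrable by (simp add: integral_nonneg_eq_0_iff_AE gain_loss)
    then show ?thesis by eventually_elim simp
  next
    case False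
    then have "(\<integral>\<^sup>+x. ennreal (redrawn x) \<partial>M1) = 1"
      using nn_integral_redrawn moved_mass_nonneg ennreal_mult_cancel_left[of "ennreal moved_mass" _ 1] by simp
    then show ?thesis by (simp add: ennreal_mult gain_loss redrawn_nonneg nn_integral_cmult)
  qed
  moreover have "(\<integral>\<^sup>+y. ennreal (gain y * redrawn x) \<partial>M2) = ennreal (moved_mass * redrawn x)" for x
    by (simp add: ennreal_mult gain_loss redrawn_nonneg moved_mass_nonneg nn_integral_multc nn_integral_gain)
  ultimately show ?thesis
    using moved_mass_nonneg by (simp add: has_marginals_def gain_loss redrawn_nonneg)
qed

lemma has_marginals_shadow: "has_marginals (\<lambda>_. 1) f2 shadow"
proof -
  have "AE x in M1. (\<integral>\<^sup>+y. ennreal (shadow x y) \<partial>M2) = ennreal 1"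
    using has_marginalsD(5)[OF s] has_marginalsD(5)[OF has_marginals_lost]
      has_marginalsD(5)[OF has_marginals_gain] AE_space
  proof eventually_elim
    case (elim x)
    have [measurable]: "s x \<in> borel_measurable M2" using elim(4) s_measurable by simp
    have "(\<integral>\<^sup>+y. ennreal (shadow x y) \<partial>M2)
        = (\<integral>\<^sup>+y. ennreal (keep y * s x y) \<partial>M2) + (\<integral>\<^sup>+y. ennreal (gain y * redrawn x) \<partial>M2)"
      unfolding shadow_def using keep_bounds s_nonneg gain_loss redrawn_nonneg
      by (simp add: nn_integral_add)
    also have "\<dots> = (\<integral>\<^sup>+y. ennreal (keep y * s x y) \<partial>M2) + (\<integral>\<^sup>+y. ennreal (lost x y) \<partial>M2)"
      using elim by simp
    also have "\<dots> = (\<integral>\<^sup>+y. ennreal (keep y * s x y) + ennreal (lost x y) \<partial>M2)"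
      unfolding lost_def by (rule nn_integral_add[symmetric]) measurable
    also have "\<dots> = (\<integral>\<^sup>+y. ennreal (s x y) \<partial>M2)"
      using keep_bounds s_nonneg lost_nonneg
      by (intro nn_integral_cong, subst ennreal_plus[symmetric]) (auto simp: lost_def algebra_simps)
    finally show ?case using elim by simp
  qed
  moreover have "AE y in M2. (\<integral>\<^sup>+x. ennreal (shadow x y) \<partial>M1) = ennreal (f2 y)"
    using has_marginalsD(6)[OF s] has_marginalsD(6)[OF has_marginals_gain] AE_space
  proof eventually_elim
    case (elim y)
    have "(\<integral>\<^sup>+x. ennreal (shadow x y) \<partial>M1)
        = (\<integral>\<^sup>+x. ennreal (keep y) * ennreal (s x y) + ennreal (gain y * redrawn x) \<partial>M1)"
      unfolding shadow_def using keep_bounds s_nonneg gain_loss redrawn_nonneg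
      by (simp add: ennreal_mult)
    also have "\<dots> = ennreal (keep y) * ennreal (f1 y) + ennreal (gain y)"
      using elim by (simp add: nn_integral_add nn_integral_cmult)
    also have "\<dots> = ennreal (f2 y)"
      using keep_bounds[of y] f1_pos[of y] gain_loss(1)[of y] f2_eq[of y] by (simp flip: ennreal_mult ennreal_plus)
    finally show ?case .
  qed
  ultimately show ?thesis
    using f2_pos by (simp add: has_marginals_def shadow_nonneg less_imp_le)
qed

lemma abs_shadow_diff_le: "\<bar>shadow x y - s x y\<bar> \<le> gain y * redrawn x + lost x y"
proof -
  have "shadow x y - s x y = gain y * redrawn x - lost x y" by (simp add: shadow_def lost_def algebra_simps)
  moreover have "0 \<le> gain y * redrawn x" "0 \<le> lost x y"
    by (simp_all add: gain_loss redrawn_nonneg lost_nonneg)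
  ultimately show ?thesis by linarith
qed

lemma weighted_shadow_diff_le:
  assumes \<psi>1[measurable]: "\<psi>1 \<in> borel_measurable M1" and \<psi>2[measurable]: "\<psi>2 \<in> borel_measurable M2"
  shows "(\<integral>\<^sup>+(x, y). (\<psi>1 x + \<psi>2 y) * ennreal \<bar>shadow x y - s x y\<bar> \<partial>MM)
    \<le> 2 * (\<integral>\<^sup>+(x, y). \<psi>1 x * ennreal (lost x y) \<partial>MM) + (\<integral>\<^sup>+y. \<psi>2 y * ennreal \<bar>f1 y - f2 y\<bar> \<partial>M2)"
proof -
  have "(\<integral>\<^sup>+(x, y). (\<psi>1 x + \<psi>2 y) * ennreal \<bar>shadow x y - s x y\<bar> \<partial>MM)
      \<le> (\<integral>\<^sup>+z. (case z of (x, y) \<Rightarrow> \<psi>1 x * ennreal (gain y * redrawn x)) + (case z of (x, y) \<Rightarrow> \<psi>1 x * ennreal (lost x y))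
        + ((case z of (x, y) \<Rightarrow> \<psi>2 y * ennreal (gain y * redrawn x)) + (case z of (x, y) \<Rightarrow> \<psi>2 y * ennreal (lost x y))) \<partial>MM)"
  proof (rule nn_integral_mono, clarify)
    fix x y
    have "ennreal \<bar>shadow x y - s x y\<bar> \<le> ennreal (gain y * redrawn x) + ennreal (lost x y)"
      using abs_shadow_diff_le by (simp add: ennreal_leI gain_loss redrawn_nonneg lost_nonneg flip: ennreal_plus)
    then have "(\<psi>1 x + \<psi>2 y) * ennreal \<bar>shadow x y - s x y\<bar>
        \<le> (\<psi>1 x + \<psi>2 y) * (ennreal (gain y * redrawn x) + ennreal (lost x y))"
      by (rule mult_left_mono) simp
    then show "(\<psi>1 x + \<psi>2 y) * ennreal \<bar>shadow x y - s x y\<bar>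
        \<le> \<psi>1 x * ennreal (gain y * redrawn x) + \<psi>1 x * ennreal (lost x y)
          + (\<psi>2 y * ennreal (gain y * redrawn x) + \<psi>2 y * ennreal (lost x y))"
      by (simp add: distrib_left distrib_right add_ac)
  qed
  also have "\<dots> = (\<integral>\<^sup>+(x, y). \<psi>1 x * ennreal (gain y * redrawn x) \<partial>MM) + (\<integral>\<^sup>+(x, y). \<psi>1 x * ennreal (lost x y) \<partial>MM)
      + ((\<integral>\<^sup>+(x, y). \<psi>2 y * ennreal (gain y * redrawn x) \<partial>MM) + (\<integral>\<^sup>+(x, y). \<psi>2 y * ennreal (lost x y) \<partial>MM))"
    by (simp add: nn_integral_add)
  also have "\<dots> = 2 * (\<integral>\<^sup>+(x, y). \<psi>1 x * ennreal (lost x y) \<partial>MM)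
      + ((\<integral>\<^sup>+y. \<psi>2 y * ennreal (gain y) \<partial>M2) + (\<integral>\<^sup>+y. \<psi>2 y * ennreal (loss y) \<partial>M2))"
    unfolding nn_integral_mult_fst[OF has_marginals_gain \<psi>1] nn_integral_mult_fst[OF has_marginals_lost \<psi>1]
      nn_integral_mult_snd[OF has_marginals_gain \<psi>2] nn_integral_mult_snd[OF has_marginals_lost \<psi>2]
    by (simp add: mult_2)
  also have "(\<integral>\<^sup>+y. \<psi>2 y * ennreal (gain y) \<partial>M2) + (\<integral>\<^sup>+y. \<psi>2 y * ennreal (loss y) \<partial>M2)
      = (\<integral>\<^sup>+y. \<psi>2 y * ennreal \<bar>f1 y - f2 y\<bar> \<partial>M2)"
    by (subst nn_integral_add[symmetric])
       (auto simp: gain_loss ennreal_plus[symmetric] distrib_left[symmetric] simp del: ennreal_plus)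
  finally show ?thesis .
qed

lemma shadow_xlnx_le:
  "shadow x y * ln (shadow x y / f2 y)
    \<le> keep y * (s x y * ln (s x y / f1 y)) + gain y * (redrawn x * ln (redrawn x))"
proof -
  define w where "w = gain y / f2 y"
  have f: "0 < f1 y" "0 < f2 y" by (rule f1_pos, rule f2_pos)
  have "0 \<le> keep y * f1 y" using f keep_bounds by simp
  then have "0 \<le> gain y" "gain y \<le> f2 y" using gain_loss(1)[of y] f2_eq[of y] by auto
  then have w: "0 \<le> w" "w \<le> 1" "w * f2 y = gain y" using f by (simp_all add: w_def)
  have w': "(1 - w) * f2 y = keep y * f1 y" using w(3) f2_eq[of y] by (simp add: algebra_simps)
  have mix: "shadow x y / f2 y = (1 - w) * (s x y / f1 y) + w * redrawn x"
  proof -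
    have "1 - w = keep y * f1 y / f2 y" using w' f by (simp add: field_simps)
    then show ?thesis using f by (simp add: shadow_def w_def add_divide_distrib)
  qed
  have "shadow x y * ln (shadow x y / f2 y) = f2 y * (shadow x y / f2 y * ln (shadow x y / f2 y))"
    using f by simp
  also have "\<dots> \<le> f2 y * ((1 - w) * (s x y / f1 y * ln (s x y / f1 y)) + w * (redrawn x * ln (redrawn x)))"
    unfolding mix using convex_onD[OF convex_on_xlnx w(1,2), of "s x y / f1 y" "redrawn x"] f s_nonneg redrawn_nonneg
    by (intro mult_left_mono) auto
  also have "\<dots> = (1 - w) * f2 y * (s x y / f1 y * ln (s x y / f1 y)) + w * f2 y * (redrawn x * ln (redrawn x))"
    by (simp add: algebra_simps)
  also have "\<dots> = keep y * (s x y * ln (s x y / f1 y)) + gain y * (redrawn x * ln (redrawn x))"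
    unfolding w(3) w' using f by simp
  finally show ?thesis .
qed

lemma shadow_xlnx_ge: "- f2 y \<le> shadow x y * ln (shadow x y / f2 y)"
proof -
  have "- 1 \<le> shadow x y / f2 y * ln (shadow x y / f2 y)"
    using shadow_nonneg f2_pos[of y] by (intro xlnx_ge_minus_one) (simp add: less_imp_le)
  then have "f2 y * - 1 \<le> f2 y * (shadow x y / f2 y * ln (shadow x y / f2 y))"
    using f2_pos[of y] by (intro mult_left_mono) (auto simp: less_imp_le)
  then show ?thesis using f2_pos[of y] by simp
qed

lemma keep_ent_integrable: "integrable MM (\<lambda>(x, y). keep y * (s x y * ln (s x y / f1 y)))"
proof (rule Bochner_Integration.integrable_bound[OF ent])
  show "AE z in MM. norm (case z of (x, y) \<Rightarrow> keep y * (s x y * ln (s x y / f1 y)))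
      \<le> norm (case z of (x, y) \<Rightarrow> s x y * ln (s x y / f1 y))"
    using keep_bounds by (intro AE_I2) (auto simp: abs_mult mult_left_le_one_le)
qed measurable

lemma lost_ent_integrable: "integrable MM (\<lambda>(x, y). lost x y * ln (s x y / f1 y))"
proof -
  have lost_eq: "(\<lambda>(x, y). lost x y * ln (s x y / f1 y)) = (\<lambda>z. (case z of (x, y) \<Rightarrow> s x y * ln (s x y / f1 y))
      - (case z of (x, y) \<Rightarrow> keep y * (s x y * ln (s x y / f1 y))))"
    by (auto simp: lost_def algebra_simps)
  show ?thesis
    unfolding lost_eq by (rule Bochner_Integration.integrable_diff[OF ent keep_ent_integrable])
qed

lemma
  shows redrawn_xlnx_integrable: "integrable M1 (\<lambda>x. redrawn x * ln (redrawn x))"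
    and redrawn_xlnx_le: "moved_mass * (\<integral>x. redrawn x * ln (redrawn x) \<partial>M1)
      \<le> (\<integral>(x, y). lost x y * ln (s x y / f1 y) \<partial>MM)"
proof -
  show "integrable M1 (\<lambda>x. redrawn x * ln (redrawn x))"
    "moved_mass * (\<integral>x. redrawn x * ln (redrawn x) \<partial>M1) \<le> (\<integral>(x, y). lost x y * ln (s x y / f1 y) \<partial>MM)"
  proof (atomize (full), cases "moved_mass = 0")
    case True
    have "AE z in MM. (case z of (x, y) \<Rightarrow> lost x y * ln (s x y / f1 y)) = 0"
      using AE_lost_eq_0[OF True] by eventually_elim auto
    then have "(\<integral>(x, y). lost x y * ln (s x y / f1 y) \<partial>MM) = 0"
      by (rule integral_eq_zero_AE)
    then show "integrable M1 (\<lambda>x. redrawn x * ln (redrawn x))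
        \<and> moved_mass * (\<integral>x. redrawn x * ln (redrawn x) \<partial>M1) \<le> (\<integral>(x, y). lost x y * ln (s x y / f1 y) \<partial>MM)"
      using True by (simp add: redrawn_def)
  next
    case False
    then have m: "0 < moved_mass" using moved_mass_nonneg by simp
    have "(\<integral>\<^sup>+y. ennreal (loss y / moved_mass) \<partial>M2) = ennreal (\<integral>y. loss y / moved_mass \<partial>M2)"
      using m loss_integrable gain_loss by (intro nn_integral_eq_integral) auto
    also have "\<dots> = 1" using m by (simp add: moved_mass_def)
    finally have weights: "has_marginals (\<lambda>_. 1) (\<lambda>y. loss y / moved_mass) (\<lambda>_ y. loss y / moved_mass)"
      using m gain_loss by (simp add: has_marginals_def M1.emeasure_space_1)
    have u: "case_prod (\<lambda>x y. s x y / f1 y) \<in> borel_measurable MM" "0 \<le> s x y / f1 y" for x y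
      using s_nonneg f1_pos[of y] by (auto simp: less_imp_le)
    have lost_eq: "loss y / moved_mass * (s x y / f1 y * t) = lost x y * t / moved_mass" for x y t
      using f1_pos[of y] by (simp add: lost_def flip: loss_eq)
    have ent': "integrable MM (\<lambda>(x, y). loss y / moved_mass * (s x y / f1 y * ln (s x y / f1 y)))"
      unfolding lost_eq using lost_ent_integrable by (simp add: case_prod_beta')
    have redrawn_eq: "(\<integral>y. loss y / moved_mass * (s x y / f1 y) \<partial>M2) = redrawn x" for x
      using lost_eq[of _ x 1] by (simp add: redrawn_def)
    show "integrable M1 (\<lambda>x. redrawn x * ln (redrawn x))
        \<and> moved_mass * (\<integral>x. redrawn x * ln (redrawn x) \<partial>M1) \<le> (\<integral>(x, y). lost x y * ln (s x y / f1 y) \<partial>MM)"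
      using integrable_conditional_xlnx[OF weights u ent'] conditional_jensen_xlnx[OF weights u ent'] m
      unfolding lost_eq redrawn_eq by (simp add: case_prod_beta' pos_le_divide_eq mult.commute)
  qed
qed

lemma
  shows gain_ent_integrable: "integrable MM (\<lambda>(x, y). gain y * (redrawn x * ln (redrawn x)))"
    and gain_ent_le: "(\<integral>(x, y). gain y * (redrawn x * ln (redrawn x)) \<partial>MM)
      \<le> (\<integral>(x, y). lost x y * ln (s x y / f1 y) \<partial>MM)"
proof -
  have weights: "has_marginals (\<lambda>_. moved_mass) gain (\<lambda>_ y. gain y)"
    by (simp add: has_marginals_def gain_loss moved_mass_nonneg nn_integral_gain M1.emeasure_space_1)
  have moved: "(\<lambda>x. redrawn x * ln (redrawn x)) \<in> borel_measurable M1"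
    "integrable M1 (\<lambda>x. moved_mass * (redrawn x * ln (redrawn x)))"
    using redrawn_xlnx_integrable by simp_all
  show "integrable MM (\<lambda>(x, y). gain y * (redrawn x * ln (redrawn x)))"
    by (rule integrable_mult_fst[OF weights moved])
  show "(\<integral>(x, y). gain y * (redrawn x * ln (redrawn x)) \<partial>MM) \<le> (\<integral>(x, y). lost x y * ln (s x y / f1 y) \<partial>MM)"
    using integral_mult_fst[OF weights moved] redrawn_xlnx_le by simp
qed

lemma
  shows shadow_ent_integrable: "integrable MM (\<lambda>(x, y). shadow x y * ln (shadow x y / f2 y))"
    and shadow_ent_le: "(\<integral>(x, y). shadow x y * ln (shadow x y / f2 y) \<partial>MM)
      \<le> (\<integral>(x, y). s x y * ln (s x y / f1 y) \<partial>MM)"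
proof -
  let ?keep = "\<lambda>(x, y). keep y * (s x y * ln (s x y / f1 y))"
    and ?gain = "\<lambda>(x, y). gain y * (redrawn x * ln (redrawn x))"
    and ?ent = "\<lambda>(x, y). shadow x y * ln (shadow x y / f2 y)"
  have upper: "integrable MM (\<lambda>z. ?keep z + ?gain z)"
    by (rule Bochner_Integration.integrable_add[OF keep_ent_integrable gain_ent_integrable])
  have le: "?ent z \<le> ?keep z + ?gain z" for z using shadow_xlnx_le by (simp add: case_prod_beta')
  have ge: "- f2 (snd z) \<le> ?ent z" for z using shadow_xlnx_ge by (simp add: case_prod_beta')
  show int: "integrable MM ?ent"
  proof (rule Bochner_Integration.integrable_bound)
    show "integrable MM (\<lambda>z. \<bar>?keep z + ?gain z\<bar> + \<bar>case z of (x, y) \<Rightarrow> f2 y\<bar>)"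
      using upper integrable_comp_snd[OF f2_integrable] by auto
    show "AE z in MM. norm (?ent z) \<le> norm (\<bar>?keep z + ?gain z\<bar> + \<bar>case z of (x, y) \<Rightarrow> f2 y\<bar>)"
    proof (rule AE_I2)
      fix z show "norm (?ent z) \<le> norm (\<bar>?keep z + ?gain z\<bar> + \<bar>case z of (x, y) \<Rightarrow> f2 y\<bar>)"
        using le[of z] ge[of z] unfolding real_norm_def case_prod_beta' by linarith
    qed
  qed measurable
  have "(\<integral>z. ?ent z \<partial>MM) \<le> (\<integral>z. ?keep z + ?gain z \<partial>MM)" by (rule integral_mono[OF int upper le])
  also have "\<dots> \<le> (\<integral>z. ?keep z \<partial>MM) + (\<integral>(x, y). lost x y * ln (s x y / f1 y) \<partial>MM)"
    using keep_ent_integrable gain_ent_integrable gain_ent_le by simp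
  also have "\<dots> = (\<integral>z. ?keep z + (case z of (x, y) \<Rightarrow> lost x y * ln (s x y / f1 y)) \<partial>MM)"
    using keep_ent_integrable lost_ent_integrable by simp
  also have "\<dots> = (\<integral>(x, y). s x y * ln (s x y / f1 y) \<partial>MM)"
    by (intro Bochner_Integration.integral_cong) (auto simp: lost_def algebra_simps)
  finally show "(\<integral>z. ?ent z \<partial>MM) \<le> (\<integral>(x, y). s x y * ln (s x y / f1 y) \<partial>MM)" .
qed

end

section \<open>Schroedinger potentials\<close>

locale cost_space = pair_prob_space M1 M2 for M1 :: "'a measure" and M2 :: "'b measure" +
  fixes c :: "'a \<Rightarrow> 'b \<Rightarrow> real" and \<phi>1 :: "'a \<Rightarrow> real" and \<phi>2 :: "'b \<Rightarrow> real" and \<alpha> B0 B1 :: real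
  assumes c_measurable[measurable]: "case_prod c \<in> borel_measurable MM"
    and c_nonneg: "0 \<le> c x y"
    and c_le: "c x y \<le> B0 + B1 * (\<phi>1 x + \<phi>2 y)"
    and B_nonneg: "0 \<le> B0" "0 \<le> B1"
    and \<phi>1_measurable[measurable]: "\<phi>1 \<in> borel_measurable M1"
    and \<phi>2_measurable[measurable]: "\<phi>2 \<in> borel_measurable M2"
    and \<phi>1_nonneg: "0 \<le> \<phi>1 x" and \<phi>2_nonneg: "0 \<le> \<phi>2 y"
    and \<alpha>_pos: "0 < \<alpha>"
    and exp_\<phi>1_integrable: "integrable M1 (\<lambda>x. exp (\<alpha> * \<phi>1 x))"
    and exp_\<phi>2_integrable: "integrable M2 (\<lambda>y. exp (\<alpha> * \<phi>2 y))"
begin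

lemma cost_space_swap: "cost_space M2 M1 (\<lambda>y x. c x y) \<phi>2 \<phi>1 \<alpha> B0 B1"
proof -
  interpret swapped: pair_prob_space M2 M1 ..
  show ?thesis
  proof unfold_locales
    show "(\<lambda>(y, x). c x y) \<in> borel_measurable (M2 \<Otimes>\<^sub>M M1)"
      by (rule measurable_case_prod_swap) measurable
    show "c x y \<le> B0 + B1 * (\<phi>2 y + \<phi>1 x)" for y x using c_le[of x y] by (simp add: add.commute)
  qed (use c_nonneg B_nonneg \<phi>1_nonneg \<phi>2_nonneg \<alpha>_pos exp_\<phi>1_integrable exp_\<phi>2_integrable in auto)
qed

lemma \<phi>1_integrable: "integrable M1 \<phi>1" and \<phi>2_integrable: "integrable M2 \<phi>2"
  using integrable_of_integrable_exp[OF \<phi>1_measurable \<phi>1_nonneg \<alpha>_pos exp_\<phi>1_integrable]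
    integrable_of_integrable_exp[OF \<phi>2_measurable \<phi>2_nonneg \<alpha>_pos exp_\<phi>2_integrable] by auto

lemma norm_c_le: "norm (c x y) \<le> norm (B0 + B1 * (\<phi>1 x + \<phi>2 y))"
  using c_nonneg[of x y] c_le[of x y] unfolding real_norm_def by linarith

lemma c_integrable_fst: "y \<in> space M2 \<Longrightarrow> integrable M1 (\<lambda>x. c x y)"
  by (rule Bochner_Integration.integrable_bound[where f = "\<lambda>x. B0 + B1 * (\<phi>1 x + \<phi>2 y)", OF _ _ AE_I2[OF norm_c_le]])
     (use \<phi>1_integrable in simp_all)

lemma c_integral_fst_le:
  assumes y: "y \<in> space M2"
  shows "(\<integral>x. c x y \<partial>M1) \<le> B0 + B1 * ((\<integral>x. \<phi>1 x \<partial>M1) + \<phi>2 y)"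
proof -
  have "(\<integral>x. c x y \<partial>M1) \<le> (\<integral>x. B0 + B1 * (\<phi>1 x + \<phi>2 y) \<partial>M1)"
    using c_integrable_fst[OF y] \<phi>1_integrable c_le by (intro integral_mono) auto
  also have "\<dots> = B0 + B1 * ((\<integral>x. \<phi>1 x \<partial>M1) + \<phi>2 y)"
    using \<phi>1_integrable by (simp add: M1.prob_space algebra_simps)
  finally show ?thesis .
qed

lemma c_integrable: "integrable MM (\<lambda>(x, y). c x y)"
proof (rule Bochner_Integration.integrable_bound)
  show "integrable MM (\<lambda>z. B0 + B1 * ((case z of (x, y) \<Rightarrow> \<phi>1 x) + (case z of (x, y) \<Rightarrow> \<phi>2 y)))"
    using integrable_comp_fst[OF \<phi>1_integrable] integrable_comp_snd[OF \<phi>2_integrable] by auto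
  show "AE z in MM. norm (case z of (x, y) \<Rightarrow> c x y)
      \<le> norm (B0 + B1 * ((case z of (x, y) \<Rightarrow> \<phi>1 x) + (case z of (x, y) \<Rightarrow> \<phi>2 y)))"
    by (rule AE_I2) (simp only: case_prod_beta' norm_c_le)
qed simp

definition gibbs :: "('a \<Rightarrow> real) \<Rightarrow> ('b \<Rightarrow> real) \<Rightarrow> 'a \<Rightarrow> 'b \<Rightarrow> real" where
  "gibbs a b x y = exp (a x + b y - c x y)"

text \<open>The value 1 is taken on null sets only; it makes the marginal densities positive everywhere.\<close>

definition gibbs_fst :: "('a \<Rightarrow> real) \<Rightarrow> ('b \<Rightarrow> real) \<Rightarrow> 'a \<Rightarrow> real" where
  "gibbs_fst a b x = (let m = (\<integral>y. gibbs a b x y \<partial>M2) in if 0 < m then m else 1)"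

definition gibbs_snd :: "('a \<Rightarrow> real) \<Rightarrow> ('b \<Rightarrow> real) \<Rightarrow> 'b \<Rightarrow> real" where
  "gibbs_snd a b y = (let m = (\<integral>x. gibbs a b x y \<partial>M1) in if 0 < m then m else 1)"

definition potentials :: "('a \<Rightarrow> real) \<Rightarrow> ('b \<Rightarrow> real) \<Rightarrow> bool" where
  "potentials a b \<longleftrightarrow> integrable M1 a \<and> integrable M2 b
    \<and> (\<exists>A. AE x in M1. a x \<le> A * (1 + \<phi>1 x)) \<and> (\<exists>A. AE y in M2. b y \<le> A * (1 + \<phi>2 y))
    \<and> (\<integral>\<^sup>+(x, y). ennreal (gibbs a b x y) \<partial>MM) = 1"

lemma gibbs_pos: "0 < gibbs a b x y" and gibbs_fst_pos: "0 < gibbs_fst a b x" and gibbs_snd_pos: "0 < gibbs_snd a b y"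
  by (simp_all add: gibbs_def gibbs_fst_def gibbs_snd_def Let_def)

lemma gibbs_swap:
  "cost_space.gibbs (\<lambda>y x. c x y) b a = (\<lambda>y x. gibbs a b x y)"
  "cost_space.gibbs_fst M1 (\<lambda>y x. c x y) b a = gibbs_snd a b"
  "cost_space.gibbs_snd M2 (\<lambda>y x. c x y) b a = gibbs_fst a b"
proof -
  interpret swapped: cost_space M2 M1 "\<lambda>y x. c x y" \<phi>2 \<phi>1 \<alpha> B0 B1 by (rule cost_space_swap)
  show gibbs: "swapped.gibbs b a = (\<lambda>y x. gibbs a b x y)"
    by (simp add: gibbs_def swapped.gibbs_def fun_eq_iff add.commute)
  show "swapped.gibbs_fst b a = gibbs_snd a b" "swapped.gibbs_snd b a = gibbs_fst a b"
    by (simp_all add: gibbs_fst_def gibbs_snd_def swapped.gibbs_fst_def swapped.gibbs_snd_def fun_eq_iff gibbs)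
qed

lemma potentialsD:
  assumes "potentials a b"
  shows "integrable M1 a" "integrable M2 b" "a \<in> borel_measurable M1" "b \<in> borel_measurable M2"
    "(\<integral>\<^sup>+(x, y). ennreal (gibbs a b x y) \<partial>MM) = 1"
  using assms by (auto simp: potentials_def)

lemma gibbs_measurable[measurable]:
  assumes [measurable]: "a \<in> borel_measurable M1" "b \<in> borel_measurable M2"
  shows "case_prod (gibbs a b) \<in> borel_measurable MM"
  unfolding gibbs_def[abs_def] by measurable

lemma gibbs_snd_measurable[measurable]:
  assumes [measurable]: "a \<in> borel_measurable M1" "b \<in> borel_measurable M2"
  shows "gibbs_snd a b \<in> borel_measurable M2"
proof -
  have [measurable]: "(\<lambda>(y, x). gibbs a b x y) \<in> borel_measurable (M2 \<Otimes>\<^sub>M M1)"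
    by (rule measurable_case_prod_swap) measurable
  show ?thesis unfolding gibbs_snd_def[abs_def] Let_def by measurable
qed

lemma potentials_swap:
  assumes "potentials a b"
  shows "cost_space.potentials M2 M1 (\<lambda>y x. c x y) \<phi>2 \<phi>1 b a"
proof -
  interpret swapped: cost_space M2 M1 "\<lambda>y x. c x y" \<phi>2 \<phi>1 \<alpha> B0 B1 by (rule cost_space_swap)
  note [measurable] = potentialsD(3,4)[OF assms]
  have "(\<integral>\<^sup>+(y, x). ennreal (gibbs a b x y) \<partial>(M2 \<Otimes>\<^sub>M M1)) = 1"
    by (subst nn_integral_swap) (simp_all add: potentialsD(5)[OF assms])
  then show ?thesis using assms unfolding potentials_def swapped.potentials_def gibbs_swap by blast
qed

lemma gibbs_integrable:
  assumes "potentials a b"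
  shows "integrable MM (case_prod (gibbs a b))" "integral\<^sup>L MM (case_prod (gibbs a b)) = 1"
proof -
  note [measurable] = potentialsD(3,4)[OF assms]
  have "(\<integral>\<^sup>+z. ennreal (case_prod (gibbs a b) z) \<partial>MM) = ennreal 1"
    using potentialsD(5)[OF assms] by (simp add: case_prod_beta')
  then show "integrable MM (case_prod (gibbs a b))" "integral\<^sup>L MM (case_prod (gibbs a b)) = 1"
    by (auto intro!: integrableI_nn_integral_finite simp: integral_eq_nn_integral case_prod_beta' less_imp_le gibbs_pos)
qed

lemma sum_potentials_le:
  assumes ab: "potentials a b"
  shows "(\<integral>x. a x \<partial>M1) + (\<integral>y. b y \<partial>M2) \<le> (\<integral>(x, y). c x y \<partial>MM)"
proof -
  note a = potentialsD(1)[OF ab] and b = potentialsD(2)[OF ab] and gibbs = gibbs_integrable[OF ab]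
  have "(\<integral>z. (case z of (x, y) \<Rightarrow> a x) + (case z of (x, y) \<Rightarrow> b y) - (case z of (x, y) \<Rightarrow> c x y) \<partial>MM)
      \<le> (\<integral>z. case_prod (gibbs a b) z - 1 \<partial>MM)"
  proof (rule integral_mono)
    fix z :: "'a \<times> 'b"
    show "(case z of (x, y) \<Rightarrow> a x) + (case z of (x, y) \<Rightarrow> b y) - (case z of (x, y) \<Rightarrow> c x y) \<le> case_prod (gibbs a b) z - 1"
      using exp_ge_add_one_self[of "a (fst z) + b (snd z) - c (fst z) (snd z)"]
      unfolding gibbs_def case_prod_beta' by linarith
  qed (use gibbs integrable_comp_fst[OF a] integrable_comp_snd[OF b] c_integrable in auto)
  also have "\<dots> = 0" using gibbs prob_space by simp
  finally show ?thesis
    using integrable_comp_fst[OF a] integrable_comp_snd[OF b] integral_comp_fst[OF a] integral_comp_snd[OF b] c_integrable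
    by simp
qed

lemma gibbs_snd_eq_integral:
  assumes ab: "potentials a b"
  shows "AE y in M2. integrable M1 (\<lambda>x. gibbs a b x y) \<and> gibbs_snd a b y = (\<integral>x. gibbs a b x y \<partial>M1)"
  using AE_integrable_snd[OF gibbs_integrable(1)[OF ab]]
proof eventually_elim
  case (elim y)
  have "0 < (\<integral>x. 1 * gibbs a b x y \<partial>M1)"
    using elim by (intro weighted_integral_pos) (simp_all add: gibbs_pos M1.prob_space)
  then show ?case using elim by (simp add: gibbs_snd_def)
qed

lemma has_marginals_gibbs:
  assumes ab: "potentials a b"
  shows "has_marginals (gibbs_fst a b) (gibbs_snd a b) (gibbs a b)"
proof -
  interpret swapped: cost_space M2 M1 "\<lambda>y x. c x y" \<phi>2 \<phi>1 \<alpha> B0 B1 by (rule cost_space_swap)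
  have "AE y in M2. (\<integral>\<^sup>+x. ennreal (gibbs a b x y) \<partial>M1) = ennreal (gibbs_snd a b y)"
    using gibbs_snd_eq_integral[OF ab]
    by eventually_elim (simp add: nn_integral_eq_integral gibbs_pos less_imp_le)
  moreover have "AE x in M1. (\<integral>\<^sup>+y. ennreal (gibbs a b x y) \<partial>M2) = ennreal (gibbs_fst a b x)"
    using swapped.gibbs_snd_eq_integral[OF potentials_swap[OF ab]] unfolding gibbs_swap
    by eventually_elim (simp add: nn_integral_eq_integral gibbs_pos less_imp_le)
  ultimately show ?thesis
    using potentialsD(3,4)[OF ab] gibbs_pos gibbs_fst_pos gibbs_snd_pos
    by (simp add: has_marginals_def less_imp_le)
qed

lemma
  assumes ab: "potentials a b"
  shows gibbs_snd_integrable: "integrable M2 (gibbs_snd a b)"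
    and gibbs_snd_integral: "(\<integral>y. gibbs_snd a b y \<partial>M2) = 1"
  using marginal_snd_integrable[OF has_marginals_gibbs[OF ab]] marginal_snd_integral[OF has_marginals_gibbs[OF ab]]
    gibbs_snd_measurable[OF potentialsD(3,4)[OF ab]] potentialsD(5)[OF ab] by auto

lemma ln_gibbs_snd_ge:
  assumes ab: "potentials a b"
  shows "AE y in M2. (\<integral>x. a x \<partial>M1) + b y - (B0 + B1 * ((\<integral>x. \<phi>1 x \<partial>M1) + \<phi>2 y)) \<le> ln (gibbs_snd a b y)"
  using gibbs_snd_eq_integral[OF ab] AE_space
proof eventually_elim
  case (elim y)
  note a = potentialsD(1)[OF ab] and c = c_integrable_fst[OF elim(2)]
  have "(\<integral>x. a x + b y - c x y \<partial>M1) = (\<integral>x. 1 * ln (gibbs a b x y) \<partial>M1)" by (simp add: gibbs_def)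
  also have "\<dots> \<le> ln (\<integral>x. 1 * gibbs a b x y \<partial>M1)"
    using a c elim by (intro jensen_ln) (simp_all add: gibbs_def M1.prob_space)
  also have "\<dots> = ln (gibbs_snd a b y)" using elim by simp
  finally have "(\<integral>x. a x \<partial>M1) + b y - (\<integral>x. c x y \<partial>M1) \<le> ln (gibbs_snd a b y)"
    using a c by (simp add: M1.prob_space)
  then show ?case using c_integral_fst_le[OF elim(2)] by linarith
qed

lemma
  assumes ab: "potentials a b"
  shows ln_gibbs_snd_integrable: "integrable M2 (\<lambda>y. ln (gibbs_snd a b y))"
    and ln_gibbs_snd_integral_le: "(\<integral>y. ln (gibbs_snd a b y) \<partial>M2) \<le> 0"
proof -
  note [measurable] = potentialsD(3,4)[OF ab]
  have upper: "ln (gibbs_snd a b y) \<le> gibbs_snd a b y - 1" for y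
    using gibbs_snd_pos by (rule ln_le_minus_one)
  let ?lower = "\<lambda>y. (\<integral>x. a x \<partial>M1) + b y - (B0 + B1 * ((\<integral>x. \<phi>1 x \<partial>M1) + \<phi>2 y))"
  show int: "integrable M2 (\<lambda>y. ln (gibbs_snd a b y))"
  proof (rule Bochner_Integration.integrable_bound)
    show "integrable M2 (\<lambda>y. \<bar>gibbs_snd a b y\<bar> + \<bar>?lower y\<bar>)"
      using gibbs_snd_integrable[OF ab] potentialsD(2)[OF ab] \<phi>2_integrable by auto
    show "AE y in M2. norm (ln (gibbs_snd a b y)) \<le> norm (\<bar>gibbs_snd a b y\<bar> + \<bar>?lower y\<bar>)"
      using ln_gibbs_snd_ge[OF ab]
    proof eventually_elim
      case (elim y)
      then show ?case using upper[of y] unfolding real_norm_def by linarith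
    qed
  qed simp
  have "(\<integral>y. ln (gibbs_snd a b y) \<partial>M2) \<le> (\<integral>y. gibbs_snd a b y - 1 \<partial>M2)"
    using int gibbs_snd_integrable[OF ab] upper by (intro integral_mono) auto
  then show "(\<integral>y. ln (gibbs_snd a b y) \<partial>M2) \<le> 0"
    using gibbs_snd_integrable[OF ab] gibbs_snd_integral[OF ab] M2.prob_space by simp
qed

definition "normalize_fst a b = (\<lambda>x. a x - ln (gibbs_fst a b x))"
definition "normalize_snd a b = (\<lambda>y. b y - ln (gibbs_snd a b y))"

lemma normalize_swap: "cost_space.normalize_snd M2 (\<lambda>y x. c x y) b a = normalize_fst a b"
proof -
  interpret swapped: cost_space M2 M1 "\<lambda>y x. c x y" \<phi>2 \<phi>1 \<alpha> B0 B1 by (rule cost_space_swap)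
  show ?thesis by (simp add: swapped.normalize_snd_def normalize_fst_def gibbs_swap)
qed

lemma gibbs_normalize_fst: "gibbs (normalize_fst a b) b x y = gibbs a b x y / gibbs_fst a b x"
  and gibbs_normalize_snd: "gibbs a (normalize_snd a b) x y = gibbs a b x y / gibbs_snd a b y"
  using gibbs_fst_pos[of a b x] gibbs_snd_pos[of a b y]
  by (simp_all add: gibbs_def normalize_fst_def normalize_snd_def exp_diff exp_add)

lemma nn_integral_gibbs_normalize_snd:
  assumes ab: "potentials a b"
  shows "AE y in M2. (\<integral>\<^sup>+x. ennreal (gibbs a (normalize_snd a b) x y) \<partial>M1) = 1"
  using has_marginalsD(6)[OF has_marginals_gibbs[OF ab]] AE_space
proof eventually_elim
  case (elim y)
  note [measurable] = potentialsD(3,4)[OF ab]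
  have "(\<integral>\<^sup>+x. ennreal (gibbs a (normalize_snd a b) x y) \<partial>M1)
      = (\<integral>\<^sup>+x. ennreal (1 / gibbs_snd a b y) * ennreal (gibbs a b x y) \<partial>M1)"
    by (simp add: gibbs_normalize_snd gibbs_pos gibbs_snd_pos less_imp_le flip: ennreal_mult)
  also have "\<dots> = ennreal (1 / gibbs_snd a b y) * ennreal (gibbs_snd a b y)"
    using elim by (simp add: nn_integral_cmult)
  also have "\<dots> = 1" using gibbs_snd_pos[of a b y] by (simp flip: ennreal_mult)
  finally show ?case .
qed

lemma potentials_normalize_snd:
  assumes ab: "potentials a b"
  shows "potentials a (normalize_snd a b)"
proof -
  note [measurable] = potentialsD(3,4)[OF ab]
  have [measurable]: "normalize_snd a b \<in> borel_measurable M2" unfolding normalize_snd_def by measurable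
  have "(\<integral>\<^sup>+(x, y). ennreal (gibbs a (normalize_snd a b) x y) \<partial>MM)
      = (\<integral>\<^sup>+y. \<integral>\<^sup>+x. ennreal (gibbs a (normalize_snd a b) x y) \<partial>M1 \<partial>M2)"
    by (subst nn_integral_snd[symmetric]) auto
  also have "\<dots> = 1"
    using nn_integral_cong_AE[OF nn_integral_gibbs_normalize_snd[OF ab]] by (simp add: M2.emeasure_space_1)
  finally have mass: "(\<integral>\<^sup>+(x, y). ennreal (gibbs a (normalize_snd a b) x y) \<partial>MM) = 1" .
  have integrable: "integrable M2 (normalize_snd a b)"
    unfolding normalize_snd_def using potentialsD(2)[OF ab] ln_gibbs_snd_integrable[OF ab] by simp
  let ?A = "max B1 \<bar>B0 + B1 * (\<integral>x. \<phi>1 x \<partial>M1) - (\<integral>x. a x \<partial>M1)\<bar>"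
  have "AE y in M2. normalize_snd a b y \<le> ?A * (1 + \<phi>2 y)"
    using ln_gibbs_snd_ge[OF ab]
  proof eventually_elim
    case (elim y)
    have "normalize_snd a b y \<le> (B0 + B1 * (\<integral>x. \<phi>1 x \<partial>M1) - (\<integral>x. a x \<partial>M1)) + B1 * \<phi>2 y"
      using elim by (simp add: normalize_snd_def algebra_simps)
    also have "\<dots> \<le> ?A + ?A * \<phi>2 y"
      by (intro add_mono mult_right_mono \<phi>2_nonneg) auto
    finally show ?case by (simp add: algebra_simps)
  qed
  then show ?thesis using ab mass integrable unfolding potentials_def by blast
qed

lemma potentials_normalize_fst:
  assumes ab: "potentials a b"
  shows "potentials (normalize_fst a b) b"
proof -
  interpret swapped: cost_space M2 M1 "\<lambda>y x. c x y" \<phi>2 \<phi>1 \<alpha> B0 B1 by (rule cost_space_swap)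
  show ?thesis
    using swapped.potentials_swap[OF swapped.potentials_normalize_snd[OF potentials_swap[OF ab]]]
    by (simp add: normalize_swap)
qed

lemma integral_normalize_snd:
  assumes ab: "potentials a b"
  shows "(\<integral>y. normalize_snd a b y \<partial>M2) = (\<integral>y. b y \<partial>M2) + (\<integral>y. - ln (gibbs_snd a b y) \<partial>M2)"
  unfolding normalize_snd_def using potentialsD(2)[OF ab] ln_gibbs_snd_integrable[OF ab] by simp

lemma integral_normalize_fst:
  assumes ab: "potentials a b"
  shows "(\<integral>x. normalize_fst a b x \<partial>M1) = (\<integral>x. a x \<partial>M1) + (\<integral>x. - ln (gibbs_fst a b x) \<partial>M1)"
proof -
  interpret swapped: cost_space M2 M1 "\<lambda>y x. c x y" \<phi>2 \<phi>1 \<alpha> B0 B1 by (rule cost_space_swap)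
  show ?thesis
    using swapped.integral_normalize_snd[OF potentials_swap[OF ab]] by (simp add: normalize_swap gibbs_swap)
qed

lemma has_marginals_normalize_snd:
  assumes ab: "potentials a b"
  shows "has_marginals (gibbs_fst a (normalize_snd a b)) (\<lambda>_. 1) (gibbs a (normalize_snd a b))"
  using has_marginals_gibbs[OF potentials_normalize_snd[OF ab]] nn_integral_gibbs_normalize_snd[OF ab]
  by (simp add: has_marginals_def)

lemma has_marginals_normalize_fst:
  assumes ab: "potentials a b"
  shows "has_marginals (\<lambda>_. 1) (gibbs_snd (normalize_fst a b) b) (gibbs (normalize_fst a b) b)"
proof -
  interpret swapped: cost_space M2 M1 "\<lambda>y x. c x y" \<phi>2 \<phi>1 \<alpha> B0 B1 by (rule cost_space_swap)
  show ?thesis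
    using swapped.has_marginals_swap[OF swapped.has_marginals_normalize_snd[OF potentials_swap[OF ab]]]
    by (simp add: normalize_swap gibbs_swap)
qed

lemma gibbs_fst_measurable[measurable]:
  assumes "a \<in> borel_measurable M1" "b \<in> borel_measurable M2"
  shows "gibbs_fst a b \<in> borel_measurable M1"
proof -
  interpret swapped: cost_space M2 M1 "\<lambda>y x. c x y" \<phi>2 \<phi>1 \<alpha> B0 B1 by (rule cost_space_swap)
  show ?thesis using swapped.gibbs_snd_measurable[OF assms(2,1)] by (simp add: gibbs_swap)
qed

lemma gibbs_fst_normalize_snd:
  assumes ab: "potentials a b"
  shows "AE x in M1. integrable M2 (\<lambda>y. gibbs a b x y * (1 / gibbs_snd a b y))
    \<and> (\<integral>y. gibbs a b x y * (1 / gibbs_snd a b y) \<partial>M2) = gibbs_fst a (normalize_snd a b) x"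
proof -
  have ratio: "gibbs a b x y * (1 / gibbs_snd a b y) = gibbs a (normalize_snd a b) x y" for x y
    by (simp add: gibbs_normalize_snd)
  show ?thesis
    unfolding ratio by (rule has_marginals_section_fst[OF has_marginals_gibbs[OF potentials_normalize_snd[OF ab]]])
qed

lemma gibbs_snd_ratio:
  assumes ab: "potentials a b"
  shows "case_prod (\<lambda>x y. 1 / gibbs_snd a b y) \<in> borel_measurable MM" "0 < 1 / gibbs_snd a b y"
  using potentialsD(3,4)[OF ab] gibbs_snd_pos by simp_all

text \<open>The two entropy bounds are data processing for the projection to the first factor, applied to the
  densities before and after the half step.\<close>

lemma
  assumes ab: "potentials a b" and matched: "has_marginals (\<lambda>_. 1) (gibbs_snd a b) (gibbs a b)"
  defines "f' \<equiv> gibbs_fst a (normalize_snd a b)"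
  shows marginal_entropy_integrable: "integrable M1 (\<lambda>x. f' x * ln (f' x))"
    and marginal_entropy_le_reverse: "(\<integral>x. f' x * ln (f' x) \<partial>M1) \<le> (\<integral>y. - ln (gibbs_snd a b y) \<partial>M2)"
proof -
  let ?f = "gibbs_snd a b" and ?\<rho> = "gibbs a b"
  note matched' = has_marginals_normalize_snd[OF ab] and ratio = gibbs_snd_ratio[OF ab]
  have ln_f: "(\<lambda>y. - ln (?f y)) \<in> borel_measurable M2" "integrable M2 (\<lambda>y. 1 * - ln (?f y))"
    using ln_gibbs_snd_integrable[OF ab] by simp_all
  have xlnx_ratio: "?\<rho> x y * (1 / ?f y * ln (1 / ?f y)) = gibbs a (normalize_snd a b) x y * - ln (?f y)" for x y
    using gibbs_snd_pos[of a b y] by (simp add: ln_div gibbs_normalize_snd)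
  have "integrable MM (\<lambda>(x, y). ?\<rho> x y * (1 / ?f y * ln (1 / ?f y)))"
    unfolding xlnx_ratio by (rule integrable_mult_snd[OF matched' ln_f])
  note jensen = integrable_conditional_xlnx[OF matched ratio(1) less_imp_le[OF ratio(2)] this]
    conditional_jensen_xlnx[OF matched ratio(1) less_imp_le[OF ratio(2)] this]
  let ?v = "\<lambda>x. \<integral>y. ?\<rho> x y * (1 / ?f y) \<partial>M2"
  have v_eq: "AE x in M1. ?v x * ln (?v x) = f' x * ln (f' x)"
    using gibbs_fst_normalize_snd[OF ab] unfolding f'_def by eventually_elim simp
  have f'[measurable]: "f' \<in> borel_measurable M1"
    unfolding f'_def by (rule gibbs_fst_measurable[OF potentialsD(3,4)[OF potentials_normalize_snd[OF ab]]])
  show "integrable M1 (\<lambda>x. f' x * ln (f' x))"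
    by (rule integrable_cong_AE_imp[OF jensen(1) _ v_eq]) measurable
  have "(\<integral>x. f' x * ln (f' x) \<partial>M1) = (\<integral>x. ?v x * ln (?v x) \<partial>M1)"
    using borel_measurable_integrable[OF jensen(1)] v_eq by (intro integral_cong_AE) auto
  also note jensen(2)
  also have "(\<integral>(x, y). ?\<rho> x y * (1 / ?f y * ln (1 / ?f y)) \<partial>MM) = (\<integral>y. - ln (?f y) \<partial>M2)"
    unfolding xlnx_ratio integral_mult_snd[OF matched' ln_f] by simp
  finally show "(\<integral>x. f' x * ln (f' x) \<partial>M1) \<le> (\<integral>y. - ln (?f y) \<partial>M2)" .
qed

lemma reverse_entropy_le_marginal:
  assumes ab: "potentials a b" and matched: "has_marginals (\<lambda>_. 1) (gibbs_snd a b) (gibbs a b)"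
    and ent: "integrable M2 (\<lambda>y. gibbs_snd a b y * ln (gibbs_snd a b y))"
  shows "(\<integral>x. - ln (gibbs_fst a (normalize_snd a b) x) \<partial>M1) \<le> (\<integral>y. gibbs_snd a b y * ln (gibbs_snd a b y) \<partial>M2)"
proof -
  interpret swapped: cost_space M2 M1 "\<lambda>y x. c x y" \<phi>2 \<phi>1 \<alpha> B0 B1 by (rule cost_space_swap)
  let ?f = "gibbs_snd a b" and ?f' = "gibbs_fst a (normalize_snd a b)" and ?\<rho> = "gibbs a b"
  note [measurable] = potentialsD(3,4)[OF ab] and ratio = gibbs_snd_ratio[OF ab]
  let ?v = "\<lambda>x. \<integral>y. ?\<rho> x y * (1 / ?f y) \<partial>M2"
  have v_eq: "AE x in M1. ?v x = ?f' x" using gibbs_fst_normalize_snd[OF ab] by eventually_elim simp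
  have ln_f': "integrable M1 (\<lambda>x. ln (?f' x))"
    using swapped.ln_gibbs_snd_integrable[OF potentials_swap[OF potentials_normalize_snd[OF ab]]]
    by (simp add: gibbs_swap)
  have ln_v: "integrable M1 (\<lambda>x. ln (?v x))"
    by (rule integrable_cong_AE_imp[OF ln_f']) (use v_eq in auto)
  have ln_ratio: "?\<rho> x y * ln (1 / ?f y) = ?\<rho> x y * - ln (?f y)" for x y
    using gibbs_snd_pos[of a b y] by (simp add: ln_div)
  have neg_ent: "(\<lambda>y. - ln (?f y)) \<in> borel_measurable M2" "integrable M2 (\<lambda>y. ?f y * - ln (?f y))"
    using ent by simp_all
  have "- (\<integral>y. ?f y * ln (?f y) \<partial>M2) = (\<integral>(x, y). ?\<rho> x y * ln (1 / ?f y) \<partial>MM)"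
    unfolding ln_ratio integral_mult_snd[OF matched neg_ent] by simp
  also have "\<dots> \<le> (\<integral>x. ln (?v x) \<partial>M1)"
  proof (rule conditional_jensen_ln[OF matched ratio _ ln_v])
    show "AE x in M1. integrable M2 (\<lambda>y. ?\<rho> x y * (1 / ?f y))"
      using gibbs_fst_normalize_snd[OF ab] by eventually_elim simp
    show "integrable MM (\<lambda>(x, y). ?\<rho> x y * ln (1 / ?f y))"
      unfolding ln_ratio by (rule integrable_mult_snd[OF matched neg_ent])
  qed
  also have "\<dots> = (\<integral>x. ln (?f' x) \<partial>M1)"
    using v_eq borel_measurable_integrable[OF ln_v] borel_measurable_integrable[OF ln_f']
    by (intro integral_cong_AE) auto
  finally show ?thesis by simp
qed

end

lemma alternating_decrease_rate:
  fixes A B :: "nat \<Rightarrow> real"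
  assumes A_nonneg: "\<And>n. 0 \<le> A n"
    and A_le: "\<And>n. 2 \<le> n \<Longrightarrow> A (Suc n) \<le> B n" and B_le: "\<And>n. 1 \<le> n \<Longrightarrow> B (Suc n) \<le> A n"
    and sum_le: "\<And>n. (\<Sum>k<n. A k) \<le> C" and n: "2 \<le> n"
  shows "B n \<le> 4 * C / real n"
proof -
  define s where "s k = A k + A (Suc k)" for k
  have s_decreasing: "s (Suc k) \<le> s k" if "1 \<le> k" for k
    using A_le[of "Suc k"] B_le[of k] that by (simp add: s_def)
  have s_le: "s m \<le> s k" if "1 \<le> k" "k \<le> m" for k m
    using that(2)
  proof (induction rule: dec_induct)
    case (step m)
    then show ?case using s_decreasing[of m] that(1) by linarith
  qed simp
  obtain m where m: "n = Suc m" "1 \<le> m" using n by (cases n) auto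
  have "real m * s m = (\<Sum>k\<in>{1..m}. s m)" by simp
  also have "\<dots> \<le> (\<Sum>k\<in>{1..m}. s k)" by (intro sum_mono s_le) auto
  also have "\<dots> \<le> (\<Sum>k<Suc m. s k)" using A_nonneg by (intro sum_mono2) (auto simp: s_def)
  also have "\<dots> = (\<Sum>k<Suc m. A k) + (\<Sum>k<Suc m. A (Suc k))" by (simp add: s_def sum.distrib)
  also have "\<dots> \<le> C + C"
  proof -
    have "(\<Sum>k<Suc m. A (Suc k)) \<le> (\<Sum>k<Suc (Suc m). A k)"
      unfolding sum.lessThan_Suc_shift[of A "Suc m"] using A_nonneg[of 0] by simp
    then show ?thesis using sum_le[of "Suc m"] sum_le[of "Suc (Suc m)"] by linarith
  qed
  finally have "real m * s m \<le> 2 * C" by simp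
  moreover have "real m * A m \<le> real m * s m" using A_nonneg by (intro mult_left_mono) (auto simp: s_def)
  ultimately have "real m * A m \<le> 2 * C" by linarith
  have "real n * B n \<le> real n * A m" using B_le[of m] m by (intro mult_left_mono) auto
  also have "\<dots> \<le> 2 * real m * A m" using m A_nonneg by (intro mult_right_mono) auto
  also have "\<dots> \<le> 4 * C" using \<open>real m * A m \<le> 2 * C\<close> by linarith
  finally show ?thesis using n by (simp add: field_simps)
qed

context cost_space
begin

lemma
  shows exp_c_integrable: "integrable MM (\<lambda>(x, y). exp (- c x y))"
    and partition_function_pos: "0 < (\<integral>(x, y). exp (- c x y) \<partial>MM)"
    and partition_function_le_1: "(\<integral>(x, y). exp (- c x y) \<partial>MM) \<le> 1"
proof -
  show int: "integrable MM (\<lambda>(x, y). exp (- c x y))"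
    by (rule integrable_const_bound[where B = 1]) (use c_nonneg in \<open>auto intro!: AE_I2\<close>)
  have "0 < (\<integral>z. 1 * (case z of (x, y) \<Rightarrow> exp (- c x y)) \<partial>MM)"
    using int by (intro weighted_integral_pos) (auto simp: prob_space)
  then show "0 < (\<integral>(x, y). exp (- c x y) \<partial>MM)" by simp
  have "(\<integral>(x, y). exp (- c x y) \<partial>MM) \<le> (\<integral>z. 1 \<partial>MM)"
    using int c_nonneg by (intro integral_mono) auto
  then show "(\<integral>(x, y). exp (- c x y) \<partial>MM) \<le> 1" using prob_space by simp
qed

primrec iterated_potentials :: "nat \<Rightarrow> ('a \<Rightarrow> real) \<times> ('b \<Rightarrow> real)" where
  "iterated_potentials 0 = ((\<lambda>_. 0), (\<lambda>_. - ln (\<integral>(x, y). exp (- c x y) \<partial>MM)))"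
| "iterated_potentials (Suc n) = (let (a, b) = iterated_potentials n in
     if even n then (normalize_fst a b, b) else (a, normalize_snd a b))"

definition "potential_fst n = fst (iterated_potentials n)"
definition "potential_snd n = snd (iterated_potentials n)"

lemma potential_Suc:
  "even n \<Longrightarrow> potential_fst (Suc n) = normalize_fst (potential_fst n) (potential_snd n)"
  "even n \<Longrightarrow> potential_snd (Suc n) = potential_snd n"
  "odd n \<Longrightarrow> potential_fst (Suc n) = potential_fst n"
  "odd n \<Longrightarrow> potential_snd (Suc n) = normalize_snd (potential_fst n) (potential_snd n)"
  by (simp_all add: potential_fst_def potential_snd_def case_prod_beta Let_def)

abbreviation "iterate n \<equiv> gibbs (potential_fst n) (potential_snd n)"
abbreviation "iterate_fst n \<equiv> gibbs_fst (potential_fst n) (potential_snd n)"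
abbreviation "iterate_snd n \<equiv> gibbs_snd (potential_fst n) (potential_snd n)"

lemma iterate_0: "iterate 0 x y = exp (- c x y) / (\<integral>(x, y). exp (- c x y) \<partial>MM)"
  using partition_function_pos by (simp add: gibbs_def potential_fst_def potential_snd_def exp_diff exp_minus field_simps)

lemma potentials_iterate: "potentials (potential_fst n) (potential_snd n)"
proof (induction n)
  case 0
  let ?Z = "\<integral>(x, y). exp (- c x y) \<partial>MM"
  have "(\<integral>\<^sup>+(x, y). ennreal (iterate 0 x y) \<partial>MM)
      = (\<integral>\<^sup>+z. ennreal (case z of (x, y) \<Rightarrow> exp (- c x y) / ?Z) \<partial>MM)"
    by (simp add: iterate_0 case_prod_beta')
  also have "\<dots> = ennreal (\<integral>(x, y). exp (- c x y) / ?Z \<partial>MM)"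
    using exp_c_integrable partition_function_pos
    by (intro nn_integral_eq_integral) (auto simp: case_prod_beta' less_imp_le)
  also have "\<dots> = 1" using partition_function_pos by (simp add: case_prod_beta')
  finally have mass: "(\<integral>\<^sup>+(x, y). ennreal (iterate 0 x y) \<partial>MM) = 1" .
  have "- ln ?Z \<le> - ln ?Z * (1 + \<phi>2 y)" for y
    using partition_function_pos partition_function_le_1 \<phi>2_nonneg[of y] mult_left_mono[of 1 "1 + \<phi>2 y" "- ln ?Z"] by simp
  then have "\<exists>A. AE y in M2. potential_snd 0 y \<le> A * (1 + \<phi>2 y)"
    unfolding potential_snd_def by (intro exI[of _ "- ln ?Z"] AE_I2) simp
  moreover have "\<exists>A. AE x in M1. potential_fst 0 x \<le> A * (1 + \<phi>1 x)"
    by (rule exI[of _ 0]) (simp add: potential_fst_def)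
  ultimately show ?case
    unfolding potentials_def using mass by (simp add: potential_fst_def potential_snd_def)
next
  case (Suc n)
  then show ?case
    using potentials_normalize_fst[OF Suc] potentials_normalize_snd[OF Suc]
    by (cases "even n") (simp_all add: potential_Suc)
qed

lemma has_marginals_iterate_odd: "odd n \<Longrightarrow> has_marginals (\<lambda>_. 1) (iterate_snd n) (iterate n)"
  using has_marginals_normalize_fst[OF potentials_iterate, of "n - 1"] potential_Suc[of "n - 1"] by (cases n) auto

lemma has_marginals_iterate_even:
  "even n \<Longrightarrow> n \<noteq> 0 \<Longrightarrow> has_marginals (iterate_fst n) (\<lambda>_. 1) (iterate n)"
  using has_marginals_normalize_snd[OF potentials_iterate, of "n - 1"] potential_Suc[of "n - 1"] by (cases n) auto

text \<open>The relative entropies between the prescribed marginal and the unmatched marginal of the \<open>n\<close>-th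
  iterate: \<open>marginal_entropy\<close> is relative to the prescribed marginal, \<open>reverse_entropy\<close> to the current one.\<close>

definition reverse_entropy :: "nat \<Rightarrow> real" where
  "reverse_entropy n =
    (if even n then \<integral>x. - ln (iterate_fst n x) \<partial>M1 else \<integral>y. - ln (iterate_snd n y) \<partial>M2)"

definition marginal_entropy :: "nat \<Rightarrow> real" where
  "marginal_entropy n = (if even n then \<integral>x. iterate_fst n x * ln (iterate_fst n x) \<partial>M1
    else \<integral>y. iterate_snd n y * ln (iterate_snd n y) \<partial>M2)"

definition finite_marginal_entropy :: "nat \<Rightarrow> bool" where
  "finite_marginal_entropy n = (if even n then integrable M1 (\<lambda>x. iterate_fst n x * ln (iterate_fst n x))
    else integrable M2 (\<lambda>y. iterate_snd n y * ln (iterate_snd n y)))"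

lemma reverse_entropy_nonneg: "0 \<le> reverse_entropy n"
proof -
  interpret swapped: cost_space M2 M1 "\<lambda>y x. c x y" \<phi>2 \<phi>1 \<alpha> B0 B1 by (rule cost_space_swap)
  show ?thesis
    using ln_gibbs_snd_integral_le[OF potentials_iterate]
      swapped.ln_gibbs_snd_integral_le[OF potentials_swap[OF potentials_iterate]]
    by (simp add: reverse_entropy_def gibbs_swap)
qed

lemma
  assumes n: "1 \<le> n"
  shows finite_marginal_entropy_Suc: "finite_marginal_entropy (Suc n)"
    and marginal_entropy_Suc_le: "marginal_entropy (Suc n) \<le> reverse_entropy n"
    and reverse_entropy_Suc_le: "finite_marginal_entropy n \<Longrightarrow> reverse_entropy (Suc n) \<le> marginal_entropy n"
proof -
  interpret swapped: cost_space M2 M1 "\<lambda>y x. c x y" \<phi>2 \<phi>1 \<alpha> B0 B1 by (rule cost_space_swap)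
  note defs = finite_marginal_entropy_def marginal_entropy_def reverse_entropy_def
  have "finite_marginal_entropy (Suc n) \<and> marginal_entropy (Suc n) \<le> reverse_entropy n
    \<and> (finite_marginal_entropy n \<longrightarrow> reverse_entropy (Suc n) \<le> marginal_entropy n)"
  proof (cases "even n")
    case False
    note matched = has_marginals_iterate_odd[OF False]
    show ?thesis
      using marginal_entropy_integrable[OF potentials_iterate matched]
        marginal_entropy_le_reverse[OF potentials_iterate matched]
        reverse_entropy_le_marginal[OF potentials_iterate matched] False
      by (simp add: defs potential_Suc)
  next
    case True
    have ab: "swapped.potentials (potential_snd n) (potential_fst n)" by (rule potentials_swap[OF potentials_iterate])
    have matched: "swapped.has_marginals (\<lambda>_. 1) (swapped.gibbs_snd (potential_snd n) (potential_fst n))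
        (swapped.gibbs (potential_snd n) (potential_fst n))"
      using has_marginals_swap[OF has_marginals_iterate_even[OF True]] n by (simp add: gibbs_swap)
    show ?thesis
      using swapped.marginal_entropy_integrable[OF ab matched] swapped.marginal_entropy_le_reverse[OF ab matched]
        swapped.reverse_entropy_le_marginal[OF ab matched] True
      by (simp add: defs potential_Suc gibbs_swap normalize_swap)
  qed
  then show "finite_marginal_entropy (Suc n)" "marginal_entropy (Suc n) \<le> reverse_entropy n"
    "finite_marginal_entropy n \<Longrightarrow> reverse_entropy (Suc n) \<le> marginal_entropy n" by auto
qed

lemma sum_reverse_entropy_le: "(\<Sum>k<n. reverse_entropy k) \<le> (\<integral>(x, y). c x y \<partial>MM)"
proof -
  have "(\<Sum>k<n. reverse_entropy k) \<le> (\<integral>x. potential_fst n x \<partial>M1) + (\<integral>y. potential_snd n y \<partial>M2)"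
  proof (induction n)
    case 0
    show ?case
      using partition_function_pos partition_function_le_1
      by (simp add: potential_fst_def potential_snd_def M2.prob_space)
  next
    case (Suc n)
    then show ?case
      using integral_normalize_fst[OF potentials_iterate, of n] integral_normalize_snd[OF potentials_iterate, of n]
      by (simp add: reverse_entropy_def potential_Suc)
  qed
  then show ?thesis using sum_potentials_le[OF potentials_iterate, of n] by linarith
qed

lemma
  assumes n: "2 \<le> n"
  shows finite_marginal_entropy: "finite_marginal_entropy n"
    and marginal_entropy_rate: "marginal_entropy n \<le> 4 * (\<integral>(x, y). c x y \<partial>MM) / real n"
proof -
  have finite: "finite_marginal_entropy n" if "2 \<le> n" for n
    using finite_marginal_entropy_Suc[of "n - 1"] that by (cases n) auto
  show "finite_marginal_entropy n" by (rule finite[OF n])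
  show "marginal_entropy n \<le> 4 * (\<integral>(x, y). c x y \<partial>MM) / real n"
    using reverse_entropy_nonneg reverse_entropy_Suc_le finite marginal_entropy_Suc_le sum_reverse_entropy_le
    by (intro alternating_decrease_rate[where A = reverse_entropy, OF _ _ _ _ n]) auto
qed

end

section \<open>Stability under perturbation of one marginal\<close>

context cost_space
begin

definition "exp_moment1 = (\<integral>x. exp (\<alpha> * \<phi>1 x) \<partial>M1)"
definition "exp_moment2 = (\<integral>y. exp (\<alpha> * \<phi>2 y) \<partial>M2)"
definition "tv_const K = 2 * K / \<alpha> + 2 * exp \<alpha> * exp_moment2 / \<alpha>"

definition entropic_cost :: "('a \<Rightarrow> 'b \<Rightarrow> real) \<Rightarrow> real" where
  "entropic_cost s = (\<integral>(x, y). s x y * c x y \<partial>MM) + (\<integral>(x, y). s x y * ln (s x y) \<partial>MM)"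

definition weighted_tv :: "('a \<Rightarrow> 'b \<Rightarrow> real) \<Rightarrow> ('a \<Rightarrow> 'b \<Rightarrow> real) \<Rightarrow> ennreal" where
  "weighted_tv r s = (\<integral>\<^sup>+(x, y). ennreal ((1 + (\<phi>1 x + \<phi>2 y)) * \<bar>r x y - s x y\<bar>) \<partial>MM)"

definition coupling_density :: "('a \<Rightarrow> 'b \<Rightarrow> real) \<Rightarrow> bool" where
  "coupling_density s \<longleftrightarrow> has_marginals (\<lambda>_. 1) (\<lambda>_. 1) s \<and> integrable MM (\<lambda>(x, y). s x y * ln (s x y))"

definition optimal_density :: "('a \<Rightarrow> 'b \<Rightarrow> real) \<Rightarrow> bool" where
  "optimal_density r \<longleftrightarrow> coupling_density r \<and> (\<forall>s. coupling_density s \<longrightarrow> entropic_cost r \<le> entropic_cost s)"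

lemma exp_moment_nonneg: "0 \<le> exp_moment1" "0 \<le> exp_moment2"
  unfolding exp_moment1_def exp_moment2_def by (auto intro!: integral_nonneg_AE)

lemma tv_const_nonneg: "0 \<le> K \<Longrightarrow> 0 \<le> tv_const K"
  unfolding tv_const_def using exp_moment_nonneg \<alpha>_pos by simp

lemma weight_nonneg: "0 \<le> u0 \<Longrightarrow> 0 \<le> u1 \<Longrightarrow> 0 \<le> u0 + u1 * (\<phi>1 x + \<phi>2 y)"
  by (simp add: \<phi>1_nonneg \<phi>2_nonneg)

lemma weighted_tv_commute: "weighted_tv r s = weighted_tv s r"
  by (simp add: weighted_tv_def abs_minus_commute)

lemma weighted_tv_triangle:
  assumes [measurable]: "case_prod r \<in> borel_measurable MM" "case_prod s \<in> borel_measurable MM"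
    "case_prod q \<in> borel_measurable MM"
  shows "weighted_tv r q \<le> weighted_tv r s + weighted_tv s q"
proof -
  have "ennreal ((1 + (\<phi>1 x + \<phi>2 y)) * \<bar>r x y - q x y\<bar>)
      \<le> ennreal ((1 + (\<phi>1 x + \<phi>2 y)) * \<bar>r x y - s x y\<bar>) + ennreal ((1 + (\<phi>1 x + \<phi>2 y)) * \<bar>s x y - q x y\<bar>)" for x y
  proof -
    have weight: "0 \<le> 1 + (\<phi>1 x + \<phi>2 y)" using weight_nonneg[of 1 1] by simp
    have "(1 + (\<phi>1 x + \<phi>2 y)) * \<bar>r x y - q x y\<bar>
        \<le> (1 + (\<phi>1 x + \<phi>2 y)) * (\<bar>r x y - s x y\<bar> + \<bar>s x y - q x y\<bar>)"
      using weight by (intro mult_left_mono) auto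
    then show ?thesis
      using weight by (simp add: ennreal_leI distrib_left flip: ennreal_plus)
  qed
  then have "weighted_tv r q \<le> (\<integral>\<^sup>+z. (case z of (x, y) \<Rightarrow> ennreal ((1 + (\<phi>1 x + \<phi>2 y)) * \<bar>r x y - s x y\<bar>))
      + (case z of (x, y) \<Rightarrow> ennreal ((1 + (\<phi>1 x + \<phi>2 y)) * \<bar>s x y - q x y\<bar>)) \<partial>MM)"
    unfolding weighted_tv_def by (intro nn_integral_mono) (simp add: case_prod_beta')
  also have "\<dots> = weighted_tv r s + weighted_tv s q"
    unfolding weighted_tv_def by (rule nn_integral_add) measurable
  finally show ?thesis .
qed

lemma cost_integrable:
  assumes s: "has_marginals (\<lambda>_. 1) f s" and f\<phi>2: "integrable M2 (\<lambda>y. f y * \<phi>2 y)"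
  shows "integrable MM (\<lambda>(x, y). s x y * c x y)"
proof (rule Bochner_Integration.integrable_bound)
  note [measurable] = has_marginalsD(1)[OF s] and s_nonneg = has_marginalsD(2)[OF s]
  let ?bound = "\<lambda>z. B0 * case_prod s z + B1 * ((case z of (x, y) \<Rightarrow> s x y * \<phi>1 x) + (case z of (x, y) \<Rightarrow> s x y * \<phi>2 y))"
  have \<phi>1: "integrable M1 (\<lambda>x. 1 * \<phi>1 x)" using \<phi>1_integrable by simp
  show "integrable MM ?bound"
    using has_marginals_integrable[OF s] integrable_mult_fst[OF s \<phi>1_measurable \<phi>1]
      integrable_mult_snd[OF s \<phi>2_measurable f\<phi>2] by auto
  show "AE z in MM. norm (case z of (x, y) \<Rightarrow> s x y * c x y) \<le> norm (?bound z)"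
  proof (rule AE_I2)
    fix z :: "'a \<times> 'b"
    obtain x y where z: "z = (x, y)" by (cases z)
    have "s x y * c x y \<le> s x y * (B0 + B1 * (\<phi>1 x + \<phi>2 y))" by (intro mult_left_mono c_le s_nonneg)
    moreover have "0 \<le> s x y * c x y" using s_nonneg c_nonneg by simp
    moreover have "?bound z = s x y * (B0 + B1 * (\<phi>1 x + \<phi>2 y))" by (simp add: z algebra_simps)
    ultimately show "norm (case z of (x, y) \<Rightarrow> s x y * c x y) \<le> norm (?bound z)" by (simp add: z)
  qed
  show "(\<lambda>(x, y). s x y * c x y) \<in> borel_measurable MM" by measurable
qed

lemma coupling_cost_integrable: "coupling_density s \<Longrightarrow> integrable MM (\<lambda>(x, y). s x y * c x y)"
  using cost_integrable[of "\<lambda>_. 1" s] \<phi>2_integrable by (simp add: coupling_density_def)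

lemma cost_le_cost_plus:
  assumes s1: "integrable MM (\<lambda>(x, y). s1 x y * c x y)" and s2: "integrable MM (\<lambda>(x, y). s2 x y * c x y)"
    and d: "(\<integral>\<^sup>+(x, y). ennreal ((B0 + B1 * (\<phi>1 x + \<phi>2 y)) * \<bar>s1 x y - s2 x y\<bar>) \<partial>MM) \<le> ennreal d" "0 \<le> d"
  shows "(\<integral>(x, y). s1 x y * c x y \<partial>MM) \<le> (\<integral>(x, y). s2 x y * c x y \<partial>MM) + d"
proof -
  let ?d = "\<lambda>z. (case z of (x, y) \<Rightarrow> s1 x y * c x y) - (case z of (x, y) \<Rightarrow> s2 x y * c x y)"
  have "ennreal (norm (integral\<^sup>L MM ?d)) \<le> (\<integral>\<^sup>+z. norm (?d z) \<partial>MM)"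
    by (rule integral_norm_bound_ennreal[OF Bochner_Integration.integrable_diff[OF s1 s2]])
  also have "\<dots> \<le> (\<integral>\<^sup>+(x, y). ennreal ((B0 + B1 * (\<phi>1 x + \<phi>2 y)) * \<bar>s1 x y - s2 x y\<bar>) \<partial>MM)"
  proof (rule nn_integral_mono)
    fix z :: "'a \<times> 'b"
    obtain x y where z: "z = (x, y)" by (cases z)
    have "?d z = c x y * (s1 x y - s2 x y)" by (simp add: z algebra_simps)
    then have "norm (?d z) = c x y * \<bar>s1 x y - s2 x y\<bar>" using c_nonneg[of x y] by (simp add: abs_mult)
    also have "\<dots> \<le> (B0 + B1 * (\<phi>1 x + \<phi>2 y)) * \<bar>s1 x y - s2 x y\<bar>"
      by (intro mult_right_mono c_le) simp
    finally show "ennreal (norm (?d z)) \<le> (case z of (x, y) \<Rightarrow> ennreal ((B0 + B1 * (\<phi>1 x + \<phi>2 y)) * \<bar>s1 x y - s2 x y\<bar>))"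
      by (simp add: z ennreal_leI)
  qed
  also note d(1)
  finally have "norm (integral\<^sup>L MM ?d) \<le> d" using d(2) by simp
  moreover have "integral\<^sup>L MM ?d = (\<integral>(x, y). s1 x y * c x y \<partial>MM) - (\<integral>(x, y). s2 x y * c x y \<partial>MM)"
    by (rule Bochner_Integration.integral_diff[OF s1 s2])
  ultimately show ?thesis unfolding real_norm_def by linarith
qed

end

locale perturbed_marginal = cost_space +
  fixes f :: "'b \<Rightarrow> real" and K t :: real
  assumes f_measurable[measurable]: "f \<in> borel_measurable M2" and f_pos: "0 < f y"
    and f_integrable: "integrable M2 f" and f_integral: "(\<integral>y. f y \<partial>M2) = 1"
    and f_ent_integrable: "integrable M2 (\<lambda>y. f y * ln (f y))"
    and f_ent_le: "(\<integral>y. f y * ln (f y) \<partial>M2) \<le> K * t\<^sup>2"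
    and t_pos: "0 < t" and t_le_1: "t \<le> 1"
begin

definition "tv = tv_const K * t"
definition "moment_shift = 2 / \<alpha> * (tv_const K * (t * ln (1 / t)) + exp_moment1 * t)"
definition "cost_shift = 2 * (B0 * tv + B1 * moment_shift) + B1 * tv"

lemma f_nonneg: "0 \<le> f y" using f_pos[of y] by simp

lemma f_ent_nonneg: "0 \<le> (\<integral>y. f y * ln (f y) \<partial>M2)"
proof -
  have "0 \<le> (\<integral>y. kl_div (f y) 1 \<partial>M2)"
    by (intro integral_nonneg_AE AE_I2 kl_div_nonneg f_nonneg) simp
  also have "\<dots> = (\<integral>y. f y * ln (f y) \<partial>M2)"
    using f_ent_integrable f_integrable f_integral by (simp add: kl_div_def M2.prob_space)
  finally show ?thesis .
qed

lemma K_nonneg: "0 \<le> K"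
  using order_trans[OF f_ent_nonneg f_ent_le] t_pos by (simp add: zero_le_mult_iff)

lemma tv_nonneg: "0 \<le> tv" and moment_shift_nonneg: "0 \<le> moment_shift" and cost_shift_nonneg: "0 \<le> cost_shift"
proof -
  show "0 \<le> tv" unfolding tv_def using tv_const_nonneg[OF K_nonneg] t_pos by simp
  moreover show "0 \<le> moment_shift"
    unfolding moment_shift_def using tv_const_nonneg[OF K_nonneg] exp_moment_nonneg \<alpha>_pos t_pos t_le_1
    by (intro mult_nonneg_nonneg add_nonneg_nonneg) auto
  ultimately show "0 \<le> cost_shift" unfolding cost_shift_def using B_nonneg by simp
qed

lemma weighted_tv_f_le: "(\<integral>\<^sup>+y. ennreal ((1 + \<phi>2 y) * \<bar>f y - 1\<bar>) \<partial>M2) \<le> ennreal tv"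
  unfolding tv_def tv_const_def exp_moment2_def
  by (rule M2.weighted_tv_le_entropy[OF f_nonneg f_integrable f_integral f_ent_integrable f_ent_le
        t_pos t_le_1 \<phi>2_nonneg exp_\<phi>2_integrable \<alpha>_pos])

lemma f_\<phi>2_integrable: "integrable M2 (\<lambda>y. f y * \<phi>2 y)"
proof (rule integrableI_bounded)
  have "(\<integral>\<^sup>+y. ennreal (norm (f y * \<phi>2 y)) \<partial>M2)
      \<le> (\<integral>\<^sup>+y. ennreal ((1 + \<phi>2 y) * \<bar>f y - 1\<bar>) + ennreal (\<phi>2 y) \<partial>M2)"
  proof (rule nn_integral_mono)
    fix y
    have "f y * \<phi>2 y \<le> (\<bar>f y - 1\<bar> + 1) * \<phi>2 y" using \<phi>2_nonneg[of y] by (intro mult_right_mono) auto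
    also have "\<dots> \<le> (1 + \<phi>2 y) * \<bar>f y - 1\<bar> + \<phi>2 y" by (simp add: algebra_simps)
    finally show "ennreal (norm (f y * \<phi>2 y)) \<le> ennreal ((1 + \<phi>2 y) * \<bar>f y - 1\<bar>) + ennreal (\<phi>2 y)"
      using f_nonneg[of y] \<phi>2_nonneg[of y] by (simp add: ennreal_leI flip: ennreal_plus)
  qed
  also have "\<dots> = (\<integral>\<^sup>+y. ennreal ((1 + \<phi>2 y) * \<bar>f y - 1\<bar>) \<partial>M2) + (\<integral>\<^sup>+y. ennreal (\<phi>2 y) \<partial>M2)"
    by (rule nn_integral_add) measurable
  also have "\<dots> < \<infinity>"
    using le_less_trans[OF weighted_tv_f_le] nn_integral_eq_integral[OF \<phi>2_integrable] \<phi>2_nonneg by simp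
  finally show "(\<integral>\<^sup>+y. ennreal (norm (f y * \<phi>2 y)) \<partial>M2) < \<infinity>" .
qed measurable

end

locale perturbed_shadow = perturbed_marginal M1 M2 c \<phi>1 \<phi>2 \<alpha> B0 B1 f K t + tv_shadow M1 M2 s f1 f2
  for M1 :: "'a measure" and M2 :: "'b measure" and c \<phi>1 \<phi>2 \<alpha> B0 B1 f K t s f1 f2 +
  assumes abs_diff_eq: "\<bar>f1 y - f2 y\<bar> = \<bar>f y - 1\<bar>"
begin

lemma lost_mass_le: "(\<integral>\<^sup>+(x, y). ennreal (lost x y) \<partial>MM) \<le> ennreal tv"
proof -
  have "(\<integral>\<^sup>+(x, y). ennreal (lost x y) \<partial>MM) = (\<integral>\<^sup>+y. ennreal (loss y) \<partial>M2)"
    using nn_integral_lost nn_integral_loss by simp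
  also have "\<dots> \<le> (\<integral>\<^sup>+y. ennreal ((1 + \<phi>2 y) * \<bar>f y - 1\<bar>) \<partial>M2)"
  proof (intro nn_integral_mono ennreal_leI)
    fix y
    have "loss y \<le> 1 * \<bar>f y - 1\<bar>" using gain_loss(1,3)[of y] abs_diff_eq[of y] by simp
    also have "\<dots> \<le> (1 + \<phi>2 y) * \<bar>f y - 1\<bar>" using \<phi>2_nonneg[of y] by (intro mult_right_mono) auto
    finally show "loss y \<le> (1 + \<phi>2 y) * \<bar>f y - 1\<bar>" .
  qed
  also note weighted_tv_f_le
  finally show ?thesis .
qed

lemma lost_exp_moment_le:
  "(\<integral>\<^sup>+(x, y). ennreal (exp (\<alpha> * \<phi>1 x)) * ennreal (lost x y) \<partial>MM) \<le> ennreal exp_moment1"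
proof -
  have "(\<integral>\<^sup>+(x, y). ennreal (exp (\<alpha> * \<phi>1 x)) * ennreal (lost x y) \<partial>MM)
      \<le> (\<integral>\<^sup>+(x, y). ennreal (exp (\<alpha> * \<phi>1 x)) * ennreal (s x y) \<partial>MM)"
    using lost_le by (intro nn_integral_mono) (auto intro!: mult_left_mono ennreal_leI)
  also have "\<dots> = (\<integral>\<^sup>+x. ennreal (exp (\<alpha> * \<phi>1 x)) * ennreal 1 \<partial>M1)"
    by (rule nn_integral_mult_fst[OF s]) measurable
  also have "\<dots> = ennreal exp_moment1"
    unfolding exp_moment1_def using nn_integral_eq_integral[OF exp_\<phi>1_integrable] by simp
  finally show ?thesis .
qed

text \<open>Truncation at the level \<open>2 / \<alpha> * ln (1 / t)\<close> balances the two terms and produces the logarithm.\<close>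

lemma lost_moment_le: "(\<integral>\<^sup>+(x, y). ennreal (\<phi>1 x) * ennreal (lost x y) \<partial>MM) \<le> ennreal moment_shift"
proof -
  define R where "R = 2 / \<alpha> * ln (1 / t)"
  have R_nonneg: "0 \<le> R" unfolding R_def using t_pos t_le_1 \<alpha>_pos by (intro mult_nonneg_nonneg) auto
  have exp_R: "exp (- \<alpha> * R / 2) = t" using t_pos \<alpha>_pos by (simp add: R_def ln_div)
  have "(\<integral>\<^sup>+(x, y). ennreal (\<phi>1 x) * ennreal (lost x y) \<partial>MM)
      = (\<integral>\<^sup>+z. ennreal (\<phi>1 (fst z)) * ennreal (case_prod lost z) \<partial>MM)" by (simp add: case_prod_beta')
  also have "\<dots> \<le> ennreal R * (\<integral>\<^sup>+z. ennreal (case_prod lost z) \<partial>MM)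
      + ennreal (2 / \<alpha> * exp (- \<alpha> * R / 2)) * (\<integral>\<^sup>+z. ennreal (exp (\<alpha> * \<phi>1 (fst z))) * ennreal (case_prod lost z) \<partial>MM)"
    using \<alpha>_pos \<phi>1_nonneg R_nonneg by (intro nn_integral_le_truncation_plus_exp) measurable
  also have "\<dots> \<le> ennreal R * ennreal tv + ennreal (2 / \<alpha> * t) * ennreal exp_moment1"
    using lost_mass_le lost_exp_moment_le unfolding exp_R by (intro add_mono mult_left_mono) (simp_all add: case_prod_beta')
  also have "\<dots> = ennreal (R * tv + 2 / \<alpha> * t * exp_moment1)"
    using R_nonneg tv_nonneg t_pos \<alpha>_pos exp_moment_nonneg by (simp flip: ennreal_mult ennreal_plus)
  also have "R * tv + 2 / \<alpha> * t * exp_moment1 = moment_shift"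
    by (simp add: moment_shift_def R_def tv_def algebra_simps)
  finally show ?thesis .
qed

lemma weighted_lost_le:
  assumes u: "0 \<le> u0" "0 \<le> u1"
  shows "(\<integral>\<^sup>+(x, y). ennreal (u0 + u1 * \<phi>1 x) * ennreal (lost x y) \<partial>MM) \<le> ennreal (u0 * tv + u1 * moment_shift)"
proof -
  have "(\<integral>\<^sup>+(x, y). ennreal (u0 + u1 * \<phi>1 x) * ennreal (lost x y) \<partial>MM)
      = (\<integral>\<^sup>+z. ennreal u0 * (case z of (x, y) \<Rightarrow> ennreal (lost x y))
          + ennreal u1 * (case z of (x, y) \<Rightarrow> ennreal (\<phi>1 x) * ennreal (lost x y)) \<partial>MM)"
    using u \<phi>1_nonneg by (intro nn_integral_cong) (auto simp: ennreal_plus ennreal_mult distrib_right mult.assoc)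
  also have "\<dots> = ennreal u0 * (\<integral>\<^sup>+(x, y). ennreal (lost x y) \<partial>MM)
      + ennreal u1 * (\<integral>\<^sup>+(x, y). ennreal (\<phi>1 x) * ennreal (lost x y) \<partial>MM)"
    by (simp add: nn_integral_add nn_integral_cmult)
  also have "\<dots> \<le> ennreal u0 * ennreal tv + ennreal u1 * ennreal moment_shift"
    by (intro add_mono mult_left_mono lost_mass_le lost_moment_le) auto
  also have "\<dots> = ennreal (u0 * tv + u1 * moment_shift)"
    using u tv_nonneg moment_shift_nonneg by (simp add: ennreal_mult ennreal_plus)
  finally show ?thesis .
qed

lemma weighted_shadow_le:
  assumes u: "0 \<le> u0" "0 \<le> u1"
  shows "(\<integral>\<^sup>+(x, y). ennreal ((u0 + u1 * (\<phi>1 x + \<phi>2 y)) * \<bar>shadow x y - s x y\<bar>) \<partial>MM)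
    \<le> ennreal (2 * (u0 * tv + u1 * moment_shift) + u1 * tv)"
proof -
  have "ennreal (u1 * \<phi>2 y) * ennreal \<bar>f1 y - f2 y\<bar> \<le> ennreal u1 * ennreal ((1 + \<phi>2 y) * \<bar>f y - 1\<bar>)" for y
    using u \<phi>2_nonneg[of y]
    by (simp add: abs_diff_eq ennreal_leI mult.assoc mult_left_mono mult_right_mono flip: ennreal_mult)
  then have "(\<integral>\<^sup>+y. ennreal (u1 * \<phi>2 y) * ennreal \<bar>f1 y - f2 y\<bar> \<partial>M2)
      \<le> (\<integral>\<^sup>+y. ennreal u1 * ennreal ((1 + \<phi>2 y) * \<bar>f y - 1\<bar>) \<partial>M2)"
    by (rule nn_integral_mono)
  also have "\<dots> = ennreal u1 * (\<integral>\<^sup>+y. ennreal ((1 + \<phi>2 y) * \<bar>f y - 1\<bar>) \<partial>M2)"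
    by (simp add: nn_integral_cmult)
  also have "\<dots> \<le> ennreal u1 * ennreal tv"
    by (intro mult_left_mono weighted_tv_f_le) simp
  finally have snd: "(\<integral>\<^sup>+y. ennreal (u1 * \<phi>2 y) * ennreal \<bar>f1 y - f2 y\<bar> \<partial>M2) \<le> ennreal (u1 * tv)"
    using u tv_nonneg by (simp add: ennreal_mult)
  have "(\<integral>\<^sup>+(x, y). ennreal ((u0 + u1 * (\<phi>1 x + \<phi>2 y)) * \<bar>shadow x y - s x y\<bar>) \<partial>MM)
      = (\<integral>\<^sup>+(x, y). (ennreal (u0 + u1 * \<phi>1 x) + ennreal (u1 * \<phi>2 y)) * ennreal \<bar>shadow x y - s x y\<bar> \<partial>MM)"
    using u \<phi>1_nonneg \<phi>2_nonneg
    by (intro nn_integral_cong) (auto simp: distrib_left add.assoc simp flip: ennreal_plus ennreal_mult)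
  also have "\<dots> \<le> 2 * (\<integral>\<^sup>+(x, y). ennreal (u0 + u1 * \<phi>1 x) * ennreal (lost x y) \<partial>MM)
      + (\<integral>\<^sup>+y. ennreal (u1 * \<phi>2 y) * ennreal \<bar>f1 y - f2 y\<bar> \<partial>M2)"
    by (rule weighted_shadow_diff_le) measurable
  also have "\<dots> \<le> 2 * ennreal (u0 * tv + u1 * moment_shift) + ennreal (u1 * tv)"
    by (intro add_mono mult_left_mono weighted_lost_le snd u) simp
  also have "2 * ennreal (u0 * tv + u1 * moment_shift) = ennreal (2 * (u0 * tv + u1 * moment_shift))"
    using u tv_nonneg moment_shift_nonneg by (subst ennreal_mult) auto
  finally show ?thesis
    using u tv_nonneg moment_shift_nonneg by (simp add: ennreal_plus)
qed

end

context perturbed_marginal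
begin

lemma shadow_exists:
  assumes f12: "f1 = (\<lambda>_. 1) \<and> f2 = f \<or> f1 = f \<and> f2 = (\<lambda>_. 1)"
    and s: "has_marginals (\<lambda>_. 1) f1 s" and ent: "integrable MM (\<lambda>(x, y). s x y * ln (s x y / f1 y))"
  obtains s' where "has_marginals (\<lambda>_. 1) f2 s'" "integrable MM (\<lambda>(x, y). s' x y * ln (s' x y / f2 y))"
    "(\<integral>(x, y). s' x y * ln (s' x y / f2 y) \<partial>MM) \<le> (\<integral>(x, y). s x y * ln (s x y / f1 y) \<partial>MM)"
    "(\<integral>(x, y). s' x y * c x y \<partial>MM) \<le> (\<integral>(x, y). s x y * c x y \<partial>MM) + cost_shift"
    "weighted_tv s' s \<le> ennreal (3 * tv + 2 * moment_shift)"
proof -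
  interpret perturbed_shadow M1 M2 c \<phi>1 \<phi>2 \<alpha> B0 B1 f K t s f1 f2
    by unfold_locales
       (use f12 s ent f_measurable f_pos f_integrable f_integral M2.prob_space in \<open>auto simp: abs_minus_commute\<close>)
  have c: "integrable MM (\<lambda>(x, y). s x y * c x y)" "integrable MM (\<lambda>(x, y). shadow x y * c x y)"
    using cost_integrable[OF s] cost_integrable[OF has_marginals_shadow] f12 f_\<phi>2_integrable \<phi>2_integrable by auto
  show thesis
  proof (rule that[OF has_marginals_shadow shadow_ent_integrable shadow_ent_le])
    show "(\<integral>(x, y). shadow x y * c x y \<partial>MM) \<le> (\<integral>(x, y). s x y * c x y \<partial>MM) + cost_shift"
      using weighted_shadow_le[OF B_nonneg] cost_shift_nonneg
      by (intro cost_le_cost_plus c) (simp_all add: cost_shift_def)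
    show "weighted_tv shadow s \<le> ennreal (3 * tv + 2 * moment_shift)"
      using weighted_shadow_le[of 1 1] by (simp add: weighted_tv_def algebra_simps)
  qed
qed

lemma
  assumes s: "has_marginals (\<lambda>_. 1) f s"
  shows relative_entropy_integrable_iff: "integrable MM (\<lambda>(x, y). s x y * ln (s x y / f y))
      \<longleftrightarrow> integrable MM (\<lambda>(x, y). s x y * ln (s x y))"
    and relative_entropy_eq: "integrable MM (\<lambda>(x, y). s x y * ln (s x y)) \<Longrightarrow>
      (\<integral>(x, y). s x y * ln (s x y / f y) \<partial>MM)
        = (\<integral>(x, y). s x y * ln (s x y) \<partial>MM) - (\<integral>y. f y * ln (f y) \<partial>M2)"
proof -
  have ln_f: "integrable MM (\<lambda>(x, y). s x y * ln (f y))"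
    "(\<integral>(x, y). s x y * ln (f y) \<partial>MM) = (\<integral>y. f y * ln (f y) \<partial>M2)"
    using integrable_mult_snd[OF s _ f_ent_integrable] integral_mult_snd[OF s _ f_ent_integrable] by simp_all
  have eq: "s x y * ln (s x y / f y) = s x y * ln (s x y) - s x y * ln (f y)" for x y
    using has_marginalsD(2)[OF s, of x y] f_pos[of y]
    by (cases "s x y = 0") (simp_all add: ln_div algebra_simps)
  have rel: "(\<lambda>(x, y). s x y * ln (s x y / f y))
      = (\<lambda>z. (case z of (x, y) \<Rightarrow> s x y * ln (s x y)) - (case z of (x, y) \<Rightarrow> s x y * ln (f y)))"
    by (auto simp: eq)
  have ent: "(\<lambda>(x, y). s x y * ln (s x y))
      = (\<lambda>z. (case z of (x, y) \<Rightarrow> s x y * ln (s x y / f y)) + (case z of (x, y) \<Rightarrow> s x y * ln (f y)))"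
    by (auto simp: eq)
  show "integrable MM (\<lambda>(x, y). s x y * ln (s x y / f y)) \<longleftrightarrow> integrable MM (\<lambda>(x, y). s x y * ln (s x y))"
  proof
    assume "integrable MM (\<lambda>(x, y). s x y * ln (s x y / f y))"
    from Bochner_Integration.integrable_add[OF this ln_f(1)]
    show "integrable MM (\<lambda>(x, y). s x y * ln (s x y))" by (subst ent)
  next
    assume "integrable MM (\<lambda>(x, y). s x y * ln (s x y))"
    from Bochner_Integration.integrable_diff[OF this ln_f(1)]
    show "integrable MM (\<lambda>(x, y). s x y * ln (s x y / f y))" by (subst rel)
  qed
  assume "integrable MM (\<lambda>(x, y). s x y * ln (s x y))"
  from Bochner_Integration.integral_diff[OF this ln_f(1)]
  show "(\<integral>(x, y). s x y * ln (s x y / f y) \<partial>MM)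
      = (\<integral>(x, y). s x y * ln (s x y) \<partial>MM) - (\<integral>y. f y * ln (f y) \<partial>M2)"
    unfolding rel ln_f(2) .
qed

lemma optimal_le_perturbed:
  assumes r: "optimal_density r"
    and s: "has_marginals (\<lambda>_. 1) f s" and ent: "integrable MM (\<lambda>(x, y). s x y * ln (s x y))"
  shows "entropic_cost r \<le> entropic_cost s + cost_shift"
proof -
  have "integrable MM (\<lambda>(x, y). s x y * ln (s x y / f y))"
    using relative_entropy_integrable_iff[OF s] ent by simp
  then obtain s' where s': "has_marginals (\<lambda>_. 1) (\<lambda>_. 1) s'" "integrable MM (\<lambda>(x, y). s' x y * ln (s' x y / 1))"
    "(\<integral>(x, y). s' x y * ln (s' x y / 1) \<partial>MM) \<le> (\<integral>(x, y). s x y * ln (s x y / f y) \<partial>MM)"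
    "(\<integral>(x, y). s' x y * c x y \<partial>MM) \<le> (\<integral>(x, y). s x y * c x y \<partial>MM) + cost_shift"
    using shadow_exists[of f "\<lambda>_. 1" s] s by blast
  then have "entropic_cost r \<le> entropic_cost s'"
    using r by (simp add: optimal_density_def coupling_density_def)
  also have "\<dots> \<le> entropic_cost s + cost_shift"
    using s'(3,4) relative_entropy_eq[OF s ent] f_ent_nonneg by (simp add: entropic_cost_def)
  finally show ?thesis .
qed

lemma perturbed_competitor:
  assumes r: "coupling_density r"
  obtains s where "has_marginals (\<lambda>_. 1) f s" "integrable MM (\<lambda>(x, y). s x y * ln (s x y))"
    "entropic_cost s \<le> entropic_cost r + cost_shift + K * t\<^sup>2"
    "weighted_tv s r \<le> ennreal (3 * tv + 2 * moment_shift)"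
proof -
  have marginals: "has_marginals (\<lambda>_. 1) (\<lambda>_. 1) r" and ent: "integrable MM (\<lambda>(x, y). r x y * ln (r x y / 1))"
    using r by (simp_all add: coupling_density_def)
  obtain s where s: "has_marginals (\<lambda>_. 1) f s" "integrable MM (\<lambda>(x, y). s x y * ln (s x y / f y))"
    "(\<integral>(x, y). s x y * ln (s x y / f y) \<partial>MM) \<le> (\<integral>(x, y). r x y * ln (r x y / 1) \<partial>MM)"
    "(\<integral>(x, y). s x y * c x y \<partial>MM) \<le> (\<integral>(x, y). r x y * c x y \<partial>MM) + cost_shift"
    "weighted_tv s r \<le> ennreal (3 * tv + 2 * moment_shift)"
    using shadow_exists[OF _ marginals ent] by blast
  have ent_s: "integrable MM (\<lambda>(x, y). s x y * ln (s x y))"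
    using s(2) relative_entropy_integrable_iff[OF s(1)] by simp
  have "entropic_cost s \<le> entropic_cost r + cost_shift + K * t\<^sup>2"
    using s(3,4) relative_entropy_eq[OF s(1) ent_s] f_ent_le by (simp add: entropic_cost_def)
  with s ent_s that show thesis by blast
qed

end

locale matched_gibbs = perturbed_marginal +
  fixes a :: "'a \<Rightarrow> real" and b :: "'b \<Rightarrow> real"
  assumes ab: "potentials a b" and matched: "has_marginals (\<lambda>_. 1) f (gibbs a b)"
begin

abbreviation "\<rho> \<equiv> gibbs a b"

lemma potentials_measurable[measurable]: "a \<in> borel_measurable M1" "b \<in> borel_measurable M2"
  using potentialsD[OF ab] by auto

lemma \<rho>_nonneg: "0 \<le> \<rho> x y"
  using gibbs_pos[of a b x y] by simp

lemma \<rho>_xlnx: "\<rho> x y * ln (\<rho> x y) = \<rho> x y * a x + \<rho> x y * b y - \<rho> x y * c x y"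
  by (simp add: gibbs_def algebra_simps)

text \<open>The entropy integrand is at least \<open>-1\<close> and \<open>c\<close> is nonnegative, so \<open>\<rho> * b\<close> is bounded below by
  \<open>- 1 - \<rho> * a\<close>; from above it is bounded by the linear growth of \<open>b\<close> in \<open>\<phi>2\<close>.\<close>

lemma \<rho>_b_integrable: "integrable MM (\<lambda>(x, y). \<rho> x y * b y)"
proof -
  obtain A where A: "AE y in M2. b y \<le> A * (1 + \<phi>2 y)" using ab unfolding potentials_def by blast
  have f: "integrable M2 (\<lambda>y. f y * (1 + \<phi>2 y))"
    using f_integrable f_\<phi>2_integrable by (simp add: distrib_left)
  have a: "integrable M1 (\<lambda>x. 1 * a x)" using potentialsD(1)[OF ab] by simp
  let ?bound = "\<lambda>z. \<bar>case z of (x, y) \<Rightarrow> \<rho> x y * a x\<bar> + \<bar>A\<bar> * (case z of (x, y) \<Rightarrow> \<rho> x y * (1 + \<phi>2 y)) + 1"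
  have bound: "integrable MM ?bound"
    using integrable_mult_fst[OF matched potentials_measurable(1) a] integrable_mult_snd[OF matched _ f] by auto
  have "AE z in MM. b (snd z) \<le> A * (1 + \<phi>2 (snd z))" by (rule AE_pair_measure) (use A in auto)
  then have le: "AE z in MM. norm (case z of (x, y) \<Rightarrow> \<rho> x y * b y) \<le> norm (?bound z)"
  proof eventually_elim
    case (elim z)
    obtain x y where z: "z = (x, y)" by (cases z)
    have weight: "0 \<le> \<rho> x y * (1 + \<phi>2 y)" using \<rho>_nonneg \<phi>2_nonneg[of y] by simp
    have "\<rho> x y * b y \<le> \<rho> x y * (A * (1 + \<phi>2 y))"
      using elim \<rho>_nonneg by (intro mult_left_mono) (auto simp: z)
    also have "\<dots> = A * (\<rho> x y * (1 + \<phi>2 y))" by simp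
    also have "\<dots> \<le> \<bar>A\<bar> * (\<rho> x y * (1 + \<phi>2 y))" using weight by (intro mult_right_mono) auto
    finally have upper: "\<rho> x y * b y \<le> \<bar>A\<bar> * (\<rho> x y * (1 + \<phi>2 y))" .
    have "0 \<le> \<rho> x y * c x y" using \<rho>_nonneg c_nonneg by simp
    then have lower: "- 1 - \<rho> x y * a x \<le> \<rho> x y * b y"
      using xlnx_ge_minus_one[OF \<rho>_nonneg[of x y]] \<rho>_xlnx[of x y] by linarith
    have "0 \<le> \<bar>A\<bar> * (\<rho> x y * (1 + \<phi>2 y))" using weight by simp
    then show ?case unfolding z prod.case real_norm_def using upper lower by linarith
  qed
  show ?thesis by (rule Bochner_Integration.integrable_bound[OF bound _ le]) measurable
qed

lemma f_b_integrable: "integrable M2 (\<lambda>y. f y * b y)"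
proof (rule integrable_cong_AE_imp[OF integrable_snd[OF \<rho>_b_integrable]])
  show "AE y in M2. (\<integral>x. \<rho> x y * b y \<partial>M1) = f y * b y"
    using has_marginals_section_snd[OF matched] by eventually_elim simp
qed measurable

lemma
  assumes s: "has_marginals (\<lambda>_. 1) f s"
  shows potential_sum_integrable: "integrable MM (\<lambda>(x, y). s x y * (a x + b y))"
    and potential_sum_integral: "(\<integral>(x, y). s x y * (a x + b y) \<partial>MM) = (\<integral>x. a x \<partial>M1) + (\<integral>y. f y * b y \<partial>M2)"
proof -
  have a: "integrable M1 (\<lambda>x. 1 * a x)" using potentialsD(1)[OF ab] by simp
  note fst = integrable_mult_fst[OF s potentials_measurable(1) a] integral_mult_fst[OF s potentials_measurable(1) a]
  note snd = integrable_mult_snd[OF s potentials_measurable(2) f_b_integrable]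
    integral_mult_snd[OF s potentials_measurable(2) f_b_integrable]
  have split: "(\<lambda>(x, y). s x y * (a x + b y)) = (\<lambda>z. (case z of (x, y) \<Rightarrow> s x y * a x) + (case z of (x, y) \<Rightarrow> s x y * b y))"
    by (auto simp: distrib_left)
  show "integrable MM (\<lambda>(x, y). s x y * (a x + b y))"
    unfolding split by (rule Bochner_Integration.integrable_add[OF fst(1) snd(1)])
  show "(\<integral>(x, y). s x y * (a x + b y) \<partial>MM) = (\<integral>x. a x \<partial>M1) + (\<integral>y. f y * b y \<partial>M2)"
    unfolding split Bochner_Integration.integral_add[OF fst(1) snd(1)] fst(2) snd(2) by simp
qed

lemma
  shows \<rho>_ent_integrable: "integrable MM (\<lambda>(x, y). \<rho> x y * ln (\<rho> x y))"
    and entropic_cost_\<rho>: "entropic_cost \<rho> = (\<integral>x. a x \<partial>M1) + (\<integral>y. f y * b y \<partial>M2)"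
proof -
  have eq: "(\<lambda>(x, y). \<rho> x y * ln (\<rho> x y))
      = (\<lambda>z. (case z of (x, y) \<Rightarrow> \<rho> x y * (a x + b y)) - (case z of (x, y) \<Rightarrow> \<rho> x y * c x y))"
    by (auto simp: \<rho>_xlnx algebra_simps)
  note sum = potential_sum_integrable[OF matched] and cost = cost_integrable[OF matched f_\<phi>2_integrable]
  show "integrable MM (\<lambda>(x, y). \<rho> x y * ln (\<rho> x y))"
    unfolding eq by (rule Bochner_Integration.integrable_diff[OF sum cost])
  show "entropic_cost \<rho> = (\<integral>x. a x \<partial>M1) + (\<integral>y. f y * b y \<partial>M2)"
    unfolding entropic_cost_def eq Bochner_Integration.integral_diff[OF sum cost] potential_sum_integral[OF matched]
    by simp
qed

text \<open>Among densities with the marginals of \<open>\<rho>\<close>, the excess entropic cost is the relative entropy.\<close>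

lemma
  assumes s: "has_marginals (\<lambda>_. 1) f s" and ent: "integrable MM (\<lambda>(x, y). s x y * ln (s x y))"
  shows kl_div_integrable: "integrable MM (\<lambda>(x, y). kl_div (s x y) (\<rho> x y))"
    and kl_div_integral: "(\<integral>(x, y). kl_div (s x y) (\<rho> x y) \<partial>MM) = entropic_cost s - entropic_cost \<rho>"
proof -
  have "s x y * ln (s x y / \<rho> x y) = s x y * ln (s x y) - s x y * (a x + b y) + s x y * c x y" for x y
  proof (cases "s x y = 0")
    case False
    then have "0 < s x y" using has_marginalsD(2)[OF s, of x y] by simp
    then have "ln (s x y / \<rho> x y) = ln (s x y) - (a x + b y) + c x y"
      using gibbs_pos[of a b x y] by (subst ln_div) (simp_all add: gibbs_def)
    then show ?thesis by (simp only: distrib_left right_diff_distrib)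
  qed simp
  then have eq: "(\<lambda>(x, y). kl_div (s x y) (\<rho> x y)) =
    (\<lambda>z. (case z of (x, y) \<Rightarrow> s x y * ln (s x y)) - (case z of (x, y) \<Rightarrow> s x y * (a x + b y))
      + (case z of (x, y) \<Rightarrow> s x y * c x y) - case_prod s z + case_prod \<rho> z)"
    by (auto simp: kl_div_def)
  note integrable = ent potential_sum_integrable[OF s] cost_integrable[OF s f_\<phi>2_integrable]
    has_marginals_integrable[OF s] has_marginals_integrable[OF matched]
  show "integrable MM (\<lambda>(x, y). kl_div (s x y) (\<rho> x y))"
    unfolding eq by (intro Bochner_Integration.integrable_add Bochner_Integration.integrable_diff integrable)
  show "(\<integral>(x, y). kl_div (s x y) (\<rho> x y) \<partial>MM) = entropic_cost s - entropic_cost \<rho>"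
    unfolding eq entropic_cost_\<rho> unfolding entropic_cost_def
    by (simp only: Bochner_Integration.integral_add Bochner_Integration.integral_diff integrable
        Bochner_Integration.integrable_add Bochner_Integration.integrable_diff
        potential_sum_integral[OF s] has_marginals_integral[OF s] has_marginals_integral[OF matched])
qed

lemma entropic_cost_\<rho>_le:
  assumes s: "has_marginals (\<lambda>_. 1) f s" and ent: "integrable MM (\<lambda>(x, y). s x y * ln (s x y))"
  shows "entropic_cost \<rho> \<le> entropic_cost s"
proof -
  have "0 \<le> (\<integral>(x, y). kl_div (s x y) (\<rho> x y) \<partial>MM)"
    by (intro integral_nonneg_AE AE_I2) (simp add: case_prod_beta' kl_div_nonneg has_marginalsD(2)[OF s] gibbs_pos)
  then show ?thesis using kl_div_integral[OF s ent] by simp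
qed

lemma entropic_cost_estimate:
  assumes r: "optimal_density r"
  shows "\<bar>entropic_cost r - entropic_cost \<rho>\<bar> \<le> cost_shift + K * t\<^sup>2"
proof -
  have coupling: "coupling_density r" using r by (simp add: optimal_density_def)
  obtain s where s: "has_marginals (\<lambda>_. 1) f s" "integrable MM (\<lambda>(x, y). s x y * ln (s x y))"
    "entropic_cost s \<le> entropic_cost r + cost_shift + K * t\<^sup>2"
    by (rule perturbed_competitor[OF coupling])
  have "0 \<le> K * t\<^sup>2" using K_nonneg by simp
  then show ?thesis
    using entropic_cost_\<rho>_le[OF s(1,2)] s(3) optimal_le_perturbed[OF r matched \<rho>_ent_integrable] by linarith
qed

lemma weighted_tv_fst_le:
  assumes s: "has_marginals (\<lambda>_. 1) f s" and ent: "integrable MM (\<lambda>(x, y). s x y * ln (s x y))"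
    and l: "0 < l" "l \<le> \<alpha> / 2"
  shows "(\<integral>\<^sup>+(x, y). ennreal ((1 + \<phi>1 x) * \<bar>s x y - \<rho> x y\<bar>) \<partial>MM)
    \<le> ennreal ((entropic_cost s - entropic_cost \<rho>) / l + l * (4 / \<alpha>\<^sup>2) * (exp \<alpha> * exp_moment1))"
proof -
  have exp_eq: "exp (\<alpha> * (1 + \<phi>1 x)) = exp \<alpha> * exp (\<alpha> * \<phi>1 x)" for x by (simp add: distrib_left exp_add)
  have exp: "(\<lambda>x. exp (\<alpha> * (1 + \<phi>1 x))) \<in> borel_measurable M1" "integrable M1 (\<lambda>x. 1 * exp (\<alpha> * (1 + \<phi>1 x)))"
    unfolding exp_eq using exp_\<phi>1_integrable by simp_all
  have exp_\<rho>: "integrable MM (\<lambda>z. \<rho> (fst z) (snd z) * exp (\<alpha> * (1 + \<phi>1 (fst z))))"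
    "(\<integral>z. \<rho> (fst z) (snd z) * exp (\<alpha> * (1 + \<phi>1 (fst z))) \<partial>MM) = exp \<alpha> * exp_moment1"
    using integrable_mult_fst[OF matched exp] integral_mult_fst[OF matched exp]
    by (simp_all add: case_prod_beta' exp_eq exp_moment1_def)
  have "(\<integral>\<^sup>+z. ennreal ((1 + \<phi>1 (fst z)) * \<bar>s (fst z) (snd z) - \<rho> (fst z) (snd z)\<bar>) \<partial>MM)
      \<le> ennreal ((\<integral>z. kl_div (s (fst z) (snd z)) (\<rho> (fst z) (snd z)) \<partial>MM) / l
        + l * (4 / \<alpha>\<^sup>2) * (\<integral>z. \<rho> (fst z) (snd z) * exp (\<alpha> * (1 + \<phi>1 (fst z))) \<partial>MM))"
    using kl_div_integrable[OF s ent] exp_\<rho>(1) \<phi>1_nonneg has_marginalsD(2)[OF s] gibbs_pos l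
    by (intro weighted_pinsker) (simp_all add: case_prod_beta')
  then show ?thesis
    using kl_div_integral[OF s ent] exp_\<rho>(2) by (simp add: case_prod_beta')
qed

text \<open>The second marginal of \<open>\<rho>\<close> need not have exponential moments. They are only needed where \<open>f \<le> 1\<close>,
  and after damping by \<open>1 / f\<close> elsewhere; the weight lost is controlled by the total variation of \<open>f\<close>.\<close>

definition "damp y = min 1 (1 / f y)"

lemma damp_measurable[measurable]: "damp \<in> borel_measurable M2"
  unfolding damp_def[abs_def] by measurable

lemma damp_pos: "0 < damp y" and damp_le_1: "damp y \<le> 1" and f_damp_le_1: "f y * damp y \<le> 1"
  and f_undamped_le: "f y * (1 - damp y) \<le> \<bar>f y - 1\<bar>"
  using f_pos[of y] by (auto simp: damp_def min_def field_simps)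

lemma
  shows damped_exp_moment_integrable: "integrable M2 (\<lambda>y. f y * (damp y * exp (\<alpha> * \<phi>2 y)))"
    and damped_exp_moment_le: "(\<integral>y. f y * (damp y * exp (\<alpha> * \<phi>2 y)) \<partial>M2) \<le> exp_moment2"
proof -
  have le: "f y * (damp y * exp (\<alpha> * \<phi>2 y)) \<le> exp (\<alpha> * \<phi>2 y)" for y
    using mult_right_mono[OF f_damp_le_1[of y], of "exp (\<alpha> * \<phi>2 y)"] by (simp add: mult.assoc)
  show int: "integrable M2 (\<lambda>y. f y * (damp y * exp (\<alpha> * \<phi>2 y)))"
    by (rule Bochner_Integration.integrable_bound[OF exp_\<phi>2_integrable])
       (use le f_nonneg damp_pos in \<open>auto simp: less_imp_le\<close>)
  show "(\<integral>y. f y * (damp y * exp (\<alpha> * \<phi>2 y)) \<partial>M2) \<le> exp_moment2"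
    unfolding exp_moment2_def by (rule integral_mono[OF int exp_\<phi>2_integrable le])
qed

lemma weighted_tv_damped_le:
  assumes s: "has_marginals (\<lambda>_. 1) f s" and ent: "integrable MM (\<lambda>(x, y). s x y * ln (s x y))"
    and l: "0 < l" "l \<le> \<alpha> / 2"
  shows "(\<integral>\<^sup>+(x, y). ennreal (\<phi>2 y * damp y * \<bar>s x y - \<rho> x y\<bar>) \<partial>MM)
    \<le> ennreal ((entropic_cost s - entropic_cost \<rho>) / l + l * (4 / \<alpha>\<^sup>2) * exp_moment2)"
proof -
  let ?kl = "\<lambda>z. kl_div (s (fst z) (snd z)) (\<rho> (fst z) (snd z))"
  note [measurable] = has_marginalsD(1)[OF s]
  have kl: "integrable MM ?kl" "(\<integral>z. ?kl z \<partial>MM) = entropic_cost s - entropic_cost \<rho>"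
    using kl_div_integrable[OF s ent] kl_div_integral[OF s ent] by (simp_all add: case_prod_beta')
  have kl_nonneg: "0 \<le> ?kl z" for z by (rule kl_div_nonneg[OF has_marginalsD(2)[OF s] gibbs_pos])
  have damp_kl: "damp (snd z) * ?kl z \<le> ?kl z" for z
    using kl_nonneg damp_pos damp_le_1 by (intro mult_left_le_one_le) (auto simp: less_imp_le)
  have scale: "kl_div (damp y * s x y) (damp y * \<rho> x y) = damp y * kl_div (s x y) (\<rho> x y)" for x y
    by (rule kl_div_scale[OF damp_pos])
  have int: "integrable MM (\<lambda>z. damp (snd z) * ?kl z)"
  proof (rule Bochner_Integration.integrable_bound[OF kl(1)])
    show "AE z in MM. norm (damp (snd z) * ?kl z) \<le> norm (?kl z)"
      using damp_kl kl_nonneg damp_pos by (intro AE_I2) (simp add: abs_mult less_imp_le)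
  qed (use borel_measurable_integrable[OF kl(1)] in measurable)
  have exp: "integrable MM (\<lambda>z. \<rho> (fst z) (snd z) * (damp (snd z) * exp (\<alpha> * \<phi>2 (snd z))))"
    "(\<integral>z. \<rho> (fst z) (snd z) * (damp (snd z) * exp (\<alpha> * \<phi>2 (snd z))) \<partial>MM)
      = (\<integral>y. f y * (damp y * exp (\<alpha> * \<phi>2 y)) \<partial>M2)"
    using integrable_mult_snd[OF matched _ damped_exp_moment_integrable]
      integral_mult_snd[OF matched _ damped_exp_moment_integrable] by (simp_all add: case_prod_beta')
  have "(\<integral>\<^sup>+z. ennreal (\<phi>2 (snd z) * \<bar>damp (snd z) * s (fst z) (snd z) - damp (snd z) * \<rho> (fst z) (snd z)\<bar>) \<partial>MM)
      \<le> ennreal ((\<integral>z. kl_div (damp (snd z) * s (fst z) (snd z)) (damp (snd z) * \<rho> (fst z) (snd z)) \<partial>MM) / l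
        + l * (4 / \<alpha>\<^sup>2) * (\<integral>z. damp (snd z) * \<rho> (fst z) (snd z) * exp (\<alpha> * \<phi>2 (snd z)) \<partial>MM))"
    using int exp(1) damp_pos \<phi>2_nonneg has_marginalsD(2)[OF s] gibbs_pos l
    by (intro weighted_pinsker) (simp_all add: scale less_imp_le mult_ac)
  also have "\<dots> \<le> ennreal ((entropic_cost s - entropic_cost \<rho>) / l + l * (4 / \<alpha>\<^sup>2) * exp_moment2)"
    using integral_mono[OF int kl(1) damp_kl] kl(2) exp(2) damped_exp_moment_le l
    by (intro ennreal_leI add_mono divide_right_mono mult_left_mono) (simp_all add: scale mult_ac)
  finally show ?thesis
    using damp_pos by (simp add: case_prod_beta' abs_mult less_imp_le mult.assoc flip: right_diff_distrib)
qed

lemma weighted_tv_undamped_le: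
  assumes s: "has_marginals (\<lambda>_. 1) f s"
  shows "(\<integral>\<^sup>+(x, y). ennreal (\<phi>2 y * (1 - damp y) * \<bar>s x y - \<rho> x y\<bar>) \<partial>MM) \<le> ennreal (2 * tv)"
proof -
  note [measurable] = has_marginalsD(1)[OF s] and s_nonneg = has_marginalsD(2)[OF s]
  let ?w = "\<lambda>y. ennreal (\<phi>2 y * (1 - damp y))"
  have w: "0 \<le> \<phi>2 y * (1 - damp y)" for y using \<phi>2_nonneg[of y] damp_le_1[of y] by simp
  have marginal: "(\<integral>\<^sup>+(x, y). ?w y * ennreal (q x y) \<partial>MM) \<le> ennreal tv" if q: "has_marginals (\<lambda>_. 1) f q" for q
  proof -
    have "(\<integral>\<^sup>+(x, y). ?w y * ennreal (q x y) \<partial>MM) = (\<integral>\<^sup>+y. ?w y * ennreal (f y) \<partial>M2)"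
      by (rule nn_integral_mult_snd[OF q]) measurable
    also have "\<dots> \<le> (\<integral>\<^sup>+y. ennreal ((1 + \<phi>2 y) * \<bar>f y - 1\<bar>) \<partial>M2)"
    proof (rule nn_integral_mono)
      fix y
      have "\<phi>2 y * (f y * (1 - damp y)) \<le> (1 + \<phi>2 y) * \<bar>f y - 1\<bar>"
        using \<phi>2_nonneg[of y] f_undamped_le[of y] f_nonneg[of y] damp_le_1[of y] by (intro mult_mono) auto
      then show "?w y * ennreal (f y) \<le> ennreal ((1 + \<phi>2 y) * \<bar>f y - 1\<bar>)"
        using w f_nonneg by (simp add: ennreal_leI mult_ac flip: ennreal_mult)
    qed
    also note weighted_tv_f_le
    finally show ?thesis .
  qed
  have "(\<integral>\<^sup>+(x, y). ennreal (\<phi>2 y * (1 - damp y) * \<bar>s x y - \<rho> x y\<bar>) \<partial>MM)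
      \<le> (\<integral>\<^sup>+z. (case z of (x, y) \<Rightarrow> ?w y * ennreal (s x y)) + (case z of (x, y) \<Rightarrow> ?w y * ennreal (\<rho> x y)) \<partial>MM)"
  proof (rule nn_integral_mono, clarify)
    fix x y
    have "\<phi>2 y * (1 - damp y) * \<bar>s x y - \<rho> x y\<bar> \<le> \<phi>2 y * (1 - damp y) * (s x y + \<rho> x y)"
      using w s_nonneg[of x y] \<rho>_nonneg[of x y] by (intro mult_left_mono) auto
    then show "ennreal (\<phi>2 y * (1 - damp y) * \<bar>s x y - \<rho> x y\<bar>) \<le> ?w y * ennreal (s x y) + ?w y * ennreal (\<rho> x y)"
      using w s_nonneg \<rho>_nonneg by (simp add: ennreal_leI distrib_left flip: ennreal_mult ennreal_plus)
  qed
  also have "\<dots> = (\<integral>\<^sup>+(x, y). ?w y * ennreal (s x y) \<partial>MM) + (\<integral>\<^sup>+(x, y). ?w y * ennreal (\<rho> x y) \<partial>MM)"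
    by (rule nn_integral_add) measurable
  also have "\<dots> \<le> ennreal tv + ennreal tv" by (intro add_mono marginal s matched)
  also have "\<dots> = ennreal (2 * tv)" using tv_nonneg by (simp flip: ennreal_plus)
  finally show ?thesis .
qed

lemma weighted_tv_\<rho>_le:
  assumes s: "has_marginals (\<lambda>_. 1) f s" and ent: "integrable MM (\<lambda>(x, y). s x y * ln (s x y))"
    and l: "0 < l" "l \<le> \<alpha> / 2"
  shows "weighted_tv s \<rho> \<le> ennreal (2 * ((entropic_cost s - entropic_cost \<rho>) / l)
    + l * (4 / \<alpha>\<^sup>2) * (exp \<alpha> * exp_moment1 + exp_moment2) + 2 * tv)"
proof -
  note [measurable] = has_marginalsD(1)[OF s]
  have excess: "0 \<le> (entropic_cost s - entropic_cost \<rho>) / l" using entropic_cost_\<rho>_le[OF s ent] l by simp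
  have moments: "0 \<le> l * (4 / \<alpha>\<^sup>2) * (exp \<alpha> * exp_moment1)" "0 \<le> l * (4 / \<alpha>\<^sup>2) * exp_moment2"
    using l exp_moment_nonneg by simp_all
  have split: "ennreal ((1 + (\<phi>1 x + \<phi>2 y)) * \<bar>s x y - \<rho> x y\<bar>) = ennreal ((1 + \<phi>1 x) * \<bar>s x y - \<rho> x y\<bar>)
      + ennreal (\<phi>2 y * damp y * \<bar>s x y - \<rho> x y\<bar>) + ennreal (\<phi>2 y * (1 - damp y) * \<bar>s x y - \<rho> x y\<bar>)" for x y
  proof -
    have "(1 + (\<phi>1 x + \<phi>2 y)) * \<bar>s x y - \<rho> x y\<bar> = (1 + \<phi>1 x) * \<bar>s x y - \<rho> x y\<bar>
        + \<phi>2 y * damp y * \<bar>s x y - \<rho> x y\<bar> + \<phi>2 y * (1 - damp y) * \<bar>s x y - \<rho> x y\<bar>"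
      by (simp add: algebra_simps)
    then show ?thesis
      using \<phi>1_nonneg[of x] \<phi>2_nonneg[of y] damp_pos[of y] damp_le_1[of y] by simp
  qed
  have "weighted_tv s \<rho> = (\<integral>\<^sup>+(x, y). ennreal ((1 + \<phi>1 x) * \<bar>s x y - \<rho> x y\<bar>) \<partial>MM)
      + (\<integral>\<^sup>+(x, y). ennreal (\<phi>2 y * damp y * \<bar>s x y - \<rho> x y\<bar>) \<partial>MM)
      + (\<integral>\<^sup>+(x, y). ennreal (\<phi>2 y * (1 - damp y) * \<bar>s x y - \<rho> x y\<bar>) \<partial>MM)"
    unfolding weighted_tv_def split by (simp add: nn_integral_add case_prod_beta')
  also have "\<dots> \<le> ennreal ((entropic_cost s - entropic_cost \<rho>) / l + l * (4 / \<alpha>\<^sup>2) * (exp \<alpha> * exp_moment1))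
      + ennreal ((entropic_cost s - entropic_cost \<rho>) / l + l * (4 / \<alpha>\<^sup>2) * exp_moment2) + ennreal (2 * tv)"
    by (intro add_mono weighted_tv_fst_le weighted_tv_damped_le weighted_tv_undamped_le s ent l)
  also have "\<dots> = ennreal ((entropic_cost s - entropic_cost \<rho>) / l + l * (4 / \<alpha>\<^sup>2) * (exp \<alpha> * exp_moment1)
      + ((entropic_cost s - entropic_cost \<rho>) / l + l * (4 / \<alpha>\<^sup>2) * exp_moment2) + 2 * tv)"
    using excess moments tv_nonneg by (simp only: ennreal_plus add_nonneg_nonneg mult_nonneg_nonneg zero_le_numeral)
  finally show ?thesis by (simp only: distrib_left mult_2 add_ac)
qed

lemma weighted_tv_estimate:
  assumes r: "optimal_density r" and l: "0 < l" "l \<le> \<alpha> / 2"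
  shows "weighted_tv r \<rho> \<le> ennreal (5 * tv + 2 * moment_shift + 2 * ((2 * cost_shift + K * t\<^sup>2) / l)
    + l * (4 / \<alpha>\<^sup>2) * (exp \<alpha> * exp_moment1 + exp_moment2))"
proof -
  have coupling: "coupling_density r" using r by (simp add: optimal_density_def)
  obtain s where s: "has_marginals (\<lambda>_. 1) f s" and ent: "integrable MM (\<lambda>(x, y). s x y * ln (s x y))"
    and cost: "entropic_cost s \<le> entropic_cost r + cost_shift + K * t\<^sup>2"
    and tv_sr: "weighted_tv s r \<le> ennreal (3 * tv + 2 * moment_shift)"
    by (rule perturbed_competitor[OF coupling])
  let ?tv = "2 * ((2 * cost_shift + K * t\<^sup>2) / l) + l * (4 / \<alpha>\<^sup>2) * (exp \<alpha> * exp_moment1 + exp_moment2) + 2 * tv"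
  have "(entropic_cost s - entropic_cost \<rho>) / l \<le> (2 * cost_shift + K * t\<^sup>2) / l"
    using cost optimal_le_perturbed[OF r matched \<rho>_ent_integrable] l by (intro divide_right_mono) auto
  then have "weighted_tv s \<rho> \<le> ennreal ?tv"
    by (intro order_trans[OF weighted_tv_\<rho>_le[OF s ent l]] ennreal_leI add_right_mono mult_left_mono) auto
  then have tv_s\<rho>: "weighted_tv r s + weighted_tv s \<rho> \<le> ennreal (3 * tv + 2 * moment_shift) + ennreal ?tv"
    using tv_sr unfolding weighted_tv_commute[of r s] by (intro add_mono)
  have "weighted_tv r \<rho> \<le> weighted_tv r s + weighted_tv s \<rho>"
    using coupling has_marginalsD(1)[OF s] has_marginalsD(1)[OF matched]
    by (intro weighted_tv_triangle) (auto simp: coupling_density_def dest: has_marginalsD(1))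
  also note tv_s\<rho>
  also have "ennreal (3 * tv + 2 * moment_shift) + ennreal ?tv = ennreal (3 * tv + 2 * moment_shift + ?tv)"
    using tv_nonneg moment_shift_nonneg cost_shift_nonneg K_nonneg l exp_moment_nonneg
    by (intro ennreal_plus[symmetric] add_nonneg_nonneg mult_nonneg_nonneg divide_nonneg_nonneg) auto
  also have "3 * tv + 2 * moment_shift + ?tv = 5 * tv + 2 * moment_shift + 2 * ((2 * cost_shift + K * t\<^sup>2) / l)
      + l * (4 / \<alpha>\<^sup>2) * (exp \<alpha> * exp_moment1 + exp_moment2)" by linarith
  finally show ?thesis .
qed

end

section \<open>Convergence rates for the densities\<close>

context cost_space
begin

definition "cost_rate K L = 2 * (B0 * tv_const K + 2 / \<alpha> * (tv_const K * L + B1 * exp_moment1)) + B1 * tv_const K"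
definition "tv_rate K L = 5 * tv_const K + 4 / \<alpha> * (2 * tv_const K + exp_moment1)
  + 4 / \<alpha> * (2 * cost_rate K L + K) + 2 / \<alpha> * (exp \<alpha> * exp_moment1 + exp_moment2)"
definition "rate_const K L = cost_rate K L + K + tv_rate K L"

definition close_densities :: "real \<Rightarrow> real \<Rightarrow> ('a \<Rightarrow> 'b \<Rightarrow> real) \<Rightarrow> ('a \<Rightarrow> 'b \<Rightarrow> real) \<Rightarrow> bool" where
  "close_densities C \<epsilon> r s \<longleftrightarrow>
    integrable MM (\<lambda>(x, y). s x y * c x y) \<and> integrable MM (\<lambda>(x, y). s x y * ln (s x y))
    \<and> \<bar>entropic_cost r - entropic_cost s\<bar> \<le> C * \<epsilon>\<^sup>2 \<and> weighted_tv r s \<le> ennreal (C * \<epsilon>)"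

lemma close_densities_mono:
  assumes "close_densities C \<epsilon> r s" "C \<le> C'" "0 \<le> \<epsilon>"
  shows "close_densities C' \<epsilon> r s"
  using assms mult_right_mono[OF assms(2), of "\<epsilon>\<^sup>2"] mult_right_mono[OF assms(2,3)]
  unfolding close_densities_def by (meson ennreal_leI order_trans zero_le_power2)

end

text \<open>The shifts of the stability estimates are \<open>O(t ln (1 / t))\<close>. The total variation is the square root of
  the cost shift, hence the scale \<open>\<epsilon>\<close> with \<open>\<epsilon>\<^sup>2\<close> of the order of the cost shift.\<close>

locale gibbs_rate = matched_gibbs +
  fixes L \<epsilon> :: real
  assumes \<epsilon>_pos: "0 < \<epsilon>" and \<epsilon>_le_1: "\<epsilon> \<le> 1" and t_le: "t \<le> \<epsilon>\<^sup>2"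
    and t_ln_le: "t * ln (1 / t) \<le> 2 * \<epsilon>" and B1_t_ln_le: "B1 * (t * ln (1 / t)) \<le> L * \<epsilon>\<^sup>2"
begin

lemma t_le_\<epsilon>: "t \<le> \<epsilon>"
proof -
  have "\<epsilon>\<^sup>2 \<le> \<epsilon>" using \<epsilon>_pos \<epsilon>_le_1 by (simp add: power2_eq_square mult_left_le)
  with t_le show ?thesis by (rule order_trans)
qed

lemma tv_le: "tv \<le> tv_const K * \<epsilon>\<^sup>2" "tv \<le> tv_const K * \<epsilon>"
  unfolding tv_def using t_le t_le_\<epsilon> tv_const_nonneg[OF K_nonneg] by (simp_all add: mult_left_mono)

lemma moment_shift_le: "moment_shift \<le> 2 / \<alpha> * (2 * tv_const K + exp_moment1) * \<epsilon>"
proof -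
  have "moment_shift \<le> 2 / \<alpha> * (tv_const K * (2 * \<epsilon>) + exp_moment1 * \<epsilon>)"
    unfolding moment_shift_def using \<alpha>_pos
    by (intro mult_left_mono add_mono t_ln_le t_le_\<epsilon> tv_const_nonneg K_nonneg exp_moment_nonneg) auto
  then show ?thesis by (simp add: algebra_simps)
qed

lemma B1_moment_shift_le: "B1 * moment_shift \<le> 2 / \<alpha> * (tv_const K * L + B1 * exp_moment1) * \<epsilon>\<^sup>2"
proof -
  have "B1 * moment_shift = 2 / \<alpha> * (tv_const K * (B1 * (t * ln (1 / t))) + B1 * exp_moment1 * t)"
    by (simp add: moment_shift_def algebra_simps)
  also have "\<dots> \<le> 2 / \<alpha> * (tv_const K * (L * \<epsilon>\<^sup>2) + B1 * exp_moment1 * \<epsilon>\<^sup>2)"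
    using \<alpha>_pos B_nonneg exp_moment_nonneg tv_const_nonneg[OF K_nonneg]
    by (intro mult_left_mono add_mono B1_t_ln_le t_le mult_nonneg_nonneg) auto
  finally show ?thesis by (simp add: algebra_simps)
qed

lemma cost_shift_le: "cost_shift \<le> cost_rate K L * \<epsilon>\<^sup>2"
proof -
  have "cost_shift \<le> 2 * (B0 * (tv_const K * \<epsilon>\<^sup>2) + 2 / \<alpha> * (tv_const K * L + B1 * exp_moment1) * \<epsilon>\<^sup>2)
      + B1 * (tv_const K * \<epsilon>\<^sup>2)"
    unfolding cost_shift_def using B_nonneg by (intro add_mono mult_left_mono tv_le B1_moment_shift_le) auto
  then show ?thesis by (simp add: cost_rate_def algebra_simps)
qed

lemma K_t_le: "K * t\<^sup>2 \<le> K * \<epsilon>\<^sup>2"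
  using t_le_\<epsilon> t_pos K_nonneg by (intro mult_left_mono power_mono) auto

lemma cost_rate_nonneg: "0 \<le> cost_rate K L"
proof -
  have "0 \<le> cost_rate K L * \<epsilon>\<^sup>2" using cost_shift_nonneg cost_shift_le by linarith
  then show ?thesis using \<epsilon>_pos by (simp add: zero_le_mult_iff)
qed

lemma tv_rate_nonneg: "0 \<le> tv_rate K L"
  unfolding tv_rate_def
  using cost_rate_nonneg K_nonneg tv_const_nonneg[OF K_nonneg] exp_moment_nonneg \<alpha>_pos by simp

lemma close_to_optimal:
  assumes r: "optimal_density r"
  shows "close_densities (rate_const K L) \<epsilon> r \<rho>"
proof -
  let ?l = "\<alpha> / 2 * \<epsilon>"
  have l: "0 < ?l" "?l \<le> \<alpha> / 2" using \<alpha>_pos \<epsilon>_pos \<epsilon>_le_1 by auto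
  have "\<bar>entropic_cost r - entropic_cost \<rho>\<bar> \<le> (cost_rate K L + K) * \<epsilon>\<^sup>2"
    using entropic_cost_estimate[OF r] cost_shift_le K_t_le by (simp add: algebra_simps)
  also have "\<dots> \<le> rate_const K L * \<epsilon>\<^sup>2"
    using tv_rate_nonneg by (intro mult_right_mono) (auto simp: rate_const_def)
  finally have cost: "\<bar>entropic_cost r - entropic_cost \<rho>\<bar> \<le> rate_const K L * \<epsilon>\<^sup>2" .
  have "5 * tv + 2 * moment_shift + 2 * ((2 * cost_shift + K * t\<^sup>2) / ?l)
      + ?l * (4 / \<alpha>\<^sup>2) * (exp \<alpha> * exp_moment1 + exp_moment2)
      \<le> 5 * (tv_const K * \<epsilon>) + 2 * (2 / \<alpha> * (2 * tv_const K + exp_moment1) * \<epsilon>)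
        + 2 * ((2 * (cost_rate K L * \<epsilon>\<^sup>2) + K * \<epsilon>\<^sup>2) / ?l)
        + ?l * (4 / \<alpha>\<^sup>2) * (exp \<alpha> * exp_moment1 + exp_moment2)"
    using l by (intro add_mono mult_left_mono divide_right_mono tv_le moment_shift_le cost_shift_le K_t_le order_refl) auto
  also have "\<dots> = tv_rate K L * \<epsilon>"
  proof -
    have "(2 * (cost_rate K L * \<epsilon>\<^sup>2) + K * \<epsilon>\<^sup>2) / ?l = 2 / \<alpha> * (2 * cost_rate K L + K) * \<epsilon>"
      using \<epsilon>_pos \<alpha>_pos by (simp add: field_simps power2_eq_square)
    moreover have "?l * (4 / \<alpha>\<^sup>2) = 2 / \<alpha> * \<epsilon>" using \<alpha>_pos by (simp add: power2_eq_square)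
    ultimately show ?thesis unfolding tv_rate_def by (simp add: algebra_simps)
  qed
  also have "\<dots> \<le> rate_const K L * \<epsilon>"
    using cost_rate_nonneg K_nonneg \<epsilon>_pos by (intro mult_right_mono) (auto simp: rate_const_def)
  finally have "weighted_tv r \<rho> \<le> ennreal (rate_const K L * \<epsilon>)"
    using weighted_tv_estimate[OF r l] by (meson ennreal_leI order_trans)
  with cost show ?thesis
    unfolding close_densities_def using cost_integrable[OF matched f_\<phi>2_integrable] \<rho>_ent_integrable by blast
qed

end

lemma mult_ln_inverse_le_powr:
  fixes t \<sigma> :: real
  assumes "0 < t" "t \<le> 1" "\<sigma> < 1"
  shows "t * ln (1 / t) \<le> t powr \<sigma> / (1 - \<sigma>)"
proof -
  have "ln (1 / t) \<le> (1 / t) powr (1 - \<sigma>) / (1 - \<sigma>)"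
    using assms by (intro ln_powr_bound) auto
  also have "(1 / t) powr (1 - \<sigma>) = t powr (\<sigma> - 1)"
    using assms by (simp add: powr_divide powr_minus_divide[symmetric])
  finally have "t * ln (1 / t) \<le> t * (t powr (\<sigma> - 1) / (1 - \<sigma>))" using assms by (intro mult_left_mono) auto
  also have "\<dots> = t powr \<sigma> / (1 - \<sigma>)" using assms by (simp add: powr_diff)
  finally show ?thesis .
qed

context cost_space
begin

text \<open>If \<open>B1 = 0\<close>, the rate \<open>\<sigma> = 1\<close> is allowed and the constant \<open>B1 / (1 - \<sigma>)\<close> is \<open>0\<close>.\<close>

lemma close_to_optimal_half_step:
  assumes \<sigma>: "0 < \<sigma>" "\<sigma> \<le> 1" "\<sigma> < 1 \<or> B1 = 0" and n: "1 \<le> n" and ab: "potentials a b"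
    and matched: "has_marginals (\<lambda>_. 1) (gibbs_snd a b) (gibbs a b)"
    and ent: "integrable M2 (\<lambda>y. gibbs_snd a b y * ln (gibbs_snd a b y))"
      "(\<integral>y. gibbs_snd a b y * ln (gibbs_snd a b y) \<partial>M2) \<le> K / real n"
    and r: "optimal_density r"
  shows "close_densities (rate_const K (B1 / (1 - \<sigma>))) (real n powr (- \<sigma> / 4)) r (gibbs a b)"
proof -
  define t where "t = real n powr (- 1 / 2)"
  let ?\<epsilon> = "real n powr (- \<sigma> / 4)"
  have t: "0 < t" "t \<le> 1" using n powr_mono[of "- 1 / 2" 0 "real n"] by (simp_all add: t_def)
  have t2: "t\<^sup>2 = 1 / real n" using n by (simp add: t_def power2_eq_square powr_minus_divide flip: powr_add)
  have \<epsilon>: "0 < ?\<epsilon>" "?\<epsilon> \<le> 1" "?\<epsilon>\<^sup>2 = t powr \<sigma>" "?\<epsilon> = t powr (\<sigma> / 2)"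
    using n \<sigma> powr_mono[of "- \<sigma> / 4" 0 "real n"] by (simp_all add: t_def powr_powr power2_eq_square flip: powr_add)
  have "t \<le> t powr \<sigma>" using powr_mono'[of \<sigma> 1 t] t \<sigma> by simp
  moreover have "t * ln (1 / t) \<le> 2 * ?\<epsilon>"
  proof -
    have "t * ln (1 / t) \<le> 2 * t powr (1 / 2)" using mult_ln_inverse_le_powr[OF t, of "1 / 2"] by simp
    also have "t powr (1 / 2) \<le> ?\<epsilon>" unfolding \<epsilon>(4) using t \<sigma> by (intro powr_mono') auto
    finally show ?thesis by simp
  qed
  moreover have "B1 * (t * ln (1 / t)) \<le> B1 / (1 - \<sigma>) * t powr \<sigma>"
  proof (cases "B1 = 0")
    case False
    then show ?thesis
      using mult_left_mono[OF mult_ln_inverse_le_powr[OF t, of \<sigma>] B_nonneg(2)] \<sigma> by simp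
  qed simp
  ultimately interpret gibbs_rate M1 M2 c \<phi>1 \<phi>2 \<alpha> B0 B1 "gibbs_snd a b" K t a b "B1 / (1 - \<sigma>)" ?\<epsilon>
    using ab matched ent t \<epsilon> t2 potentialsD(3,4)[OF ab] gibbs_snd_pos gibbs_snd_integrable[OF ab] gibbs_snd_integral[OF ab]
    by unfold_locales auto
  show ?thesis by (rule close_to_optimal[OF r])
qed

lemma coupling_density_swap:
  assumes s: "coupling_density s"
  shows "cost_space.coupling_density M2 M1 (\<lambda>y x. s x y)"
proof -
  interpret swapped: cost_space M2 M1 "\<lambda>y x. c x y" \<phi>2 \<phi>1 \<alpha> B0 B1 by (rule cost_space_swap)
  show ?thesis
    using s has_marginals_swap[of "\<lambda>_. 1" "\<lambda>_. 1" s] integrable_swap[of "\<lambda>x y. s x y * ln (s x y)"]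
    unfolding coupling_density_def swapped.coupling_density_def by blast
qed

lemma entropic_cost_swap:
  assumes [measurable]: "case_prod s \<in> borel_measurable MM"
  shows "cost_space.entropic_cost M2 M1 (\<lambda>y x. c x y) (\<lambda>y x. s x y) = entropic_cost s"
proof -
  interpret swapped: cost_space M2 M1 "\<lambda>y x. c x y" \<phi>2 \<phi>1 \<alpha> B0 B1 by (rule cost_space_swap)
  have "(\<integral>(y, x). s x y * c x y \<partial>(M2 \<Otimes>\<^sub>M M1)) = (\<integral>(x, y). s x y * c x y \<partial>MM)"
    "(\<integral>(y, x). s x y * ln (s x y) \<partial>(M2 \<Otimes>\<^sub>M M1)) = (\<integral>(x, y). s x y * ln (s x y) \<partial>MM)"
    by (rule integral_swap, measurable)+
  then show ?thesis by (simp only: swapped.entropic_cost_def entropic_cost_def)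
qed

lemma weighted_tv_swap:
  assumes [measurable]: "case_prod r \<in> borel_measurable MM" "case_prod s \<in> borel_measurable MM"
  shows "cost_space.weighted_tv M2 M1 \<phi>2 \<phi>1 (\<lambda>y x. r x y) (\<lambda>y x. s x y) = weighted_tv r s"
proof -
  interpret swapped: cost_space M2 M1 "\<lambda>y x. c x y" \<phi>2 \<phi>1 \<alpha> B0 B1 by (rule cost_space_swap)
  have "(\<integral>\<^sup>+(y, x). ennreal ((1 + (\<phi>1 x + \<phi>2 y)) * \<bar>r x y - s x y\<bar>) \<partial>(M2 \<Otimes>\<^sub>M M1)) = weighted_tv r s"
    unfolding weighted_tv_def by (rule nn_integral_swap) measurable
  then show ?thesis by (simp only: swapped.weighted_tv_def add.commute)
qed

lemma optimal_densityD:
  assumes "optimal_density r"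
  shows "has_marginals (\<lambda>_. 1) (\<lambda>_. 1) r" "case_prod r \<in> borel_measurable MM"
  using assms has_marginalsD(1) unfolding optimal_density_def coupling_density_def by blast+

lemma optimal_density_swap:
  assumes r: "optimal_density r"
  shows "cost_space.optimal_density M2 M1 (\<lambda>y x. c x y) (\<lambda>y x. r x y)"
proof -
  interpret swapped: cost_space M2 M1 "\<lambda>y x. c x y" \<phi>2 \<phi>1 \<alpha> B0 B1 by (rule cost_space_swap)
  have "swapped.entropic_cost (\<lambda>y x. r x y) \<le> swapped.entropic_cost s" if s: "swapped.coupling_density s" for s
  proof -
    have s': "coupling_density (\<lambda>x y. s y x)" by (rule swapped.coupling_density_swap[OF s])
    then have meas: "case_prod (\<lambda>x y. s y x) \<in> borel_measurable MM"
      using has_marginalsD(1) unfolding coupling_density_def by blast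
    have "entropic_cost r \<le> entropic_cost (\<lambda>x y. s y x)" using r s' by (simp add: optimal_density_def)
    then show ?thesis
      using entropic_cost_swap[OF optimal_densityD(2)[OF r]] entropic_cost_swap[OF meas] by simp
  qed
  then show ?thesis
    using r coupling_density_swap unfolding optimal_density_def swapped.optimal_density_def by blast
qed

lemma close_densities_unswap:
  assumes close: "cost_space.close_densities M2 M1 (\<lambda>y x. c x y) \<phi>2 \<phi>1 C \<epsilon> (\<lambda>y x. r x y) (\<lambda>y x. s x y)"
    and meas: "case_prod r \<in> borel_measurable MM" "case_prod s \<in> borel_measurable MM"
  shows "close_densities C \<epsilon> r s"
proof -
  interpret swapped: cost_space M2 M1 "\<lambda>y x. c x y" \<phi>2 \<phi>1 \<alpha> B0 B1 by (rule cost_space_swap)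
  show ?thesis
    using close swapped.integrable_swap[of "\<lambda>y x. s x y * c x y"] swapped.integrable_swap[of "\<lambda>y x. s x y * ln (s x y)"]
    unfolding close_densities_def swapped.close_densities_def
      entropic_cost_swap[OF meas(1)] entropic_cost_swap[OF meas(2)] weighted_tv_swap[OF meas] by blast
qed

lemma iterate_measurable[measurable]: "case_prod (iterate n) \<in> borel_measurable MM"
  by (rule gibbs_measurable[OF potentialsD(3,4)[OF potentials_iterate]])

theorem iterates_converge:
  assumes \<sigma>: "0 < \<sigma>" "\<sigma> \<le> 1" "\<sigma> < 1 \<or> B1 = 0"
  obtains C where "0 \<le> C"
    "\<And>n r. 2 \<le> n \<Longrightarrow> optimal_density r \<Longrightarrow> close_densities C (real n powr (- \<sigma> / 4)) r (iterate n)"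
proof -
  interpret swapped: cost_space M2 M1 "\<lambda>y x. c x y" \<phi>2 \<phi>1 \<alpha> B0 B1 by (rule cost_space_swap)
  let ?K = "4 * (\<integral>(x, y). c x y \<partial>MM)" and ?L = "B1 / (1 - \<sigma>)"
  show thesis
  proof (rule that)
    show "0 \<le> max 0 (max (rate_const ?K ?L) (swapped.rate_const ?K ?L))" by simp
    fix n :: nat and r
    assume n: "2 \<le> n" and r: "optimal_density r"
    note rate = finite_marginal_entropy[OF n] marginal_entropy_rate[OF n]
    have "1 \<le> n" using n by simp
    have "\<exists>C \<in> {rate_const ?K ?L, swapped.rate_const ?K ?L}. close_densities C (real n powr (- \<sigma> / 4)) r (iterate n)"
    proof (cases "even n")
      case False
      then have "close_densities (rate_const ?K ?L) (real n powr (- \<sigma> / 4)) r (iterate n)"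
        using rate has_marginals_iterate_odd
        by (intro close_to_optimal_half_step[OF \<sigma> \<open>1 \<le> n\<close> potentials_iterate] r)
           (simp_all add: finite_marginal_entropy_def marginal_entropy_def)
      then show ?thesis by blast
    next
      case True
      then have "swapped.close_densities (swapped.rate_const ?K ?L) (real n powr (- \<sigma> / 4)) (\<lambda>y x. r x y) (\<lambda>y x. iterate n x y)"
        using rate has_marginals_swap[OF has_marginals_iterate_even[OF True]] n
          swapped.close_to_optimal_half_step[OF \<sigma> \<open>1 \<le> n\<close> potentials_swap[OF potentials_iterate] _ _ _ optimal_density_swap[OF r]]
        by (simp add: finite_marginal_entropy_def marginal_entropy_def gibbs_swap)
      then show ?thesis using close_densities_unswap[OF _ optimal_densityD(2)[OF r] iterate_measurable] by blast
    qed
    then show "close_densities (max 0 (max (rate_const ?K ?L) (swapped.rate_const ?K ?L))) (real n powr (- \<sigma> / 4)) r (iterate n)"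
      using close_densities_mono by fastforce
  qed
qed

end

section \<open>Sinkhorn iterates and optimal couplings as densities\<close>

lemma ext_integral_eq_integral:
  assumes f: "integrable M f"
  shows "ext_integral M f = ereal (\<integral>x. f x \<partial>M)"
proof -
  have pos: "(\<integral>\<^sup>+x. ennreal (max 0 (f x)) \<partial>M) = ennreal (\<integral>x. max 0 (f x) \<partial>M)"
    and neg: "(\<integral>\<^sup>+x. ennreal (max 0 (- f x)) \<partial>M) = ennreal (\<integral>x. max 0 (- f x) \<partial>M)"
    by (rule nn_integral_eq_integral; use f in simp)+
  have "(\<integral>x. max 0 (f x) \<partial>M) - (\<integral>x. max 0 (- f x) \<partial>M) = (\<integral>x. max 0 (f x) - max 0 (- f x) \<partial>M)"
    using f by (intro Bochner_Integration.integral_diff[symmetric]) auto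
  also have "(\<lambda>x. max 0 (f x) - max 0 (- f x)) = f" by (auto simp: fun_eq_iff max_def)
  finally show ?thesis
    unfolding ext_integral_def pos neg
    by (subst (1 2) enn2ereal_ennreal) (auto intro!: integral_nonneg_AE)
qed

lemma ext_integral_cong_AE:
  assumes "AE x in M. f x = g x"
  shows "ext_integral M f = ext_integral M g"
proof -
  have "(\<integral>\<^sup>+x. ennreal (max 0 (f x)) \<partial>M) = (\<integral>\<^sup>+x. ennreal (max 0 (g x)) \<partial>M)"
    "(\<integral>\<^sup>+x. ennreal (max 0 (- f x)) \<partial>M) = (\<integral>\<^sup>+x. ennreal (max 0 (- g x)) \<partial>M)"
    by (rule nn_integral_cong_AE; use assms in eventually_elim; simp)+
  then show ?thesis by (simp add: ext_integral_def)
qed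

lemma ext_integral_density:
  fixes r h :: "'a \<Rightarrow> real"
  assumes [measurable]: "r \<in> borel_measurable M" "h \<in> borel_measurable M" and r: "\<And>x. 0 \<le> r x"
  shows "ext_integral (density M (\<lambda>x. ennreal (r x))) h = ext_integral M (\<lambda>x. r x * h x)"
proof -
  have "ennreal (r x) * ennreal (max 0 (h x)) = ennreal (max 0 (r x * h x))"
    "ennreal (r x) * ennreal (max 0 (- h x)) = ennreal (max 0 (- (r x * h x)))" for x
    using r[of x] by (auto simp: max_def zero_le_mult_iff mult_le_0_iff simp flip: ennreal_mult)
  then show ?thesis unfolding ext_integral_def by (simp add: nn_integral_density)
qed

lemma ext_integral_nonneg: "(\<And>x. 0 \<le> f x) \<Longrightarrow> 0 \<le> ext_integral M f"
  by (simp add: ext_integral_def max_absorb1 zero_ennreal.rep_eq)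

lemma (in prob_space) integrable_of_ext_integral_less_top:
  assumes [measurable]: "f \<in> borel_measurable M" and f: "\<And>x. - 1 \<le> f x" and fin: "ext_integral M f < \<infinity>"
  shows "integrable M f"
proof (rule integrableI_bounded)
  let ?pos = "\<integral>\<^sup>+x. ennreal (max 0 (f x)) \<partial>M" and ?neg = "\<integral>\<^sup>+x. ennreal (max 0 (- f x)) \<partial>M"
  have "?neg \<le> (\<integral>\<^sup>+x. 1 \<partial>M)"
  proof (rule nn_integral_mono)
    fix x show "ennreal (max 0 (- f x)) \<le> 1" using f[of x] by (simp add: ennreal_le_1)
  qed
  then have neg: "?neg \<le> 1" by (simp add: emeasure_space_1)
  then have "enn2ereal ?neg \<noteq> \<infinity>" by (auto simp: less_eq_ennreal.rep_eq one_ennreal.rep_eq)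
  have "?pos \<noteq> top"
  proof
    assume "?pos = top"
    then have "ext_integral M f = \<infinity>"
      using \<open>enn2ereal ?neg \<noteq> \<infinity>\<close> unfolding ext_integral_def by (cases "enn2ereal ?neg") auto
    then show False using fin by simp
  qed
  have "(\<integral>\<^sup>+x. ennreal (norm (f x)) \<partial>M) = (\<integral>\<^sup>+x. ennreal (max 0 (f x)) + ennreal (max 0 (- f x)) \<partial>M)"
    by (intro nn_integral_cong) (simp add: max_def abs_if)
  also have "\<dots> = ?pos + ?neg" by (rule nn_integral_add) measurable
  also have "\<dots> < \<infinity>"
    using \<open>?pos \<noteq> top\<close> le_less_trans[OF neg ennreal_one_less_top] by (simp add: less_top)
  finally show "(\<integral>\<^sup>+x. ennreal (norm (f x)) \<partial>M) < \<infinity>" .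
qed measurable

lemma (in sigma_finite_measure) KL_density:
  fixes r :: "'a \<Rightarrow> real"
  assumes [measurable]: "r \<in> borel_measurable M" and r: "\<And>x. 0 \<le> r x"
  shows "KL (density M (\<lambda>x. ennreal (r x))) M = ext_integral M (\<lambda>x. r x * ln (r x))"
proof -
  let ?P = "density M (\<lambda>x. ennreal (r x))"
  have "AE x in M. ennreal (r x) = RN_deriv M ?P x" by (rule RN_deriv_unique) auto
  then have "AE x in M. ln (enn2real (RN_deriv M ?P x)) = ln (r x)"
    by eventually_elim (metis enn2real_ennreal r)
  then have "AE x in ?P. ln (enn2real (RN_deriv M ?P x)) = ln (r x)"
    by (subst AE_density) auto
  moreover have "absolutely_continuous M ?P" by (rule absolutely_continuousI_density) measurable
  ultimately have "KL ?P M = ext_integral ?P (\<lambda>x. ln (r x))"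
    unfolding KL_def using ext_integral_cong_AE[where M = ?P] by simp
  then show ?thesis by (simp add: ext_integral_density r)
qed

lemma (in prob_space) density_of_finite_KL:
  assumes P: "finite_measure P" "sets P = sets M" and fin: "KL P M < \<infinity>"
  obtains r :: "'a \<Rightarrow> real" where "r \<in> borel_measurable M" "\<And>x. 0 \<le> r x"
    "P = density M (\<lambda>x. ennreal (r x))" "integrable M (\<lambda>x. r x * ln (r x))"
proof -
  have ac: "absolutely_continuous M P" using fin by (auto simp: KL_def split: if_splits)
  obtain r where r: "r \<in> borel_measurable M" "AE x in M. RN_deriv M P x = ennreal (r x)" "\<And>x. 0 \<le> r x"
    using real_RN_deriv[OF P(1) ac P(2)] by metis
  have "P = density M (RN_deriv M P)" using density_RN_deriv[OF ac P(2)] by simp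
  also have "\<dots> = density M (\<lambda>x. ennreal (r x))" using r by (intro density_cong) auto
  finally have P_eq: "P = density M (\<lambda>x. ennreal (r x))" .
  have "ext_integral M (\<lambda>x. r x * ln (r x)) < \<infinity>"
    using fin KL_density[OF r(1,3)] unfolding P_eq by simp
  then have "integrable M (\<lambda>x. r x * ln (r x))"
    using r(1) xlnx_ge_minus_one[OF r(3)] by (intro integrable_of_ext_integral_less_top) auto
  with r P_eq that show thesis by blast
qed

lemma density_RN_deriv_distr:
  fixes g :: "'a \<Rightarrow> real"
  assumes "prob_space P" and X[measurable]: "X \<in> measurable P M" and [measurable]: "g \<in> borel_measurable M"
    and g: "\<And>x. 0 < g x" and distr: "distr P M X = density M (\<lambda>x. ennreal (g x))"
  shows "density P (\<lambda>z. RN_deriv (distr P M X) M (X z)) = density P (\<lambda>z. ennreal (1 / g (X z)))"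
proof -
  let ?N = "density M (\<lambda>x. ennreal (g x))"
  interpret P: prob_space P by fact
  interpret N: prob_space ?N using P.prob_space_distr[OF X] unfolding distr .
  have "density ?N (\<lambda>x. ennreal (1 / g x)) = density M (\<lambda>x. ennreal (g x) * ennreal (1 / g x))"
    by (rule density_density_eq) measurable
  also have "\<dots> = density M (\<lambda>x. 1)"
    by (rule density_cong) (use g in \<open>auto simp: less_imp_le less_imp_neq[symmetric] simp flip: ennreal_mult\<close>)
  finally have "density ?N (\<lambda>x. ennreal (1 / g x)) = M" by (simp add: density_1)
  then have "AE x in ?N. ennreal (1 / g x) = RN_deriv ?N M x" by (intro N.RN_deriv_unique) auto
  then have "AE z in P. ennreal (1 / g (X z)) = RN_deriv ?N M (X z)"
    using AE_distrD[OF X] unfolding distr[symmetric] by blast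
  moreover have "RN_deriv ?N M \<in> borel_measurable M"
    using borel_measurable_RN_deriv[of ?N M] by simp
  ultimately show ?thesis unfolding distr by (intro density_cong) auto
qed

context pair_sigma_finite
begin

lemma
  assumes w: "w \<in> borel_measurable MM" and P: "prob_space (density MM w)"
  shows distr_density_fst: "distr (density MM w) M1 fst = density M1 (\<lambda>x. \<integral>\<^sup>+y. w (x, y) \<partial>M2)"
    and distr_density_snd: "distr (density MM w) M2 snd = density M2 (\<lambda>y. \<integral>\<^sup>+x. w (x, y) \<partial>M1)"
proof -
  interpret P: prob_space "density MM w" by (rule P)
  have "distributed (density MM w) MM (\<lambda>z. (fst z, snd z)) w"
    unfolding distributed_def using w by (simp add: distr_id2)
  then show "distr (density MM w) M1 fst = density M1 (\<lambda>x. \<integral>\<^sup>+y. w (x, y) \<partial>M2)"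
    "distr (density MM w) M2 snd = density M2 (\<lambda>y. \<integral>\<^sup>+x. w (x, y) \<partial>M1)"
    using P.distr_marginal1 P.distr_marginal2 M1.sigma_finite_measure_axioms M2.sigma_finite_measure_axioms
    unfolding distributed_def by blast+
qed

lemma
  assumes s: "has_marginals g f s" and P: "prob_space (density MM (\<lambda>(x, y). ennreal (s x y)))"
    and meas: "g \<in> borel_measurable M1" "f \<in> borel_measurable M2"
  shows distr_has_marginals_fst: "distr (density MM (\<lambda>(x, y). ennreal (s x y))) M1 fst = density M1 g"
    and distr_has_marginals_snd: "distr (density MM (\<lambda>(x, y). ennreal (s x y))) M2 snd = density M2 f"
proof -
  note [measurable] = has_marginalsD(1)[OF s]
  have w: "(\<lambda>(x, y). ennreal (s x y)) \<in> borel_measurable MM" by measurable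
  show "distr (density MM (\<lambda>(x, y). ennreal (s x y))) M1 fst = density M1 g"
    unfolding distr_density_fst[OF w P] prod.case using has_marginalsD(5)[OF s] meas by (intro density_cong) auto
  show "distr (density MM (\<lambda>(x, y). ennreal (s x y))) M2 snd = density M2 f"
    unfolding distr_density_snd[OF w P] prod.case using has_marginalsD(6)[OF s] meas by (intro density_cong) auto
qed

end

locale borel_cost_space = cost_space M1 M2 c \<phi>1 \<phi>2 \<alpha> B0 B1
  for M1 :: "'a::polish_space measure" and M2 :: "'b::polish_space measure" and c \<phi>1 \<phi>2 \<alpha> B0 B1 +
  assumes sets_M1: "sets M1 = sets borel" and sets_M2: "sets M2 = sets borel"
begin

abbreviation "dens s \<equiv> density MM (\<lambda>(x, y). ennreal (s x y))"

lemma sets_MM: "sets MM = sets (borel :: ('a \<times> 'b) measure)"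
  by (metis borel_prod sets_pair_measure_cong sets_M1 sets_M2)

lemma distr_borel: "distr P borel fst = distr P M1 fst" "distr P borel snd = distr P M2 snd"
  by (auto intro!: distr_cong simp: sets_M1 sets_M2)

lemma prob_space_dens:
  assumes [measurable]: "case_prod s \<in> borel_measurable MM" and mass: "(\<integral>\<^sup>+(x, y). ennreal (s x y) \<partial>MM) = 1"
  shows "prob_space (dens s)"
  using mass by (intro prob_spaceI) (simp add: emeasure_density cong: nn_integral_cong)

lemma density_dens:
  assumes [measurable]: "case_prod s \<in> borel_measurable MM" "w \<in> borel_measurable MM" and nonneg: "\<And>x y. 0 \<le> s x y"
  shows "density (dens s) (\<lambda>z. ennreal (w z)) = dens (\<lambda>x y. s x y * w (x, y))"
proof -
  have "density (dens s) (\<lambda>z. ennreal (w z)) = density MM (\<lambda>z. (case z of (x, y) \<Rightarrow> ennreal (s x y)) * ennreal (w z))"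
    by (rule density_density_eq) measurable
  also have "\<dots> = dens (\<lambda>x y. s x y * w (x, y))"
    by (intro arg_cong[where f = "density MM"]) (auto simp: nonneg ennreal_mult')
  finally show ?thesis .
qed

lemma dens_normalize_snd:
  assumes ab: "potentials a b"
  shows "density (dens (gibbs a b)) (\<lambda>z. RN_deriv (distr (dens (gibbs a b)) borel snd) M2 (snd z))
    = dens (gibbs a (normalize_snd a b))"
proof -
  note [measurable] = potentialsD(3,4)[OF ab]
  have P: "prob_space (dens (gibbs a b))" by (rule prob_space_dens[OF _ potentialsD(5)[OF ab]]) measurable
  have "density (dens (gibbs a b)) (\<lambda>z. RN_deriv (distr (dens (gibbs a b)) borel snd) M2 (snd z))
      = density (dens (gibbs a b)) (\<lambda>z. ennreal (1 / gibbs_snd a b (snd z)))"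
    unfolding distr_borel
    by (rule density_RN_deriv_distr[OF P _ _ gibbs_snd_pos distr_has_marginals_snd[OF has_marginals_gibbs[OF ab] P]])
       measurable
  also have "\<dots> = dens (\<lambda>x y. gibbs a b x y * (1 / gibbs_snd a b y))"
    by (subst density_dens) (simp_all add: gibbs_pos less_imp_le)
  finally show ?thesis by (simp add: gibbs_normalize_snd)
qed

lemma dens_normalize_fst:
  assumes ab: "potentials a b"
  shows "density (dens (gibbs a b)) (\<lambda>z. RN_deriv (distr (dens (gibbs a b)) borel fst) M1 (fst z))
    = dens (gibbs (normalize_fst a b) b)"
proof -
  note [measurable] = potentialsD(3,4)[OF ab]
  have P: "prob_space (dens (gibbs a b))" by (rule prob_space_dens[OF _ potentialsD(5)[OF ab]]) measurable
  have "density (dens (gibbs a b)) (\<lambda>z. RN_deriv (distr (dens (gibbs a b)) borel fst) M1 (fst z))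
      = density (dens (gibbs a b)) (\<lambda>z. ennreal (1 / gibbs_fst a b (fst z)))"
    unfolding distr_borel
    by (rule density_RN_deriv_distr[OF P _ _ gibbs_fst_pos distr_has_marginals_fst[OF has_marginals_gibbs[OF ab] P]])
       measurable
  also have "\<dots> = dens (\<lambda>x y. gibbs a b x y * (1 / gibbs_fst a b x))"
    by (subst density_dens) (simp_all add: gibbs_pos less_imp_le)
  finally show ?thesis by (simp add: gibbs_normalize_fst)
qed

lemma sinkhorn_eq: "sinkhorn (case_prod c) M1 M2 n = dens (iterate n)"
proof (induction n)
  case 0
  let ?Z = "\<integral>(x, y). exp (- c x y) \<partial>MM"
  have Z: "(\<integral>\<^sup>+z. ennreal (exp (- case_prod c z)) \<partial>MM) = ennreal ?Z"
    using nn_integral_eq_integral[OF exp_c_integrable] by (simp add: case_prod_beta')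
  have "ennreal (exp (- case_prod c z)) / ennreal ?Z = (case z of (x, y) \<Rightarrow> ennreal (iterate 0 x y))" for z
    using partition_function_pos by (cases z) (simp add: iterate_0 divide_ennreal)
  then show ?case by (simp only: sinkhorn.simps Z)
next
  case (Suc n)
  show ?case
    unfolding sinkhorn.simps Suc
    using dens_normalize_fst[OF potentials_iterate, of n] dens_normalize_snd[OF potentials_iterate, of n]
    by (simp add: potential_Suc)
qed

lemma dens_in_couplings_iff:
  assumes [measurable]: "case_prod s \<in> borel_measurable MM" and nonneg: "\<And>x y. 0 \<le> s x y"
  shows "dens s \<in> couplings M1 M2 \<longleftrightarrow> has_marginals (\<lambda>_. 1) (\<lambda>_. 1) s"
proof
  assume s: "has_marginals (\<lambda>_. 1) (\<lambda>_. 1) s"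
  have P: "prob_space (dens s)" by (rule prob_space_dens[OF assms(1) nn_integral_has_marginals[OF s]])
  have "distr (dens s) M1 fst = density M1 (\<lambda>_. ennreal 1)" by (rule distr_has_marginals_fst[OF s P]) simp_all
  moreover have "distr (dens s) M2 snd = density M2 (\<lambda>_. ennreal 1)" by (rule distr_has_marginals_snd[OF s P]) simp_all
  ultimately show "dens s \<in> couplings M1 M2"
    using P by (simp add: couplings_def sets_MM distr_borel density_1)
next
  assume "dens s \<in> couplings M1 M2"
  then have P: "prob_space (dens s)" and marg: "distr (dens s) M1 fst = M1" "distr (dens s) M2 snd = M2"
    by (simp_all add: couplings_def distr_borel)
  have w: "(\<lambda>(x, y). ennreal (s x y)) \<in> borel_measurable MM" by measurable
  have "density M1 (\<lambda>x. \<integral>\<^sup>+y. ennreal (s x y) \<partial>M2) = density M1 (\<lambda>_. 1)"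
    "density M2 (\<lambda>y. \<integral>\<^sup>+x. ennreal (s x y) \<partial>M1) = density M2 (\<lambda>_. 1)"
    using distr_density_fst[OF w P] distr_density_snd[OF w P] by (simp_all add: marg density_1)
  then have "AE x in M1. (\<integral>\<^sup>+y. ennreal (s x y) \<partial>M2) = 1" "AE y in M2. (\<integral>\<^sup>+x. ennreal (s x y) \<partial>M1) = 1"
    by (simp_all add: M1.density_unique_iff M2.density_unique_iff)
  then show "has_marginals (\<lambda>_. 1) (\<lambda>_. 1) s" by (simp add: has_marginals_def nonneg)
qed

lemma Fent_dens:
  assumes s[measurable]: "case_prod s \<in> borel_measurable MM" and nonneg: "\<And>x y. 0 \<le> s x y"
    and int: "integrable MM (\<lambda>(x, y). s x y * c x y)" "integrable MM (\<lambda>(x, y). s x y * ln (s x y))"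
  shows "Fent (case_prod c) M1 M2 (dens s) = ereal (entropic_cost s)"
proof -
  have dens: "dens s = density MM (\<lambda>z. ennreal (case_prod s z))" by (simp add: case_prod_beta')
  have "ext_integral (dens s) (case_prod c) = ereal (\<integral>(x, y). s x y * c x y \<partial>MM)"
    unfolding dens using ext_integral_eq_integral[OF int(1)] nonneg
    by (subst ext_integral_density) (auto simp: case_prod_beta')
  moreover have "KL (dens s) MM = ereal (\<integral>(x, y). s x y * ln (s x y) \<partial>MM)"
    unfolding dens using ext_integral_eq_integral[OF int(2)] nonneg
    by (subst KL_density) (auto simp: case_prod_beta')
  ultimately show ?thesis by (simp add: Fent_def entropic_cost_def)
qed

lemma
  assumes s: "coupling_density s"
  shows coupling_density_in_couplings: "dens s \<in> couplings M1 M2"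
    and Fent_coupling_density: "Fent (case_prod c) M1 M2 (dens s) = ereal (entropic_cost s)"
    and S_ent_le: "S_ent (case_prod c) M1 M2 \<le> ereal (entropic_cost s)"
proof -
  have marg: "has_marginals (\<lambda>_. 1) (\<lambda>_. 1) s" and ent: "integrable MM (\<lambda>(x, y). s x y * ln (s x y))"
    using s by (simp_all add: coupling_density_def)
  show "dens s \<in> couplings M1 M2" using dens_in_couplings_iff[OF has_marginalsD(1,2)[OF marg]] marg by simp
  moreover show "Fent (case_prod c) M1 M2 (dens s) = ereal (entropic_cost s)"
    by (rule Fent_dens[OF has_marginalsD(1,2)[OF marg] coupling_cost_integrable[OF s] ent])
  ultimately show "S_ent (case_prod c) M1 M2 \<le> ereal (entropic_cost s)"
    unfolding S_ent_def using INF_lower by metis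
qed

lemma coupling_density_one: "coupling_density (\<lambda>_ _. 1)"
  unfolding coupling_density_def by (intro conjI has_marginals_one) (simp add: split_def)

lemma optimal_coupling_density:
  assumes \<pi>: "\<pi> \<in> couplings M1 M2" and opt: "Fent (case_prod c) M1 M2 \<pi> = S_ent (case_prod c) M1 M2"
  obtains r where "\<pi> = dens r" "optimal_density r"
proof -
  interpret \<pi>: prob_space \<pi> using \<pi> by (simp add: couplings_def)
  have sets_\<pi>: "sets \<pi> = sets MM" using \<pi> by (simp add: couplings_def sets_MM)
  have "Fent (case_prod c) M1 M2 \<pi> < \<infinity>"
    using S_ent_le[OF coupling_density_one] opt by (auto simp: le_less_trans)
  moreover have "0 \<le> ext_integral \<pi> (case_prod c)"
    using c_nonneg by (intro ext_integral_nonneg) (simp add: case_prod_beta')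
  ultimately have "KL \<pi> MM < \<infinity>" by (auto simp: Fent_def)
  then obtain r where r[measurable]: "r \<in> borel_measurable MM" and nonneg: "\<And>z. 0 \<le> r z"
    and \<pi>_eq: "\<pi> = density MM (\<lambda>z. ennreal (r z))" and ent: "integrable MM (\<lambda>z. r z * ln (r z))"
    using density_of_finite_KL[OF \<pi>.finite_measure_axioms sets_\<pi>] by blast
  let ?r = "curry r"
  have \<pi>_dens: "\<pi> = dens ?r" unfolding \<pi>_eq by (simp add: case_prod_beta')
  have coupling: "coupling_density ?r"
    unfolding coupling_density_def using \<pi> ent dens_in_couplings_iff[of ?r] nonneg unfolding \<pi>_dens
    by (simp add: case_prod_beta')
  have "entropic_cost ?r \<le> entropic_cost s" if s: "coupling_density s" for s
  proof -
    have "ereal (entropic_cost ?r) = S_ent (case_prod c) M1 M2"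
      using Fent_coupling_density[OF coupling] opt unfolding \<pi>_dens by simp
    also note S_ent_le[OF s]
    finally show ?thesis by simp
  qed
  then have "optimal_density ?r" unfolding optimal_density_def using coupling by blast
  with \<pi>_dens show thesis by (rule that)
qed

end

section \<open>Total variation and Wasserstein distance\<close>

lemma mixture_of_images:
  fixes w1 w2 :: "'a \<Rightarrow> ennreal"
  assumes [measurable]: "T1 \<in> measurable M N" "T2 \<in> measurable M N"
    and [measurable]: "w1 \<in> borel_measurable M" "w2 \<in> borel_measurable M"
  obtains \<gamma> where "sets \<gamma> = sets N"
    "\<And>h. h \<in> borel_measurable N \<Longrightarrow>
      (\<integral>\<^sup>+z. h z \<partial>\<gamma>) = (\<integral>\<^sup>+x. w1 x * h (T1 x) \<partial>M) + (\<integral>\<^sup>+x. w2 x * h (T2 x) \<partial>M)"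
proof -
  let ?S = "M \<Otimes>\<^sub>M count_space (UNIV :: bool set)"
  define w where "w u = (if snd u then w1 (fst u) else w2 (fst u))" for u :: "'a \<times> bool"
  define T where "T u = (if snd u then T1 (fst u) else T2 (fst u))" for u :: "'a \<times> bool"
  have [measurable]: "w \<in> borel_measurable ?S" "T \<in> measurable ?S N"
    unfolding w_def[abs_def] T_def[abs_def] by measurable
  interpret bool: sigma_finite_measure "count_space (UNIV :: bool set)"
    by (rule sigma_finite_measure_count_space_finite) simp
  show thesis
  proof (rule that)
    show "sets (distr (density ?S w) N T) = sets N" by simp
    fix h :: "'b \<Rightarrow> ennreal" assume [measurable]: "h \<in> borel_measurable N"
    have "(\<integral>\<^sup>+z. h z \<partial>distr (density ?S w) N T) = (\<integral>\<^sup>+u. w u * h (T u) \<partial>?S)"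
      by (simp add: nn_integral_distr nn_integral_density)
    also have "\<dots> = (\<integral>\<^sup>+x. \<integral>\<^sup>+b. w (x, b) * h (T (x, b)) \<partial>count_space UNIV \<partial>M)"
      by (rule bool.nn_integral_fst[symmetric]) measurable
    also have "\<dots> = (\<integral>\<^sup>+x. w1 x * h (T1 x) + w2 x * h (T2 x) \<partial>M)"
      by (intro nn_integral_cong, subst nn_integral_count_space_finite)
         (simp_all add: UNIV_bool w_def T_def add.commute)
    also have "\<dots> = (\<integral>\<^sup>+x. w1 x * h (T1 x) \<partial>M) + (\<integral>\<^sup>+x. w2 x * h (T2 x) \<partial>M)"
      by (rule nn_integral_add) measurable
    finally show "(\<integral>\<^sup>+z. h z \<partial>distr (density ?S w) N T)
      = (\<integral>\<^sup>+x. w1 x * h (T1 x) \<partial>M) + (\<integral>\<^sup>+x. w2 x * h (T2 x) \<partial>M)" .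
  qed
qed

lemma nn_integral_rescaled_product:
  fixes D E :: "'a \<Rightarrow> real" and g :: "'a \<Rightarrow> ennreal"
  assumes [measurable]: "D \<in> borel_measurable M" "E \<in> borel_measurable M" "g \<in> borel_measurable M"
    and nonneg: "\<And>x. 0 \<le> D x" "\<And>x. 0 \<le> E x" "0 \<le> m"
    and D: "(\<integral>\<^sup>+x. ennreal (D x) \<partial>M) = ennreal m" and E: "(\<integral>\<^sup>+x. ennreal (E x) \<partial>M) = ennreal m"
  shows "(\<integral>\<^sup>+x. \<integral>\<^sup>+y. ennreal (D x * E y / m) * g x \<partial>M \<partial>M) = (\<integral>\<^sup>+x. ennreal (D x) * g x \<partial>M)"
proof (cases "m = 0")
  case True
  then have "(\<integral>\<^sup>+x. ennreal (D x) \<partial>M) = 0" using D by simp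
  then have "AE x in M. ennreal (D x) = 0" by (rule nn_integral_0_iff_AE[THEN iffD1, rotated]) measurable
  then have "(\<integral>\<^sup>+x. ennreal (D x) * g x \<partial>M) = (\<integral>\<^sup>+x. 0 \<partial>M)"
    by (intro nn_integral_cong_AE) (auto elim!: eventually_mono)
  then show ?thesis using True by simp
next
  case False
  have "(\<integral>\<^sup>+y. ennreal (D x * E y / m) * g x \<partial>M) = ennreal (D x) * g x" for x
  proof -
    have "(\<integral>\<^sup>+y. ennreal (D x * E y / m) * g x \<partial>M) = (\<integral>\<^sup>+y. ennreal (D x / m) * g x * ennreal (E y) \<partial>M)"
      using nonneg by (intro nn_integral_cong) (simp add: ennreal_mult[symmetric] mult_ac)
    also have "\<dots> = ennreal (D x / m) * g x * ennreal m" by (simp add: nn_integral_cmult E)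
    also have "\<dots> = ennreal (D x / m) * ennreal m * g x" by (simp add: mult_ac)
    also have "ennreal (D x / m) * ennreal m = ennreal (D x)" using False nonneg by (simp flip: ennreal_mult)
    finally show ?thesis .
  qed
  then show ?thesis by simp
qed

lemma nn_integral_add_densities:
  fixes u v :: "'a \<Rightarrow> real" and g :: "'a \<Rightarrow> ennreal"
  assumes [measurable]: "u \<in> borel_measurable M" "v \<in> borel_measurable M" "g \<in> borel_measurable M"
    and nonneg: "\<And>x. 0 \<le> u x" "\<And>x. 0 \<le> v x"
  shows "(\<integral>\<^sup>+x. ennreal (u x) * g x \<partial>M) + (\<integral>\<^sup>+x. ennreal (v x) * g x \<partial>M) = (\<integral>\<^sup>+x. ennreal (u x + v x) * g x \<partial>M)"
  by (subst nn_integral_add[symmetric]) (auto simp: nonneg ennreal_plus distrib_right)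

lemma distr_eqI_nn_integral:
  assumes f: "f \<in> measurable M N" and sets: "sets P = sets N"
    and eq: "\<And>A. A \<in> sets N \<Longrightarrow> (\<integral>\<^sup>+z. indicator A (f z) \<partial>M) = emeasure P A"
  shows "distr M N f = P"
proof (rule measure_eqI)
  fix A assume "A \<in> sets (distr M N f)"
  then have A: "A \<in> sets N" by simp
  have "emeasure (distr M N f) A = (\<integral>\<^sup>+z. indicator A z \<partial>distr M N f)" using A by simp
  also have "\<dots> = (\<integral>\<^sup>+z. indicator A (f z) \<partial>M)" using A by (intro nn_integral_distr f) simp
  finally show "emeasure (distr M N f) A = emeasure P A" using eq[OF A] by simp
qed (simp add: sets)

lemma measurable_fst_borel: "fst \<in> measurable borel (borel :: 'a::second_countable_topology measure)"
  and measurable_snd_borel: "snd \<in> measurable borel (borel :: 'b::second_countable_topology measure)"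
  by (simp_all add: borel_measurable_continuous_onI continuous_on_fst continuous_on_snd continuous_on_id)

locale density_pair = prob_space M for M :: "'z::second_countable_topology measure" +
  fixes p q :: "'z \<Rightarrow> real"
  assumes sets_M: "sets M = sets borel"
    and p_measurable[measurable]: "p \<in> borel_measurable M" and q_measurable[measurable]: "q \<in> borel_measurable M"
    and p_nonneg: "0 \<le> p z" and q_nonneg: "0 \<le> q z"
    and p_mass: "(\<integral>\<^sup>+z. ennreal (p z) \<partial>M) = 1" and q_mass: "(\<integral>\<^sup>+z. ennreal (q z) \<partial>M) = 1"
begin

definition "common z = min (p z) (q z)"
definition "excess z = max 0 (p z - q z)"
definition "deficit z = max 0 (q z - p z)"
definition "excess_mass = enn2real (\<integral>\<^sup>+z. ennreal (excess z) \<partial>M)"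

lemma parts_measurable[measurable]:
  "common \<in> borel_measurable M" "excess \<in> borel_measurable M" "deficit \<in> borel_measurable M"
  unfolding common_def[abs_def] excess_def[abs_def] deficit_def[abs_def] by measurable

lemma parts_nonneg: "0 \<le> common z" "0 \<le> excess z" "0 \<le> deficit z" "0 \<le> excess_mass"
  using p_nonneg q_nonneg by (auto simp: common_def excess_def deficit_def excess_mass_def)

lemma parts_sum: "common z + excess z = p z" "common z + deficit z = q z" "excess z + deficit z = \<bar>p z - q z\<bar>"
  by (auto simp: common_def excess_def deficit_def)

lemma nn_integral_excess: "(\<integral>\<^sup>+z. ennreal (excess z) \<partial>M) = ennreal excess_mass"
  and nn_integral_deficit: "(\<integral>\<^sup>+z. ennreal (deficit z) \<partial>M) = ennreal excess_mass"
proof -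
  have sum_p: "(\<integral>\<^sup>+z. ennreal (common z) \<partial>M) + (\<integral>\<^sup>+z. ennreal (excess z) \<partial>M) = 1"
    using nn_integral_add_densities[of common M excess "\<lambda>_. 1"] p_mass by (simp add: parts_nonneg parts_sum)
  have sum_q: "(\<integral>\<^sup>+z. ennreal (common z) \<partial>M) + (\<integral>\<^sup>+z. ennreal (deficit z) \<partial>M) = 1"
    using nn_integral_add_densities[of common M deficit "\<lambda>_. 1"] q_mass by (simp add: parts_nonneg parts_sum)
  have "(\<integral>\<^sup>+z. ennreal (excess z) \<partial>M) \<le> 1" unfolding sum_p[symmetric] by simp
  then show excess: "(\<integral>\<^sup>+z. ennreal (excess z) \<partial>M) = ennreal excess_mass"
    unfolding excess_mass_def using le_less_trans[OF _ ennreal_one_less_top] by simp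
  have "(\<integral>\<^sup>+z. ennreal (common z) \<partial>M) \<noteq> \<infinity>" using sum_p by auto
  moreover have "(\<integral>\<^sup>+z. ennreal (common z) \<partial>M) + (\<integral>\<^sup>+z. ennreal (deficit z) \<partial>M)
      = (\<integral>\<^sup>+z. ennreal (common z) \<partial>M) + ennreal excess_mass"
    using sum_p sum_q excess by simp
  ultimately show "(\<integral>\<^sup>+z. ennreal (deficit z) \<partial>M) = ennreal excess_mass"
    by (simp only: ennreal_add_left_cancel simp_thms)
qed

abbreviation "move x y \<equiv> ennreal (excess x * deficit y / excess_mass)"

lemma nn_integral_move_fst:
  assumes "g \<in> borel_measurable M"
  shows "(\<integral>\<^sup>+x. \<integral>\<^sup>+y. move x y * g x \<partial>M \<partial>M) = (\<integral>\<^sup>+x. ennreal (excess x) * g x \<partial>M)"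
  using assms by (intro nn_integral_rescaled_product parts_nonneg nn_integral_excess nn_integral_deficit) measurable

lemma nn_integral_move_snd:
  assumes [measurable]: "g \<in> borel_measurable M"
  shows "(\<integral>\<^sup>+x. \<integral>\<^sup>+y. move x y * g y \<partial>M \<partial>M) = (\<integral>\<^sup>+y. ennreal (deficit y) * g y \<partial>M)"
proof -
  interpret square: pair_prob_space M M ..
  have "(\<integral>\<^sup>+x. \<integral>\<^sup>+y. move x y * g y \<partial>M \<partial>M) = (\<integral>\<^sup>+y. \<integral>\<^sup>+x. ennreal (deficit y * excess x / excess_mass) * g y \<partial>M \<partial>M)"
    by (subst square.Fubini'[symmetric]) (measurable, simp add: mult.commute)
  also have "\<dots> = (\<integral>\<^sup>+y. ennreal (deficit y) * g y \<partial>M)"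
    by (intro nn_integral_rescaled_product parts_nonneg nn_integral_excess nn_integral_deficit assms) measurable
  finally show ?thesis .
qed

lemma diagonal_plus_product:
  obtains \<gamma> where "sets \<gamma> = sets (borel :: ('z \<times> 'z) measure)"
    "\<And>h. h \<in> borel_measurable borel \<Longrightarrow> (\<integral>\<^sup>+z. h z \<partial>\<gamma>)
      = (\<integral>\<^sup>+x. ennreal (common x) * h (x, x) \<partial>M) + (\<integral>\<^sup>+x. \<integral>\<^sup>+y. move x y * h (x, y) \<partial>M \<partial>M)"
proof -
  have sets_square: "sets (M \<Otimes>\<^sub>M M) = sets (borel :: ('z \<times> 'z) measure)"
    by (metis borel_prod sets_pair_measure_cong sets_M)
  obtain \<gamma> where \<gamma>: "sets \<gamma> = sets (M \<Otimes>\<^sub>M M)"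
    "\<And>h. h \<in> borel_measurable (M \<Otimes>\<^sub>M M) \<Longrightarrow> (\<integral>\<^sup>+z. h z \<partial>\<gamma>)
      = (\<integral>\<^sup>+z. ennreal (common (fst z)) * h (fst z, fst z) \<partial>(M \<Otimes>\<^sub>M M))
        + (\<integral>\<^sup>+z. move (fst z) (snd z) * h z \<partial>(M \<Otimes>\<^sub>M M))"
    by (rule mixture_of_images[of "\<lambda>z. (fst z, fst z)" "M \<Otimes>\<^sub>M M" "M \<Otimes>\<^sub>M M" "\<lambda>z. z"
          "\<lambda>z. ennreal (common (fst z))" "\<lambda>z. move (fst z) (snd z)"]) measurable
  show thesis
  proof (rule that)
    show "sets \<gamma> = sets borel" using \<gamma>(1) sets_square by simp
    fix h :: "'z \<times> 'z \<Rightarrow> ennreal" assume "h \<in> borel_measurable borel"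
    then have h[measurable]: "h \<in> borel_measurable (M \<Otimes>\<^sub>M M)" by (simp add: measurable_cong_sets[OF sets_square refl])
    have "(\<integral>\<^sup>+z. ennreal (common (fst z)) * h (fst z, fst z) \<partial>(M \<Otimes>\<^sub>M M)) = (\<integral>\<^sup>+x. ennreal (common x) * h (x, x) \<partial>M)"
      by (subst nn_integral_fst[symmetric]) (simp_all add: emeasure_space_1)
    moreover have "(\<integral>\<^sup>+z. move (fst z) (snd z) * h z \<partial>(M \<Otimes>\<^sub>M M)) = (\<integral>\<^sup>+x. \<integral>\<^sup>+y. move x y * h (x, y) \<partial>M \<partial>M)"
      by (subst nn_integral_fst[symmetric]) simp_all
    ultimately show "(\<integral>\<^sup>+z. h z \<partial>\<gamma>)
        = (\<integral>\<^sup>+x. ennreal (common x) * h (x, x) \<partial>M) + (\<integral>\<^sup>+x. \<integral>\<^sup>+y. move x y * h (x, y) \<partial>M \<partial>M)"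
      using \<gamma>(2)[OF h] by simp
  qed
qed

lemma diagonal_plus_product_in_couplings:
  assumes sets: "sets \<gamma> = sets (borel :: ('z \<times> 'z) measure)"
    and \<gamma>: "\<And>h. h \<in> borel_measurable borel \<Longrightarrow> (\<integral>\<^sup>+z. h z \<partial>\<gamma>)
      = (\<integral>\<^sup>+x. ennreal (common x) * h (x, x) \<partial>M) + (\<integral>\<^sup>+x. \<integral>\<^sup>+y. move x y * h (x, y) \<partial>M \<partial>M)"
  shows "\<gamma> \<in> couplings (density M p) (density M q)"
proof -
  have meas: "fst \<in> measurable \<gamma> borel" "snd \<in> measurable \<gamma> borel"
    by (simp_all add: measurable_cong_sets[OF sets refl] measurable_fst_borel measurable_snd_borel)
  have fst: "distr \<gamma> borel fst = density M p"
  proof (rule distr_eqI_nn_integral[OF meas(1)])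
    fix A :: "'z set" assume A: "A \<in> sets borel"
    then have [measurable]: "A \<in> sets M" by (simp add: sets_M)
    have "(\<integral>\<^sup>+z. indicator A (fst z) \<partial>\<gamma>)
        = (\<integral>\<^sup>+x. ennreal (common x) * indicator A x \<partial>M) + (\<integral>\<^sup>+x. ennreal (excess x) * indicator A x \<partial>M)"
      by (subst \<gamma>[OF measurable_compose[OF measurable_fst_borel borel_measurable_indicator[OF A]]])
         (simp add: nn_integral_move_fst)
    also have "\<dots> = emeasure (density M p) A"
      by (subst nn_integral_add_densities) (simp_all add: parts_nonneg parts_sum emeasure_density)
    finally show "(\<integral>\<^sup>+z. indicator A (fst z) \<partial>\<gamma>) = emeasure (density M p) A" .
  qed (simp add: sets_M)
  have snd: "distr \<gamma> borel snd = density M q"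
  proof (rule distr_eqI_nn_integral[OF meas(2)])
    fix A :: "'z set" assume A: "A \<in> sets borel"
    then have [measurable]: "A \<in> sets M" by (simp add: sets_M)
    have "(\<integral>\<^sup>+z. indicator A (snd z) \<partial>\<gamma>)
        = (\<integral>\<^sup>+x. ennreal (common x) * indicator A x \<partial>M) + (\<integral>\<^sup>+x. ennreal (deficit x) * indicator A x \<partial>M)"
      by (subst \<gamma>[OF measurable_compose[OF measurable_snd_borel borel_measurable_indicator[OF A]]])
         (simp add: nn_integral_move_snd)
    also have "\<dots> = emeasure (density M q) A"
      by (subst nn_integral_add_densities) (simp_all add: parts_nonneg parts_sum emeasure_density)
    finally show "(\<integral>\<^sup>+z. indicator A (snd z) \<partial>\<gamma>) = emeasure (density M q) A" .
  qed (simp add: sets_M)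
  have "prob_space \<gamma>"
  proof (rule prob_space_distrD[OF meas(1)])
    show "prob_space (distr \<gamma> borel fst)"
      unfolding fst by (rule prob_spaceI) (simp add: emeasure_density p_mass)
  qed
  with fst snd sets show ?thesis by (simp add: couplings_def)
qed

lemma total_variation_coupling:
  assumes d: "d \<in> borel_measurable borel" and G[measurable]: "G \<in> borel_measurable M"
    and diag: "\<And>z. d (z, z) = 0" and le: "\<And>z w. d (z, w) \<le> G z + (G w :: ennreal)"
  obtains \<gamma> where "\<gamma> \<in> couplings (density M p) (density M q)"
    "(\<integral>\<^sup>+z. d z \<partial>\<gamma>) \<le> (\<integral>\<^sup>+z. G z * ennreal \<bar>p z - q z\<bar> \<partial>M)"
proof -
  obtain \<gamma> where sets: "sets \<gamma> = sets (borel :: ('z \<times> 'z) measure)"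
    and \<gamma>: "\<And>h. h \<in> borel_measurable borel \<Longrightarrow> (\<integral>\<^sup>+z. h z \<partial>\<gamma>)
      = (\<integral>\<^sup>+x. ennreal (common x) * h (x, x) \<partial>M) + (\<integral>\<^sup>+x. \<integral>\<^sup>+y. move x y * h (x, y) \<partial>M \<partial>M)"
    by (rule diagonal_plus_product) blast
  have "(\<integral>\<^sup>+z. d z \<partial>\<gamma>) = (\<integral>\<^sup>+x. \<integral>\<^sup>+y. move x y * d (x, y) \<partial>M \<partial>M)"
    by (simp add: \<gamma>[OF d] diag)
  also have "\<dots> \<le> (\<integral>\<^sup>+x. \<integral>\<^sup>+y. move x y * G x + move x y * G y \<partial>M \<partial>M)"
    unfolding distrib_left[symmetric] by (intro nn_integral_mono mult_left_mono le) simp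
  also have "\<dots> = (\<integral>\<^sup>+x. (\<integral>\<^sup>+y. move x y * G x \<partial>M) + (\<integral>\<^sup>+y. move x y * G y \<partial>M) \<partial>M)"
    by (intro nn_integral_cong nn_integral_add) simp_all
  also have "\<dots> = (\<integral>\<^sup>+x. \<integral>\<^sup>+y. move x y * G x \<partial>M \<partial>M) + (\<integral>\<^sup>+x. \<integral>\<^sup>+y. move x y * G y \<partial>M \<partial>M)"
    by (rule nn_integral_add) measurable
  also have "\<dots> = (\<integral>\<^sup>+z. ennreal (excess z) * G z \<partial>M) + (\<integral>\<^sup>+z. ennreal (deficit z) * G z \<partial>M)"
    by (simp only: nn_integral_move_fst[OF G] nn_integral_move_snd[OF G])
  also have "\<dots> = (\<integral>\<^sup>+z. G z * ennreal \<bar>p z - q z\<bar> \<partial>M)"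
    by (subst nn_integral_add_densities) (simp_all add: parts_nonneg parts_sum mult.commute)
  finally show thesis
    using that[OF diagonal_plus_product_in_couplings[OF sets \<gamma>]] by simp
qed

end

lemma dXr_nonneg: "0 \<le> dXr r x y"
  by (simp add: dXr_def)

lemma dXr_powr:
  assumes "0 < r"
  shows "dXr r x y powr r = dist (fst x) (fst y) powr r + dist (snd x) (snd y) powr r"
  using assms by (simp add: dXr_def powr_powr)

lemma powr_add_le:
  fixes a b q :: real
  assumes "0 \<le> a" "0 \<le> b" "0 \<le> q"
  shows "(a + b) powr q \<le> 2 powr q * (a powr q + b powr q)"
proof -
  have "(a + b) powr q \<le> (2 * max a b) powr q" using assms by (intro powr_mono2) auto
  also have "\<dots> = 2 powr q * max a b powr q" using assms by (simp add: powr_mult)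
  also have "max a b powr q \<le> a powr q + b powr q" by (auto simp: max_def)
  finally show ?thesis by simp
qed

lemma dist_powr_le:
  fixes q :: real
  assumes "0 \<le> q"
  shows "dist x y powr q \<le> 2 powr q * (dist z x powr q + dist z y powr q)"
proof -
  have "dist x y powr q \<le> (dist z x + dist z y) powr q"
    using assms dist_triangle3[of x y z] by (intro powr_mono2) auto
  also have "\<dots> \<le> 2 powr q * (dist z x powr q + dist z y powr q)" using assms by (intro powr_add_le) auto
  finally show ?thesis .
qed

lemma dXr_powr_le:
  assumes "0 < r"
  shows "dXr r x y powr r \<le> 2 powr r * (dXr r z x powr r + dXr r z y powr r)"
  using dist_powr_le[of r "fst x" "fst y" "fst z"] dist_powr_le[of r "snd x" "snd y" "snd z"] assms
  by (simp add: dXr_powr algebra_simps)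

lemma dXr_powr_measurable:
  assumes r: "0 < r"
  shows "(\<lambda>w. dXr r (fst w) (snd w) powr r)
    \<in> borel_measurable (borel :: (('a::polish_space \<times> 'b::polish_space) \<times> ('a \<times> 'b)) measure)"
proof -
  have "continuous_on UNIV (\<lambda>w :: ('a \<times> 'b) \<times> ('a \<times> 'b). dist (fst (fst w)) (fst (snd w)))"
    "continuous_on UNIV (\<lambda>w :: ('a \<times> 'b) \<times> ('a \<times> 'b). dist (snd (fst w)) (snd (snd w)))"
    by (intro continuous_intros)+
  note [measurable] = this[THEN borel_measurable_continuous_onI]
  show ?thesis unfolding dXr_powr[OF r] by measurable
qed

lemma Wass_le:
  assumes \<gamma>: "\<gamma> \<in> couplings P Q" and le: "(\<integral>\<^sup>+z. ennreal (dXr r (fst z) (snd z) powr r) \<partial>\<gamma>) \<le> ennreal X"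
    and r: "0 < r"
  shows "Wass r P Q \<le> ennreal (X powr (1 / r))"
proof -
  define I where "I = (INF \<gamma>\<in>couplings P Q. \<integral>\<^sup>+z. ennreal (dXr r (fst z) (snd z) powr r) \<partial>\<gamma>)"
  have I: "I \<le> ennreal X" unfolding I_def using INF_lower[OF \<gamma>] le by (rule order_trans)
  then have fin: "I \<noteq> \<infinity>" by (auto simp: top_unique)
  show ?thesis
  proof (cases "0 \<le> X")
    case True
    then have "enn2real I \<le> X" using enn2real_mono[OF I] by simp
    then have "enn2real I powr (1 / r) \<le> X powr (1 / r)" using r by (intro powr_mono2) auto
    then show ?thesis using fin unfolding Wass_def Let_def I_def[symmetric] by (simp add: ennreal_leI)
  next
    case False
    then have "I = 0" using I by (simp add: ennreal_neg)
    then show ?thesis unfolding Wass_def Let_def I_def[symmetric] by simp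
  qed
qed

lemma Wass_density_le:
  fixes M :: "('a::polish_space \<times> 'b::polish_space) measure"
  assumes pq: "density_pair M p q" and r: "0 < r"
    and le: "(\<integral>\<^sup>+z. ennreal (2 powr r * dXr r z0 z powr r) * ennreal \<bar>p z - q z\<bar> \<partial>M) \<le> ennreal X"
  shows "Wass r (density M p) (density M q) \<le> ennreal (X powr (1 / r))"
proof -
  interpret density_pair M p q by fact
  define G where "G z = ennreal (2 powr r * dXr r z0 z powr r)" for z
  have "(\<lambda>z. dXr r z0 z powr r) \<in> borel_measurable borel"
    using measurable_compose[OF _ dXr_powr_measurable[OF r], of "\<lambda>z. (z0, z)" borel]
    by (simp add: borel_measurable_continuous_onI continuous_on_Pair continuous_on_const continuous_on_id)
  then have "(\<lambda>z. dXr r z0 z powr r) \<in> borel_measurable M" by (simp add: measurable_cong_sets[OF sets_M refl])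
  then have G_measurable: "G \<in> borel_measurable M" unfolding G_def[abs_def] by measurable
  have dist_measurable: "(\<lambda>w :: ('a \<times> 'b) \<times> ('a \<times> 'b). ennreal (dXr r (fst w) (snd w) powr r)) \<in> borel_measurable borel"
    by (rule measurable_compose[OF dXr_powr_measurable[OF r] measurable_ennreal])
  have diag: "ennreal (dXr r (fst (z, z)) (snd (z, z)) powr r) = 0" for z :: "'a \<times> 'b"
    by (simp add: dXr_def)
  have triangle: "ennreal (dXr r (fst (z, w)) (snd (z, w)) powr r) \<le> G z + G w" for z w
    using dXr_powr_le[OF r, of z w z0] unfolding G_def by (simp add: ennreal_leI distrib_left flip: ennreal_plus)
  obtain \<gamma> where "\<gamma> \<in> couplings (density M p) (density M q)"
    "(\<integral>\<^sup>+w. ennreal (dXr r (fst w) (snd w) powr r) \<partial>\<gamma>) \<le> (\<integral>\<^sup>+z. G z * ennreal \<bar>p z - q z\<bar> \<partial>M)"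
    by (rule total_variation_coupling[OF dist_measurable G_measurable diag triangle])
  moreover note le[folded G_def]
  ultimately show ?thesis using r by (intro Wass_le) auto
qed

lemma powr_le_one_plus_powr:
  fixes a q p :: real
  assumes "0 \<le> a" "0 \<le> q" "q \<le> p"
  shows "a powr q \<le> 1 + a powr p"
proof (cases "a \<le> 1")
  case True
  then have "a powr q \<le> 1" using assms by (intro powr_le1) auto
  then show ?thesis by (simp add: add_increasing2)
next
  case False
  then have "a powr q \<le> a powr p" using assms by (intro powr_mono) auto
  then show ?thesis by simp
qed

locale wasserstein_cost_space =
  borel_cost_space M1 M2 c "\<lambda>x. dist u x powr p" "\<lambda>y. dist v y powr p" \<alpha> B0 B1
  for M1 :: "'a::polish_space measure" and M2 :: "'b::polish_space measure" and c u v p \<alpha> B0 B1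
begin

lemma Wass_le_weighted_tv:
  assumes q: "0 < q" "q \<le> p"
    and s1[measurable]: "case_prod s1 \<in> borel_measurable MM" and s2[measurable]: "case_prod s2 \<in> borel_measurable MM"
    and nonneg: "\<And>x y. 0 \<le> s1 x y" "\<And>x y. 0 \<le> s2 x y"
    and mass: "(\<integral>\<^sup>+(x, y). ennreal (s1 x y) \<partial>MM) = 1" "(\<integral>\<^sup>+(x, y). ennreal (s2 x y) \<partial>MM) = 1"
    and X: "weighted_tv s1 s2 \<le> ennreal X"
  shows "Wass q (dens s1) (dens s2) \<le> ennreal ((2 * 2 powr q * X) powr (1 / q))"
proof -
  have densities: "density_pair MM (case_prod s1) (case_prod s2)"
    by unfold_locales (use sets_MM nonneg mass in \<open>auto simp: case_prod_beta'\<close>)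
  have weight: "2 powr q * dXr q (u, v) (x, y) powr q \<le> 2 * 2 powr q * (1 + (dist u x powr p + dist v y powr p))" for x y
  proof -
    have "dXr q (u, v) (x, y) powr q \<le> (1 + dist u x powr p) + (1 + dist v y powr p)"
      unfolding dXr_powr[OF q(1)] fst_conv snd_conv using q by (intro add_mono powr_le_one_plus_powr) auto
    also have "\<dots> \<le> 2 * (1 + (dist u x powr p + dist v y powr p))" by simp
    finally have "2 powr q * dXr q (u, v) (x, y) powr q \<le> 2 powr q * (2 * (1 + (dist u x powr p + dist v y powr p)))"
      by (rule mult_left_mono) simp
    then show ?thesis by (simp only: mult_ac)
  qed
  have "(\<integral>\<^sup>+z. ennreal (2 powr q * dXr q (u, v) z powr q) * ennreal \<bar>case_prod s1 z - case_prod s2 z\<bar> \<partial>MM)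
      \<le> (\<integral>\<^sup>+z. ennreal (2 * 2 powr q) * (case z of (x, y) \<Rightarrow>
          ennreal ((1 + (dist u x powr p + dist v y powr p)) * \<bar>s1 x y - s2 x y\<bar>)) \<partial>MM)"
  proof (rule nn_integral_mono)
    fix z :: "'a \<times> 'b"
    obtain x y where z: "z = (x, y)" by (cases z)
    have "2 powr q * dXr q (u, v) (x, y) powr q * \<bar>s1 x y - s2 x y\<bar>
        \<le> 2 * 2 powr q * ((1 + (dist u x powr p + dist v y powr p)) * \<bar>s1 x y - s2 x y\<bar>)"
      unfolding mult.assoc[of "2 * 2 powr q", symmetric] by (intro mult_right_mono weight) simp
    then show "ennreal (2 powr q * dXr q (u, v) z powr q) * ennreal \<bar>case_prod s1 z - case_prod s2 z\<bar>
        \<le> ennreal (2 * 2 powr q) * (case z of (x, y) \<Rightarrow>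
          ennreal ((1 + (dist u x powr p + dist v y powr p)) * \<bar>s1 x y - s2 x y\<bar>))"
      by (simp add: z ennreal_leI flip: ennreal_mult)
  qed
  also have "\<dots> = ennreal (2 * 2 powr q) * weighted_tv s1 s2"
    unfolding weighted_tv_def by (rule nn_integral_cmult) measurable
  also have "\<dots> \<le> ennreal (2 * 2 powr q) * ennreal X" by (intro mult_left_mono X) simp
  also have "\<dots> = ennreal (2 * 2 powr q * X)" by (simp add: ennreal_mult')
  finally have "Wass q (density MM (case_prod s1)) (density MM (case_prod s2)) \<le> ennreal ((2 * 2 powr q * X) powr (1 / q))"
    by (rule Wass_density_le[OF densities q(1)])
  then show ?thesis by (simp add: case_prod_beta')
qed

lemma close_to_sinkhorn:
  assumes r: "optimal_density r" and close: "close_densities C \<epsilon> r (iterate n)"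
  shows "\<bar>Fent (case_prod c) M1 M2 (dens r) - Fent (case_prod c) M1 M2 (sinkhorn (case_prod c) M1 M2 n)\<bar> \<le> ereal (C * \<epsilon>\<^sup>2)"
    and "0 < q \<Longrightarrow> q \<le> p \<Longrightarrow>
      Wass q (dens r) (sinkhorn (case_prod c) M1 M2 n) \<le> ennreal ((2 * 2 powr q * (C * \<epsilon>)) powr (1 / q))"
    and "0 < q \<Longrightarrow> q \<le> p \<Longrightarrow>
      Wass q (sinkhorn (case_prod c) M1 M2 n) (dens r) \<le> ennreal ((2 * 2 powr q * (C * \<epsilon>)) powr (1 / q))"
proof -
  note marginals = optimal_densityD(1)[OF r]
  have "coupling_density r" using r unfolding optimal_density_def by blast
  then have "Fent (case_prod c) M1 M2 (dens r) = ereal (entropic_cost r)" by (rule Fent_coupling_density)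
  moreover have "Fent (case_prod c) M1 M2 (dens (iterate n)) = ereal (entropic_cost (iterate n))"
    using close unfolding close_densities_def
    by (intro Fent_dens iterate_measurable less_imp_le[OF gibbs_pos]) blast+
  ultimately show "\<bar>Fent (case_prod c) M1 M2 (dens r) - Fent (case_prod c) M1 M2 (sinkhorn (case_prod c) M1 M2 n)\<bar> \<le> ereal (C * \<epsilon>\<^sup>2)"
    using close unfolding sinkhorn_eq close_densities_def by simp
  have tv: "weighted_tv r (iterate n) \<le> ennreal (C * \<epsilon>)" "weighted_tv (iterate n) r \<le> ennreal (C * \<epsilon>)"
    using close weighted_tv_commute[of r] unfolding close_densities_def by simp_all
  note r_facts = has_marginalsD(1,2)[OF marginals] nn_integral_has_marginals[OF marginals]
    and iterate_facts = iterate_measurable less_imp_le[OF gibbs_pos] potentialsD(5)[OF potentials_iterate]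
  assume q: "0 < q" "q \<le> p"
  show "Wass q (dens r) (sinkhorn (case_prod c) M1 M2 n) \<le> ennreal ((2 * 2 powr q * (C * \<epsilon>)) powr (1 / q))"
    "Wass q (sinkhorn (case_prod c) M1 M2 n) (dens r) \<le> ennreal ((2 * 2 powr q * (C * \<epsilon>)) powr (1 / q))"
    unfolding sinkhorn_eq by (intro Wass_le_weighted_tv q r_facts iterate_facts tv)+
qed

lemma sinkhorn_rate:
  assumes \<sigma>: "0 < \<sigma>" "\<sigma> \<le> 1" "\<sigma> < 1 \<or> B1 = 0"
    and \<pi>: "\<pi> \<in> couplings M1 M2" "Fent (case_prod c) M1 M2 \<pi> = S_ent (case_prod c) M1 M2"
  obtains C where "0 \<le> C" "\<bar>Fent (case_prod c) M1 M2 \<pi>\<bar> \<noteq> \<infinity>"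
    "\<And>n. 2 \<le> n \<Longrightarrow> \<bar>Fent (case_prod c) M1 M2 \<pi> - Fent (case_prod c) M1 M2 (sinkhorn (case_prod c) M1 M2 n)\<bar>
      \<le> ereal (C * real n powr (- \<sigma> / 2))"
    "\<And>n q. 2 \<le> n \<Longrightarrow> 0 < q \<Longrightarrow> q \<le> p \<Longrightarrow>
      Wass q \<pi> (sinkhorn (case_prod c) M1 M2 n) \<le> ennreal ((C * real n powr (- \<sigma> / 4)) powr (1 / q))"
    "\<And>n q. 2 \<le> n \<Longrightarrow> 0 < q \<Longrightarrow> q \<le> p \<Longrightarrow>
      Wass q (sinkhorn (case_prod c) M1 M2 n) \<pi> \<le> ennreal ((C * real n powr (- \<sigma> / 4)) powr (1 / q))"
proof -
  obtain r where r: "\<pi> = dens r" "optimal_density r" by (rule optimal_coupling_density[OF \<pi>])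
  obtain C where C: "0 \<le> C"
    and close: "\<And>n r. 2 \<le> n \<Longrightarrow> optimal_density r \<Longrightarrow> close_densities C (real n powr (- \<sigma> / 4)) r (iterate n)"
    using iterates_converge[OF \<sigma>] by blast
  have Wass_const: "ennreal ((2 * 2 powr q * (C * \<epsilon>)) powr (1 / q)) \<le> ennreal ((C * (1 + 2 * 2 powr p) * \<epsilon>) powr (1 / q))"
    if "0 < q" "q \<le> p" "0 \<le> \<epsilon>" for q \<epsilon> :: real
  proof (intro ennreal_leI powr_mono2)
    have "(2::real) powr q \<le> 2 powr p" using that by (intro powr_mono) auto
    then have "2 * 2 powr q \<le> 1 + 2 * 2 powr p" by linarith
    then have "2 * 2 powr q * (C * \<epsilon>) \<le> (1 + 2 * 2 powr p) * (C * \<epsilon>)"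
      using that C by (intro mult_right_mono) auto
    then show "2 * 2 powr q * (C * \<epsilon>) \<le> C * (1 + 2 * 2 powr p) * \<epsilon>" by (simp only: mult_ac)
  qed (use that C in auto)
  show thesis
  proof (rule that)
    show "0 \<le> C * (1 + 2 * 2 powr p)" using C by simp
    have "coupling_density r" using r(2) unfolding optimal_density_def by blast
    then show "\<bar>Fent (case_prod c) M1 M2 \<pi>\<bar> \<noteq> \<infinity>" unfolding r(1) by (simp add: Fent_coupling_density)
  next
    fix n :: nat assume n: "2 \<le> n"
    note close_n = close_to_sinkhorn[OF r(2) close[OF n r(2)], folded r(1)]
    have \<epsilon>: "(real n powr (- \<sigma> / 4))\<^sup>2 = real n powr (- \<sigma> / 2)"
      by (simp add: power2_eq_square flip: powr_add)
    have "C * real n powr (- \<sigma> / 2) \<le> C * (1 + 2 * 2 powr p) * real n powr (- \<sigma> / 2)"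
      using C by (intro mult_right_mono) (auto simp: distrib_left)
    then show "\<bar>Fent (case_prod c) M1 M2 \<pi> - Fent (case_prod c) M1 M2 (sinkhorn (case_prod c) M1 M2 n)\<bar>
        \<le> ereal (C * (1 + 2 * 2 powr p) * real n powr (- \<sigma> / 2))"
      using close_n(1) unfolding \<epsilon> by (meson ereal_less_eq(3) order_trans)
    fix q assume q: "0 < q" "q \<le> p"
    show "Wass q \<pi> (sinkhorn (case_prod c) M1 M2 n) \<le> ennreal ((C * (1 + 2 * 2 powr p) * real n powr (- \<sigma> / 4)) powr (1 / q))"
      "Wass q (sinkhorn (case_prod c) M1 M2 n) \<pi> \<le> ennreal ((C * (1 + 2 * 2 powr p) * real n powr (- \<sigma> / 4)) powr (1 / q))"
      using close_n(2,3)[OF q] Wass_const[OF q] by (meson order_trans powr_ge_zero)+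
  qed
qed

end

section \<open>Growth conditions and the convergence theorem\<close>

lemma dXr_le_dist:
  assumes "1 \<le> r"
  shows "dXr r x y \<le> 2 * dist x y"
proof -
  have "dist (fst x) (fst y) powr r \<le> dist x y powr r" "dist (snd x) (snd y) powr r \<le> dist x y powr r"
    using assms dist_fst_le[of x y] dist_snd_le[of x y] by (auto intro!: powr_mono2)
  then have "dXr r x y \<le> (2 * dist x y powr r) powr (1 / r)"
    unfolding dXr_def using assms by (intro powr_mono2) auto
  also have "\<dots> = 2 powr (1 / r) * dist x y" using assms by (simp add: powr_mult powr_powr)
  also have "\<dots> \<le> 2 powr 1 * dist x y" using assms by (intro mult_right_mono powr_mono) auto
  finally show ?thesis by simp
qed

lemma lipschitzXE:
  assumes "lipschitzX p f"
  obtains L where "0 \<le> L" "\<And>x y. \<bar>f x - f y\<bar> \<le> L * dXr p x y"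
proof -
  obtain L where L: "\<And>x y. \<bar>f x - f y\<bar> \<le> L * dXr p x y" using assms by (auto simp: lipschitzX_def)
  have "\<bar>f x - f y\<bar> \<le> \<bar>L\<bar> * dXr p x y" for x y
    using L[of x y] mult_right_mono[OF abs_ge_self[of L] dXr_nonneg[of p x y]] by linarith
  then show thesis by (rule that[OF abs_ge_zero])
qed

lemma growthE:
  assumes "growth p r h"
  obtains C z0 where "0 \<le> C" "\<And>z. \<bar>h z\<bar> \<le> C * (1 + dXr p z z0 powr r)"
proof -
  obtain C z0 where C: "\<And>z. \<bar>h z\<bar> \<le> C * (1 + dXr p z z0 powr r)" using assms by (auto simp: growth_def)
  have "\<bar>h z\<bar> \<le> \<bar>C\<bar> * (1 + dXr p z z0 powr r)" for z
    using C[of z] mult_right_mono[OF abs_ge_self[of C], of "1 + dXr p z z0 powr r"] by (simp add: add_nonneg_nonneg)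
  then show thesis by (rule that[OF abs_ge_zero])
qed

lemma continuous_on_lipschitzX:
  assumes "1 \<le> p" and f: "lipschitzX p f"
  shows "continuous_on UNIV f"
proof -
  obtain L where L: "0 \<le> L" "\<And>x y. \<bar>f x - f y\<bar> \<le> L * dXr p x y" using f by (rule lipschitzXE) blast
  have "\<bar>f x - f y\<bar> \<le> 2 * L * dist x y" for x y
    using L(2)[of x y] mult_left_mono[OF dXr_le_dist[OF assms(1), of x y] L(1)] by linarith
  then have "(2 * L)-lipschitz_on UNIV f" using L(1) by (auto intro!: lipschitz_onI simp: dist_real_def)
  then show ?thesis by (rule lipschitz_on_continuous_on)
qed

lemma growth_le:
  fixes c :: "'a::metric_space \<times> 'b::metric_space \<Rightarrow> real"
  assumes p: "0 < p" and c: "growth p p c"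
  obtains B0 B1 where "0 \<le> B0" "0 \<le> B1"
    "\<And>x y. c (x, y) \<le> B0 + B1 * (dist u x powr p + dist v y powr p)"
proof -
  obtain C z0 where C: "0 \<le> C" "\<And>z. \<bar>c z\<bar> \<le> C * (1 + dXr p z z0 powr p)" using c by (rule growthE) blast
  let ?B1 = "C * 2 powr p"
  let ?B0 = "C + ?B1 * dXr p (u, v) z0 powr p"
  show thesis
  proof (rule that[of ?B0 ?B1])
    show "0 \<le> ?B0" "0 \<le> ?B1" using C(1) by auto
    fix x y
    have "c (x, y) \<le> C * (1 + dXr p (x, y) z0 powr p)" using C(2)[of "(x, y)"] by linarith
    also have "\<dots> \<le> C * (1 + 2 powr p * (dXr p (u, v) (x, y) powr p + dXr p (u, v) z0 powr p))"
      by (intro mult_left_mono add_left_mono dXr_powr_le p C(1))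
    also have "\<dots> = ?B0 + ?B1 * (dist u x powr p + dist v y powr p)"
      by (simp add: dXr_powr[OF p, of "(u, v)" "(x, y)"] algebra_simps)
    finally show "c (x, y) \<le> ?B0 + ?B1 * (dist u x powr p + dist v y powr p)" .
  qed
qed

lemma one_plus_mult_one_plus_powr_le:
  fixes d p :: real
  assumes "0 \<le> d" "1 \<le> p"
  shows "(1 + d) * (1 + d powr (p - 1)) \<le> 4 * (1 + d powr p)"
proof -
  define m where "m = max 1 d"
  have m: "1 \<le> m" "d \<le> m" by (auto simp: m_def)
  have "d powr (p - 1) \<le> m powr (p - 1)" "1 \<le> m powr (p - 1)"
    using m assms by (auto intro!: powr_mono2 ge_one_powr_ge_zero)
  then have "(1 + d) * (1 + d powr (p - 1)) \<le> (2 * m) * (2 * m powr (p - 1))"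
    using m assms by (intro mult_mono) auto
  also have "\<dots> = 4 * m powr p" using m by (simp add: powr_diff)
  also have "m powr p \<le> 1 + d powr p" by (auto simp: m_def max_def)
  finally show ?thesis by simp
qed

lemma growth_mult:
  assumes p: "1 \<le> p" and f: "lipschitzX p f" and g: "growth p (p - 1) g"
  shows "growth p p (\<lambda>z. f z * g z)"
proof -
  obtain C z0 where C: "0 \<le> C" "\<And>z. \<bar>g z\<bar> \<le> C * (1 + dXr p z z0 powr (p - 1))" using g by (rule growthE) blast
  obtain L where L: "0 \<le> L" "\<And>x y. \<bar>f x - f y\<bar> \<le> L * dXr p x y" using f by (rule lipschitzXE) blast
  define F where "F = \<bar>f z0\<bar> + L"
  have F: "0 \<le> F" using L by (simp add: F_def)
  have f_le: "\<bar>f z\<bar> \<le> F * (1 + dXr p z z0)" for z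
  proof -
    have "\<bar>f z\<bar> \<le> \<bar>f z0\<bar> * 1 + L * dXr p z z0" using L(2)[of z z0] by linarith
    also have "\<dots> \<le> \<bar>f z0\<bar> * (1 + dXr p z z0) + L * (1 + dXr p z z0)"
      using L(1) dXr_nonneg[of p z z0] by (intro add_mono mult_left_mono) auto
    finally show ?thesis by (simp add: F_def distrib_right)
  qed
  have "\<bar>f z * g z\<bar> \<le> 4 * F * C * (1 + dXr p z z0 powr p)" for z
  proof -
    have "\<bar>f z * g z\<bar> \<le> (F * (1 + dXr p z z0)) * (C * (1 + dXr p z z0 powr (p - 1)))"
      unfolding abs_mult using F dXr_nonneg[of p z z0] by (intro mult_mono f_le C) auto
    also have "\<dots> = F * C * ((1 + dXr p z z0) * (1 + dXr p z z0 powr (p - 1)))" by simp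
    also have "\<dots> \<le> F * C * (4 * (1 + dXr p z z0 powr p))"
      using F C(1) by (intro mult_left_mono one_plus_mult_one_plus_powr_le p dXr_nonneg) auto
    finally show ?thesis by (simp only: mult_ac)
  qed
  then show ?thesis unfolding growth_def by blast
qed

lemma growth_0_bounded:
  assumes "growth p 0 h"
  obtains B where "0 \<le> B" "\<And>z. \<bar>h z\<bar> \<le> B"
proof -
  obtain C z0 where C: "0 \<le> C" "\<And>z. \<bar>h z\<bar> \<le> C * (1 + dXr p z z0 powr 0)" using assms by (rule growthE) blast
  have "\<bar>h z\<bar> \<le> C * 2" for z
  proof -
    have "C * (1 + dXr p z z0 powr 0) \<le> C * 2" using C(1) by (intro mult_left_mono) auto
    with C(2)[of z] show ?thesis by linarith
  qed
  then show thesis using that[of "C * 2"] C(1) by simp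
qed

lemma product_cost_le:
  fixes f g :: "'a::metric_space \<times> 'b::metric_space \<Rightarrow> real"
  assumes p: "1 \<le> p" and f: "lipschitzX p f" "growth p (p - 1) f" and g: "growth p (p - 1) g"
  obtains B0 B1 where "0 \<le> B0" "0 \<le> B1" "1 / p < 1 \<or> B1 = 0"
    "\<And>x y. f (x, y) * g (x, y) \<le> B0 + B1 * (dist u x powr p + dist v y powr p)"
proof (cases "p = 1")
  case True
  then have "growth p 0 f" "growth p 0 g" using f g by simp_all
  then obtain Bf Bg where B: "0 \<le> Bf" "\<And>z. \<bar>f z\<bar> \<le> Bf" "0 \<le> Bg" "\<And>z. \<bar>g z\<bar> \<le> Bg"
    by (metis growth_0_bounded)
  have "f z * g z \<le> Bf * Bg" for z
    using mult_mono[OF B(2)[of z] B(4)[of z] B(1)] abs_ge_self[of "f z * g z"] by (simp add: abs_mult)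
  then show thesis using that[of "Bf * Bg" 0] B by simp
next
  case False
  then have "1 / p < 1" "0 < p" using p by simp_all
  from growth_le[OF this(2) growth_mult[OF p f(1) g], of u v] this(1) show thesis using that by metis
qed

lemma tendsto_of_abs_diff_le:
  fixes X :: "nat \<Rightarrow> ereal"
  assumes x: "\<bar>x\<bar> \<noteq> \<infinity>" and b: "b \<longlonglongrightarrow> 0" and le: "\<forall>\<^sub>F n in sequentially. \<bar>x - X n\<bar> \<le> ereal (b n)"
  shows "X \<longlonglongrightarrow> x"
proof -
  obtain x' where x': "x = ereal x'" using x by auto
  have le': "\<forall>\<^sub>F n in sequentially. ereal (x' - b n) \<le> X n \<and> X n \<le> ereal (x' + b n)"
    using le
  proof eventually_elim
    case (elim n)
    then show ?case unfolding x' by (cases "X n") auto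
  qed
  have "(\<lambda>n. ereal (x' - b n)) \<longlonglongrightarrow> ereal (x' - 0)" "(\<lambda>n. ereal (x' + b n)) \<longlonglongrightarrow> ereal (x' + 0)"
    by (intro tendsto_ereal tendsto_diff tendsto_add tendsto_const b)+
  with le' show ?thesis
    unfolding x' by (intro tendsto_sandwich[of "\<lambda>n. ereal (x' - b n)" X sequentially "\<lambda>n. ereal (x' + b n)"])
      (auto elim: eventually_mono)
qed

lemma powr_rate_tendsto_0:
  fixes C s e :: real
  assumes "0 \<le> C" "0 < s" "0 < e"
  shows "(\<lambda>n. (C * real n powr (- s)) powr e) \<longlonglongrightarrow> 0"
proof -
  have "(\<lambda>n. real n powr (- s * e)) \<longlonglongrightarrow> 0"
    using assms by (intro tendsto_neg_powr filterlim_real_sequentially) (simp add: mult_pos_pos)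
  from tendsto_mult_left_zero[OF this, of "C powr e"] show ?thesis
    using assms by (simp add: powr_mult powr_powr mult.commute)
qed

locale exp_moment_marginals =
  fixes \<mu>1 :: "'a::polish_space measure" and \<mu>2 :: "'b::polish_space measure"
    and p \<alpha>1 \<alpha>2 :: real and u :: 'a and v :: 'b
  assumes p: "1 \<le> p" and \<mu>1: "prob_space \<mu>1" "sets \<mu>1 = sets borel" and \<mu>2: "prob_space \<mu>2" "sets \<mu>2 = sets borel"
    and \<alpha>1: "0 < \<alpha>1" "(\<integral>\<^sup>+x. ennreal (exp (\<alpha>1 * dist u x powr p)) \<partial>\<mu>1) < \<infinity>"
    and \<alpha>2: "0 < \<alpha>2" "(\<integral>\<^sup>+y. ennreal (exp (\<alpha>2 * dist v y powr p)) \<partial>\<mu>2) < \<infinity>"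
begin

lemma integrable_exp_dist:
  fixes M :: "'c::polish_space measure"
  assumes "sets M = sets borel" "\<alpha> \<le> \<alpha>'" and fin: "(\<integral>\<^sup>+x. ennreal (exp (\<alpha>' * dist z x powr p)) \<partial>M) < \<infinity>"
  shows "(\<lambda>x. dist z x powr p) \<in> borel_measurable M" "integrable M (\<lambda>x. exp (\<alpha> * dist z x powr p))"
proof -
  have [measurable]: "(\<lambda>x. dist z x) \<in> borel_measurable borel"
    by (intro borel_measurable_continuous_onI continuous_intros)
  have "(\<lambda>x. dist z x powr p) \<in> borel_measurable borel" by measurable
  then show [measurable]: "(\<lambda>x. dist z x powr p) \<in> borel_measurable M"
    by (simp add: measurable_cong_sets[OF assms(1) refl])
  show "integrable M (\<lambda>x. exp (\<alpha> * dist z x powr p))"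
  proof (rule integrableI_bounded)
    have "(\<integral>\<^sup>+x. ennreal (norm (exp (\<alpha> * dist z x powr p))) \<partial>M) \<le> (\<integral>\<^sup>+x. ennreal (exp (\<alpha>' * dist z x powr p)) \<partial>M)"
      using assms(2) by (intro nn_integral_mono ennreal_leI) (auto intro!: mult_right_mono)
    then show "(\<integral>\<^sup>+x. ennreal (norm (exp (\<alpha> * dist z x powr p))) \<partial>M) < \<infinity>" using fin by (rule le_less_trans)
  qed measurable
qed

lemma wasserstein_cost_space:
  assumes c: "continuous_on UNIV c" "\<And>z. 0 \<le> c z" and B: "0 \<le> B0" "0 \<le> B1"
    and c_le: "\<And>x y. c (x, y) \<le> B0 + B1 * (dist u x powr p + dist v y powr p)"
  shows "wasserstein_cost_space \<mu>1 \<mu>2 (curry c) u v p (min \<alpha>1 \<alpha>2) B0 B1"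
proof -
  interpret M1: prob_space \<mu>1 by (rule \<mu>1)
  interpret M2: prob_space \<mu>2 by (rule \<mu>2)
  interpret pair_prob_space \<mu>1 \<mu>2 ..
  have sets: "sets (\<mu>1 \<Otimes>\<^sub>M \<mu>2) = sets (borel :: ('a \<times> 'b) measure)"
    by (metis borel_prod sets_pair_measure_cong \<mu>1(2) \<mu>2(2))
  have "c \<in> borel_measurable (\<mu>1 \<Otimes>\<^sub>M \<mu>2)"
    using borel_measurable_continuous_onI[OF c(1)] by (simp add: measurable_cong_sets[OF sets refl])
  then show ?thesis
    by unfold_locales
       (use c B c_le \<alpha>1(1) \<alpha>2(1) \<mu>1(2) \<mu>2(2) integrable_exp_dist[OF \<mu>1(2) min.cobounded1 \<alpha>1(2)]
          integrable_exp_dist[OF \<mu>2(2) min.cobounded2 \<alpha>2(2)] in auto)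
qed

theorem sinkhorn_tendsto:
  assumes c: "continuous_on UNIV c" "\<And>z. 0 \<le> c z" "growth p p c"
    and \<pi>: "\<pi> \<in> couplings \<mu>1 \<mu>2" "Fent c \<mu>1 \<mu>2 \<pi> = S_ent c \<mu>1 \<mu>2"
  shows "(\<lambda>n. Fent c \<mu>1 \<mu>2 (sinkhorn c \<mu>1 \<mu>2 n)) \<longlonglongrightarrow> Fent c \<mu>1 \<mu>2 \<pi>"
    and "(\<lambda>n. Wass p (sinkhorn c \<mu>1 \<mu>2 n) \<pi>) \<longlonglongrightarrow> 0"
proof -
  have "0 < p" using p by simp
  obtain B0 B1 where B: "0 \<le> B0" "0 \<le> B1" "\<And>x y. c (x, y) \<le> B0 + B1 * (dist u x powr p + dist v y powr p)"
    using growth_le[OF \<open>0 < p\<close> c(3)] by metis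
  interpret wasserstein_cost_space \<mu>1 \<mu>2 "curry c" u v p "min \<alpha>1 \<alpha>2" B0 B1
    by (rule wasserstein_cost_space[OF c(1,2) B])
  obtain C where C: "0 \<le> C" "\<bar>Fent c \<mu>1 \<mu>2 \<pi>\<bar> \<noteq> \<infinity>"
    "\<And>n. 2 \<le> n \<Longrightarrow> \<bar>Fent c \<mu>1 \<mu>2 \<pi> - Fent c \<mu>1 \<mu>2 (sinkhorn c \<mu>1 \<mu>2 n)\<bar> \<le> ereal (C * real n powr (- (1 / 2) / 2))"
    "\<And>n. 2 \<le> n \<Longrightarrow> Wass p (sinkhorn c \<mu>1 \<mu>2 n) \<pi> \<le> ennreal ((C * real n powr (- (1 / 2) / 4)) powr (1 / p))"
    by (rule sinkhorn_rate[of "1 / 2" \<pi>, unfolded case_prod_curry]) (use \<pi> \<open>0 < p\<close> in simp_all)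
  show "(\<lambda>n. Fent c \<mu>1 \<mu>2 (sinkhorn c \<mu>1 \<mu>2 n)) \<longlonglongrightarrow> Fent c \<mu>1 \<mu>2 \<pi>"
  proof (rule tendsto_of_abs_diff_le[OF C(2)])
    show "(\<lambda>n. C * real n powr (- (1 / 2) / 2)) \<longlonglongrightarrow> 0" using powr_rate_tendsto_0[OF C(1), of "1 / 4" 1] C(1) by simp
    show "\<forall>\<^sub>F n in sequentially. \<bar>Fent c \<mu>1 \<mu>2 \<pi> - Fent c \<mu>1 \<mu>2 (sinkhorn c \<mu>1 \<mu>2 n)\<bar>
        \<le> ereal (C * real n powr (- (1 / 2) / 2))"
      using eventually_ge_at_top[of 2] by eventually_elim (rule C(3))
  qed
  have "(\<lambda>n. (C * real n powr (- (1 / 2) / 4)) powr (1 / p)) \<longlonglongrightarrow> 0"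
    using powr_rate_tendsto_0[OF C(1), of "1 / 8" "1 / p"] \<open>0 < p\<close> by simp
  then have bound: "(\<lambda>n. ennreal ((C * real n powr (- (1 / 2) / 4)) powr (1 / p))) \<longlonglongrightarrow> 0"
    using tendsto_ennrealI by fastforce
  have "\<forall>\<^sub>F n in sequentially. Wass p (sinkhorn c \<mu>1 \<mu>2 n) \<pi> \<le> ennreal ((C * real n powr (- (1 / 2) / 4)) powr (1 / p))"
    using eventually_ge_at_top[of 2] by eventually_elim (rule C(4))
  from tendsto_sandwich[OF _ this tendsto_const bound]
  show "(\<lambda>n. Wass p (sinkhorn c \<mu>1 \<mu>2 n) \<pi>) \<longlonglongrightarrow> 0" by simp
qed

theorem sinkhorn_product_cost_rate:
  assumes q: "1 \<le> q" "q \<le> p" and f: "lipschitzX p f" "growth p (p - 1) f" and g: "lipschitzX p g" "growth p (p - 1) g"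
    and nonneg: "\<And>z. 0 \<le> f z * g z"
  defines "c \<equiv> \<lambda>z. f z * g z"
  assumes \<pi>: "\<pi> \<in> couplings \<mu>1 \<mu>2" "Fent c \<mu>1 \<mu>2 \<pi> = S_ent c \<mu>1 \<mu>2"
  shows "\<exists>c0. \<forall>n\<ge>2.
    \<bar>Fent c \<mu>1 \<mu>2 \<pi> - Fent c \<mu>1 \<mu>2 (sinkhorn c \<mu>1 \<mu>2 n)\<bar> \<le> ereal (c0 * real n powr (- 1 / (2 * p)))
    \<and> Wass q \<pi> (sinkhorn c \<mu>1 \<mu>2 n) \<le> ennreal (c0 * real n powr (- 1 / (4 * p * q)))"
proof -
  have c: "continuous_on UNIV c"
    unfolding c_def by (intro continuous_on_mult continuous_on_lipschitzX[OF p] f g)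
  have c_nonneg: "0 \<le> c z" for z unfolding c_def by (rule nonneg)
  obtain B0 B1 where B: "0 \<le> B0" "0 \<le> B1" "\<And>x y. c (x, y) \<le> B0 + B1 * (dist u x powr p + dist v y powr p)"
    and \<sigma>: "1 / p < 1 \<or> B1 = 0"
    unfolding c_def using product_cost_le[OF p f g(2)] by metis
  interpret wasserstein_cost_space \<mu>1 \<mu>2 "curry c" u v p "min \<alpha>1 \<alpha>2" B0 B1
    by (rule wasserstein_cost_space[OF c c_nonneg B])
  obtain C where C: "0 \<le> C"
    "\<And>n. 2 \<le> n \<Longrightarrow> \<bar>Fent c \<mu>1 \<mu>2 \<pi> - Fent c \<mu>1 \<mu>2 (sinkhorn c \<mu>1 \<mu>2 n)\<bar> \<le> ereal (C * real n powr (- (1 / p) / 2))"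
    "\<And>n. 2 \<le> n \<Longrightarrow> Wass q \<pi> (sinkhorn c \<mu>1 \<mu>2 n) \<le> ennreal ((C * real n powr (- (1 / p) / 4)) powr (1 / q))"
    by (rule sinkhorn_rate[of "1 / p" \<pi>, unfolded case_prod_curry]) (use \<pi> p q \<sigma> in simp_all)
  show ?thesis
  proof (intro exI[of _ "max C (C powr (1 / q))"] allI impI conjI)
    fix n :: nat assume n: "2 \<le> n"
    have "C * real n powr (- (1 / p) / 2) \<le> max C (C powr (1 / q)) * real n powr (- 1 / (2 * p))"
      by (simp add: mult.commute mult_right_mono)
    then show "\<bar>Fent c \<mu>1 \<mu>2 \<pi> - Fent c \<mu>1 \<mu>2 (sinkhorn c \<mu>1 \<mu>2 n)\<bar>
        \<le> ereal (max C (C powr (1 / q)) * real n powr (- 1 / (2 * p)))"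
      using C(2)[OF n] by (meson ereal_less_eq(3) order_trans)
    have "(C * real n powr (- (1 / p) / 4)) powr (1 / q) = C powr (1 / q) * real n powr (- 1 / (4 * p * q))"
      using C(1) by (simp add: powr_mult powr_powr mult_ac)
    also have "\<dots> \<le> max C (C powr (1 / q)) * real n powr (- 1 / (4 * p * q))"
      by (intro mult_right_mono) auto
    finally show "Wass q \<pi> (sinkhorn c \<mu>1 \<mu>2 n) \<le> ennreal (max C (C powr (1 / q)) * real n powr (- 1 / (4 * p * q)))"
      using C(3)[OF n] by (meson ennreal_leI order_trans)
  qed
qed

end

theorem mainTheorem10:
  fixes \<mu>1 :: "'a::polish_space measure" and \<mu>2 :: "'b::polish_space measure"
    and p :: real
  assumes p: "1 \<le> p"
    and P1: "prob_space \<mu>1" "sets \<mu>1 = sets borel"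
    and P2: "prob_space \<mu>2" "sets \<mu>2 = sets borel"
    and mom1: "\<exists>\<alpha>>0. \<exists>xh. (\<integral>\<^sup>+ x. ennreal (exp (\<alpha> * dist xh x powr p)) \<partial>\<mu>1) < \<infinity>"
    and mom2: "\<exists>\<alpha>>0. \<exists>xh. (\<integral>\<^sup>+ x. ennreal (exp (\<alpha> * dist xh x powr p)) \<partial>\<mu>2) < \<infinity>"
  shows
    "(\<forall>c \<pi>s. continuous_on UNIV c \<and> (\<forall>x. 0 \<le> c x) \<and> growth p p c
        \<and> \<pi>s \<in> couplings \<mu>1 \<mu>2 \<and> Fent c \<mu>1 \<mu>2 \<pi>s = S_ent c \<mu>1 \<mu>2
      \<longrightarrow> (\<lambda>n. Fent c \<mu>1 \<mu>2 (sinkhorn c \<mu>1 \<mu>2 n)) \<longlonglongrightarrow> Fent c \<mu>1 \<mu>2 \<pi>s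
        \<and> (\<lambda>n. Wass p (sinkhorn c \<mu>1 \<mu>2 n) \<pi>s) \<longlonglongrightarrow> 0)
   \<and> (\<forall>q f g \<pi>s. 1 \<le> q \<and> q \<le> p
        \<and> lipschitzX p f \<and> lipschitzX p g \<and> growth p (p - 1) f \<and> growth p (p - 1) g
        \<and> (\<forall>x. 0 \<le> f x * g x)
        \<and> \<pi>s \<in> couplings \<mu>1 \<mu>2
        \<and> Fent (\<lambda>x. f x * g x) \<mu>1 \<mu>2 \<pi>s = S_ent (\<lambda>x. f x * g x) \<mu>1 \<mu>2
      \<longrightarrow> (\<exists>c0. \<forall>n\<ge>2.
            \<bar>Fent (\<lambda>x. f x * g x) \<mu>1 \<mu>2 \<pi>s - Fent (\<lambda>x. f x * g x) \<mu>1 \<mu>2 (sinkhorn (\<lambda>x. f x * g x) \<mu>1 \<mu>2 n)\<bar>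
               \<le> ereal (c0 * real n powr (- 1 / (2 * p)))
          \<and> Wass q \<pi>s (sinkhorn (\<lambda>x. f x * g x) \<mu>1 \<mu>2 n)
               \<le> ennreal (c0 * real n powr (- 1 / (4 * p * q)))))"
proof -
  obtain \<alpha>1 u where \<alpha>1: "0 < \<alpha>1" "(\<integral>\<^sup>+ x. ennreal (exp (\<alpha>1 * dist u x powr p)) \<partial>\<mu>1) < \<infinity>" using mom1 by blast
  obtain \<alpha>2 v where \<alpha>2: "0 < \<alpha>2" "(\<integral>\<^sup>+ x. ennreal (exp (\<alpha>2 * dist v x powr p)) \<partial>\<mu>2) < \<infinity>" using mom2 by blast
  interpret exp_moment_marginals \<mu>1 \<mu>2 p \<alpha>1 \<alpha>2 u v
    by (rule exp_moment_marginals.intro[OF p P1 P2 \<alpha>1 \<alpha>2])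
  show ?thesis using sinkhorn_tendsto sinkhorn_product_cost_rate by blast
qed

end
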